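(* Let $n\geq 1$ and let $\mathbb{X}=\langle X,\rho\rangle=\dot{\bigcup}_{i<n}\mathbb{X}_i$, where $\mathbb{X}_i$, $i<n$, are pairwise disjoint $L_b$-structures of finite diameter, say all of diameter $\leq m$. Let $\mathcal{T}:=\mathrm{Th}(\mathbb{X})$ and $\mathcal{T}_i:=\mathrm{Th}(\mathbb{X}_i)$ for $i<n$. Then: (a) $X/\rho_{\rm rst}=\{X_i:i<n\}$ and $\rho_{\rm rst}=D_{\varepsilon_m,\mathbb{X}}$. (b) For each $L_b$-structure $\mathbb{Y}$: $\mathbb{Y}\equiv\dot{\bigcup}_{i<n}\mathbb{X}_i$ if and only if $\mathbb{Y}=\dot{\bigcup}_{i<n}\mathbb{Y}_i$ for some (pairwise disjoint) $\mathbb{Y}_i$ with $\mathbb{Y}_i\equiv\mathbb{X}_i$, for $i<n$. (c) For each $L_b$-structure $\mathbb{E}$: $\mathbb{E}\preccurlyeq\dot{\bigcup}_{i<n}\mathbb{X}_i$ if and only if $\mathbb{E}=\dot{\bigcup}_{i<n}\mathbb{E}_i$ for some $\mathbb{E}_i$ with $\mathbb{E}_i\preccurlyeq\mathbb{X}_i$, for $i<n$. (d) $\max\{I(\mathcal{T}_i):i<n\}\leq I(\mathcal{T})\leq\prod_{i<n}I(\mathcal{T}_i)$; thus, $I(\mathcal{T})=1$ if and only if $I(\mathcal{T}_i)=1$ for each $i<n$. (e) If the theories $\mathcal{T}_i$, $i<n$, satisfy Vaught's conjecture, then $\mathcal{T}$ satisfies Vaught's conjecture: with $\kappa:=\prod_{i<n}I(\mathcal{T}_i)$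 we have $I(\mathcal{T})=\kappa$ if $\kappa\in\{1,\omega,\mathfrak{c}\}$, and $I(\mathcal{T})\in[3,\omega)$ otherwise. (f) $\mathcal{T}$ is atomic if and only if the theories $\mathcal{T}_i$, $i<n$, are atomic; in that case $\dot{\bigcup}_{i<n}\mathbb{X}_i^{\rm at}$ is a countable atomic model of $\mathcal{T}$, where $\mathbb{X}_i^{\rm at}$ is a countable atomic model of $\mathcal{T}_i$, for $i<n$. (g) $\mathcal{T}$ is small if and only if the theories $\mathcal{T}_i$, $i<n$, are small; in that case $\dot{\bigcup}_{i<n}\mathbb{X}_i^{\rm sat}$ is a countably saturated model of $\mathcal{T}$, where $\mathbb{X}_i^{\rm sat}$ is a countably saturated model of $\mathcal{T}_i$, for $i<n$.
   Context: $L_b=\langle R\rangle$ is the language with one binary relational symbol. For $L_b$-structures $\mathbb{X}_i=\langle X_i,\rho_i\rangle$ with pairwise disjoint domains, $\dot{\bigcup}_{i}\mathbb{X}_i=\langle\bigcup_i X_i,\bigcup_i\rho_i\rangle$ is the disjoint union; when the domains are not disjoint it is understood up to isomorphism, by replacing the components with isomorphic copies having pairwise disjoint domains. For an $L_b$-structure $\mathbb{X}=\langle X,\rho\rangle$ let $\rho_{\rm rs}:=\Delta_X\cup\rho\cup\rho^{-1}$, where $\Delta_X$ is the diagonal of $X$, and let $\rho_{\rm rst}$ be the transitive closure of $\rho_{\rm rs}$, i.e. the minimal equivalence relation on $X$ containing $\rho$. A path of length $k$ from $x$ to $y$ is a tuple $\langle z_0,\dots,z_k\rangle$ with $z_0=x$,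 $z_k=y$ and $z_i\,\rho_{\rm rs}\,z_{i+1}$ for each $i<k$. $\mathbb{X}$ is of diameter $\leq k$ iff for all $x,y\in X$ there is a path of length $\leq k$ from $x$ to $y$; $\mathbb{X}$ is of finite diameter iff it is of diameter $\leq k$ for some $k\in\mathbb{N}$. Let $\varphi_{\rm rs}(u,v):=\;u=v\lor R(u,v)\lor R(v,u)$ and $$\varepsilon_k(u,v):=\exists w_0,\dots,w_k\;\Big(w_0=u\land w_k=v\land\bigwedge_{i<k}\varphi_{\rm rs}(w_i,w_{i+1})\Big).$$ For a formula $\varphi(v_0,\dots,v_{l-1})$, $D_{\varphi,\mathbb{X}}:=\{\bar x\in X^l:\mathbb{X}\models\varphi[\bar x]\}$. $\equiv$ denotes elementary equivalence and $\preccurlyeq$ elementary substructure. "Countable" means of cardinality at most $\omega$. For a complete theory $\mathcal{T}$, $I(\mathcal{T})$ is the number of isomorphism types of models of $\mathcal{T}$ of cardinality $\omega$; if $\mathcal{T}$ has a finite model, $I(\mathcal{T}):=1$. $\mathfrak{c}=2^{\omega}$. $\mathcal{T}$ satisfies Vaught's conjecture iff $I(\mathcal{T})\leq\omega$ or $I(\mathcal{T})=\mathfrak{c}$. A formula $\varphi(\bar v)$ is complete in $\mathcal{T}$ iff it is consistent with $\mathcal{T}$ and for each formula $\psi(\bar v)$ we have $\mathcal{T}\vdash\varphi\rightarrow\psi$ or $\mathcal{T}\vdash\varphi\rightarrow\neg\psi$; a formula is completable in $\mathcal{T}$ iff it is implied, modulo $\mathcal{T}$, by a complete formula. $\mathcal{T}$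 is atomic iff each formula consistent with $\mathcal{T}$ is completable in $\mathcal{T}$. A model is atomic iff each finite tuple of its elements satisfies a complete formula of its theory. $\mathcal{T}$ is small iff $|\bigcup_{n\in\omega}S_n(\mathcal{T})|\leq\omega$. A model is countably saturated iff it is countable and $\omega$-saturated. *)

theory Defs
  imports
    Main
    "HOL-Library.FuncSet"
    "HOL-Library.Disjoint_Sets"
    "HOL-Library.Countable_Set"
begin

unbundle cardinal_syntax

record 'a struc =
  univ :: "'a set"
  rel :: "('a \<times> 'a) set"

text \<open>As usual in model theory, domains are nonempty.\<close>

definition is_struc :: "'a struc \<Rightarrow> bool" where
  "is_struc A \<longleftrightarrow> univ A \<noteq> {} \<and> rel A \<subseteq> univ A \<times> univ A"

text \<open>The union of the structures \<open>X 0, \<dots>, X (n - 1)\<close>. It is the disjoint union when their domains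
  are pairwise disjoint; that hypothesis is stated separately, as \<open>disjoint_strucs n X\<close>,
  or follows from the context.\<close>

definition dunion :: "nat \<Rightarrow> (nat \<Rightarrow> 'a struc) \<Rightarrow> 'a struc" where
  "dunion n X = \<lparr>univ = (\<Union>i<n. univ (X i)), rel = (\<Union>i<n. rel (X i))\<rparr>"

definition disjoint_strucs :: "nat \<Rightarrow> (nat \<Rightarrow> 'a struc) \<Rightarrow> bool" where
  "disjoint_strucs n X \<longleftrightarrow> disjoint_family_on (\<lambda>i. univ (X i)) {..<n}"

definition rel_rs :: "'a struc \<Rightarrow> ('a \<times> 'a) set" where
  "rel_rs A = Id_on (univ A) \<union> rel A \<union> (rel A)\<inverse>"

definition rel_rst :: "'a struc \<Rightarrow> ('a \<times> 'a) set" where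
  "rel_rst A = (rel_rs A)\<^sup>+"

definition is_path :: "'a struc \<Rightarrow> nat \<Rightarrow> 'a \<Rightarrow> 'a \<Rightarrow> 'a list \<Rightarrow> bool" where
  "is_path A k x y zs \<longleftrightarrow> length zs = Suc k \<and> zs ! 0 = x \<and> zs ! k = y \<and>
     (\<forall>i<k. (zs ! i, zs ! Suc i) \<in> rel_rs A)"

definition diameter_le :: "'a struc \<Rightarrow> nat \<Rightarrow> bool" where
  "diameter_le A k \<longleftrightarrow> (\<forall>x\<in>univ A. \<forall>y\<in>univ A. \<exists>j\<le>k. \<exists>zs. is_path A j x y zs)"

definition iso_struc :: "'a struc \<Rightarrow> 'b struc \<Rightarrow> bool" where
  "iso_struc A B \<longleftrightarrow> (\<exists>f. bij_betw f (univ A) (univ B) \<and>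
     (\<forall>x\<in>univ A. \<forall>y\<in>univ A. (x, y) \<in> rel A \<longleftrightarrow> (f x, f y) \<in> rel B))"

text \<open>The variables are \<open>v\<^sub>0, v\<^sub>1, \<dots>\<close>, represented by their indices.\<close>

datatype form =
    Fls
  | Eq nat nat
  | Rel nat nat
  | Imp form form
  | All nat form

abbreviation Neg :: "form \<Rightarrow> form" where
  "Neg \<phi> \<equiv> Imp \<phi> Fls"

abbreviation Or :: "form \<Rightarrow> form \<Rightarrow> form" where
  "Or \<phi> \<psi> \<equiv> Imp (Neg \<phi>) \<psi>"

abbreviation And :: "form \<Rightarrow> form \<Rightarrow> form" where
  "And \<phi> \<psi> \<equiv> Neg (Imp \<phi> (Neg \<psi>))"

abbreviation Ex :: "nat \<Rightarrow> form \<Rightarrow> form" where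
  "Ex x \<phi> \<equiv> Neg (All x (Neg \<phi>))"

definition Conj :: "form list \<Rightarrow> form" where
  "Conj \<phi>s = foldr And \<phi>s (Neg Fls)"

definition Exs :: "nat list \<Rightarrow> form \<Rightarrow> form" where
  "Exs xs \<phi> = foldr Ex xs \<phi>"

primrec fv :: "form \<Rightarrow> nat set" where
  "fv Fls = {}"
| "fv (Eq x y) = {x, y}"
| "fv (Rel x y) = {x, y}"
| "fv (Imp \<phi> \<psi>) = fv \<phi> \<union> fv \<psi>"
| "fv (All x \<phi>) = fv \<phi> - {x}"

text \<open>\<open>forms l\<close> is the set of formulas \<open>\<phi>(v\<^sub>0, \<dots>, v\<^sub>l\<^sub>-\<^sub>1)\<close>; \<open>forms 0\<close> is the set of sentences.\<close>

definition forms :: "nat \<Rightarrow> form set" where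
  "forms l = {\<phi>. fv \<phi> \<subseteq> {..<l}}"

primrec sat :: "'a struc \<Rightarrow> (nat \<Rightarrow> 'a) \<Rightarrow> form \<Rightarrow> bool" where
  "sat A s Fls \<longleftrightarrow> False"
| "sat A s (Eq x y) \<longleftrightarrow> s x = s y"
| "sat A s (Rel x y) \<longleftrightarrow> (s x, s y) \<in> rel A"
| "sat A s (Imp \<phi> \<psi>) \<longleftrightarrow> (sat A s \<phi> \<longrightarrow> sat A s \<psi>)"
| "sat A s (All x \<phi>) \<longleftrightarrow> (\<forall>a\<in>univ A. sat A (s(x := a)) \<phi>)"

text \<open>Satisfaction of \<open>\<phi> \<in> forms l\<close> by a tuple \<open>xs\<close> of length \<open>l\<close> is \<open>sat A ((!) xs) \<phi>\<close>; the
  unspecified values of \<open>(!) xs\<close> beyond the length of \<open>xs\<close> do not matter.\<close>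

definition defset :: "nat \<Rightarrow> form \<Rightarrow> 'a struc \<Rightarrow> 'a list set" where
  "defset l \<phi> A = {xs. length xs = l \<and> set xs \<subseteq> univ A \<and> sat A ((!) xs) \<phi>}"

definition phi_rs :: "nat \<Rightarrow> nat \<Rightarrow> form" where
  "phi_rs u v = Or (Eq u v) (Or (Rel u v) (Rel v u))"

text \<open>The formula \<open>\<epsilon>\<^sub>k(v\<^sub>0, v\<^sub>1)\<close>; the bound variable \<open>w\<^sub>i\<close> is \<open>v\<^sub>i\<^sub>+\<^sub>2\<close>.\<close>

definition eps :: "nat \<Rightarrow> form" where
  "eps k = Exs (map (\<lambda>i. i + 2) [0..<Suc k])
     (Conj ([Eq (0 + 2) 0, Eq (k + 2) 1] @ map (\<lambda>i. phi_rs (i + 2) (Suc i + 2)) [0..<k]))"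

definition models :: "'a struc \<Rightarrow> form set \<Rightarrow> bool" where
  "models A T \<longleftrightarrow> is_struc A \<and> (\<forall>\<phi>\<in>T. \<forall>s. range s \<subseteq> univ A \<longrightarrow> sat A s \<phi>)"

definition Th :: "'a struc \<Rightarrow> form set" where
  "Th A = {\<phi> \<in> forms 0. \<forall>s. range s \<subseteq> univ A \<longrightarrow> sat A s \<phi>}"

definition elem_equiv :: "'a struc \<Rightarrow> 'b struc \<Rightarrow> bool" where
  "elem_equiv A B \<longleftrightarrow> Th A = Th B"

definition elem_substruc :: "'a struc \<Rightarrow> 'a struc \<Rightarrow> bool" where
  "elem_substruc A B \<longleftrightarrow> is_struc A \<and> is_struc B \<and>
     univ A \<subseteq> univ B \<and> rel A = rel B \<inter> (univ A \<times> univ A) \<and>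
     (\<forall>\<phi> s. range s \<subseteq> univ A \<longrightarrow> (sat A s \<phi> \<longleftrightarrow> sat B s \<phi>))"

text \<open>Since variables are the only terms, substitution replaces the free occurrences of a variable
  \<open>x\<close> by a variable \<open>y\<close>; \<open>free_for x y \<phi>\<close> says that no such occurrence lies in the scope of a
  quantifier binding \<open>y\<close>.\<close>

primrec subst :: "nat \<Rightarrow> nat \<Rightarrow> form \<Rightarrow> form" where
  "subst x y Fls = Fls"
| "subst x y (Eq u v) = Eq (if u = x then y else u) (if v = x then y else v)"
| "subst x y (Rel u v) = Rel (if u = x then y else u) (if v = x then y else v)"
| "subst x y (Imp \<phi> \<psi>) = Imp (subst x y \<phi>) (subst x y \<psi>)"
| "subst x y (All z \<phi>) = (if z = x then All z \<phi> else All z (subst x y \<phi>))"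

primrec free_for :: "nat \<Rightarrow> nat \<Rightarrow> form \<Rightarrow> bool" where
  "free_for x y Fls \<longleftrightarrow> True"
| "free_for x y (Eq u v) \<longleftrightarrow> True"
| "free_for x y (Rel u v) \<longleftrightarrow> True"
| "free_for x y (Imp \<phi> \<psi>) \<longleftrightarrow> free_for x y \<phi> \<and> free_for x y \<psi>"
| "free_for x y (All z \<phi>) \<longleftrightarrow> x \<notin> fv (All z \<phi>) \<or> (z \<noteq> y \<and> free_for x y \<phi>)"

text \<open>A Hilbert calculus in the style of Mendelson for first-order logic with equality. Because
  generalization is unrestricted, the premises \<open>T\<close> are meant to be sentences.\<close>

inductive proves :: "form set \<Rightarrow> form \<Rightarrow> bool" (infix \<open>\<turnstile>\<close> 50) for T where
  premise: "\<phi> \<in> T \<Longrightarrow> T \<turnstile> \<phi>"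
| weakening: "T \<turnstile> Imp \<phi> (Imp \<psi> \<phi>)"
| distribution: "T \<turnstile> Imp (Imp \<phi> (Imp \<psi> \<chi>)) (Imp (Imp \<phi> \<psi>) (Imp \<phi> \<chi>))"
| double_negation: "T \<turnstile> Imp (Neg (Neg \<phi>)) \<phi>"
| universal_instance: "free_for x y \<phi> \<Longrightarrow> T \<turnstile> Imp (All x \<phi>) (subst x y \<phi>)"
| all_imp: "x \<notin> fv \<phi> \<Longrightarrow> T \<turnstile> Imp (All x (Imp \<phi> \<psi>)) (Imp \<phi> (All x \<psi>))"
| eq_refl: "T \<turnstile> Eq x x"
| eq_eq: "T \<turnstile> Imp (Eq x y) (Imp (Eq x z) (Eq y z))"
| eq_rel_left: "T \<turnstile> Imp (Eq x y) (Imp (Rel x z) (Rel y z))"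
| eq_rel_right: "T \<turnstile> Imp (Eq x y) (Imp (Rel z x) (Rel z y))"
| modus_ponens: "T \<turnstile> Imp \<phi> \<psi> \<Longrightarrow> T \<turnstile> \<phi> \<Longrightarrow> T \<turnstile> \<psi>"
| generalization: "T \<turnstile> \<phi> \<Longrightarrow> T \<turnstile> All x \<phi>"

definition consistent_with :: "form set \<Rightarrow> form \<Rightarrow> bool" where
  "consistent_with T \<phi> \<longleftrightarrow> \<not> T \<turnstile> Neg \<phi>"

text \<open>Completeness of a formula depends on the tuple of variables considered, so the number \<open>l\<close> of
  variables is a parameter.\<close>

definition complete_form :: "form set \<Rightarrow> nat \<Rightarrow> form \<Rightarrow> bool" where
  "complete_form T l \<phi> \<longleftrightarrow> \<phi> \<in> forms l \<and> consistent_with T \<phi> \<and>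
     (\<forall>\<psi>\<in>forms l. T \<turnstile> Imp \<phi> \<psi> \<or> T \<turnstile> Imp \<phi> (Neg \<psi>))"

definition completable_form :: "form set \<Rightarrow> nat \<Rightarrow> form \<Rightarrow> bool" where
  "completable_form T l \<phi> \<longleftrightarrow> \<phi> \<in> forms l \<and> (\<exists>\<chi>. complete_form T l \<chi> \<and> T \<turnstile> Imp \<chi> \<phi>)"

definition atomic_theory :: "form set \<Rightarrow> bool" where
  "atomic_theory T \<longleftrightarrow> (\<forall>l. \<forall>\<phi>\<in>forms l. consistent_with T \<phi> \<longrightarrow> completable_form T l \<phi>)"

definition atomic_model :: "'a struc \<Rightarrow> bool" where
  "atomic_model A \<longleftrightarrow> (\<forall>xs. set xs \<subseteq> univ A \<longrightarrow>
     (\<exists>\<phi>. complete_form (Th A) (length xs) \<phi> \<and> sat A ((!) xs) \<phi>))"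

text \<open>The complete \<open>l\<close>-types of \<open>T\<close>: the sets of formulas in \<open>v\<^sub>0, \<dots>, v\<^sub>l\<^sub>-\<^sub>1\<close> all of whose finite
  conjunctions are consistent with \<open>T\<close> and which contain each formula or its negation.\<close>

definition complete_types :: "nat \<Rightarrow> form set \<Rightarrow> form set set" where
  "complete_types l T = {p. p \<subseteq> forms l \<and>
     (\<forall>\<phi>s. set \<phi>s \<subseteq> p \<longrightarrow> consistent_with T (Conj \<phi>s)) \<and>
     (\<forall>\<psi>\<in>forms l. \<psi> \<in> p \<or> Neg \<psi> \<in> p)}"

definition small_theory :: "form set \<Rightarrow> bool" where
  "small_theory T \<longleftrightarrow> countable (\<Union>l. complete_types l T)"

text \<open>The tuple \<open>xs\<close> enumerates a finite set of parameters. A set \<open>p\<close> of formulas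
  \<open>\<phi>(xs, v)\<close>, with \<open>v\<close> the variable of index \<open>length xs\<close>, is consistent with the theory of \<open>A\<close> with
  names for \<open>xs\<close> iff each finite part of \<open>p\<close> is satisfied in \<open>A\<close>.\<close>

definition omega_saturated :: "'a struc \<Rightarrow> bool" where
  "omega_saturated A \<longleftrightarrow> (\<forall>xs p. set xs \<subseteq> univ A \<and> p \<subseteq> forms (Suc (length xs)) \<and>
     (\<forall>q\<subseteq>p. finite q \<longrightarrow> (\<exists>b\<in>univ A. \<forall>\<phi>\<in>q. sat A ((!) (xs @ [b])) \<phi>)) \<longrightarrow>
     (\<exists>b\<in>univ A. \<forall>\<phi>\<in>p. sat A ((!) (xs @ [b])) \<phi>))"

definition countable_atomic_model :: "form set \<Rightarrow> 'a struc \<Rightarrow> bool" where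
  "countable_atomic_model T A \<longleftrightarrow> models A T \<and> countable (univ A) \<and> atomic_model A"

definition countably_saturated_model :: "form set \<Rightarrow> 'a struc \<Rightarrow> bool" where
  "countably_saturated_model T A \<longleftrightarrow> models A T \<and> countable (univ A) \<and> omega_saturated A"

text \<open>Cardinal numbers are cardinal orders, compared by \<open>\<le>o\<close>, \<open><o\<close> and \<open>=o\<close>. Every countable structure
  is isomorphic to one whose domain is a set of natural numbers, so the isomorphism types of
  countable models are represented by classes of such structures.\<close>

definition iso_rel :: "(nat struc \<times> nat struc) set" where
  "iso_rel = {(A, B). is_struc A \<and> is_struc B \<and> iso_struc A B}"

text \<open>In the first case \<open>|{{}}|\<close> is the cardinal 1.\<close>

definition num_models :: "form set \<Rightarrow> nat struc set rel" where
  "num_models T =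
     (if \<exists>A :: nat struc. models A T \<and> finite (univ A) then |{{}}|
      else |{A :: nat struc. models A T \<and> infinite (univ A)} // iso_rel| )"

definition card_Max :: "'a rel set \<Rightarrow> 'a rel" where
  "card_Max K = (SOME r. r \<in> K \<and> (\<forall>s\<in>K. s \<le>o r))"

definition card_Prod :: "nat \<Rightarrow> (nat \<Rightarrow> 'a rel) \<Rightarrow> (nat \<Rightarrow> 'a) rel" where
  "card_Prod n r = |\<Pi>\<^sub>E i\<in>{..<n}. Field (r i)|"

definition continuum :: "(nat \<Rightarrow> bool) rel" where
  "continuum = ctwo ^c natLeq"

definition Vaught_conjecture :: "form set \<Rightarrow> bool" where
  "Vaught_conjecture T \<longleftrightarrow> num_models T \<le>o natLeq \<or> num_models T =o continuum"

end

theory Submission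
  imports Defs
begin

text \<open>The union is governed by two facts. First, truth in a disjoint union decomposes
  (\<open>sat_dunion_dnf\<close>): once it is known in which component each free variable has its value, a
  formula is equivalent to a finite disjunction of conjunctions of formulas, each evaluated in one
  component. Hence the theory of the union, and the type of a tuple in it, depend only on the theories
  of the components and on the types of the parts of the tuple, and unions of elementary substructures
  or of saturated models are again such. Secondly, since the components have diameter at most \<open>m\<close>,
  being in the same component is definable, by paths of length \<open>m\<close>, and formulas can be relativized to
  the component of an element (\<open>sat_rlv\<close>). So everything true in the components can be expressed in
  the union, but only up to a permutation of the components: the formula \<open>master\<close> says that there
  are representatives of the \<open>n\<close> components, in some order, whose components satisfy given formulas. As
  there are only finitely many permutations, finitely many sentences suffice to tell the components
  apart as far as their theories differ (\<open>match_components\<close>, \<open>separating_sentence\<close>); this gives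
  \<open>models_of_union\<close>, the transfer of isolated types between components and union, and with it the
  transfer of atomicity. Smallness is transferred by counting types in the same way.

  The countable models that the theorem asks for all come from one construction (\<open>generic_model\<close>):
  an increasing chain of finitely satisfiable sets of formulas that meets countably many dense families
  has a union that describes a countable term model. The choice of the dense families yields
  the Loewenheim-Skolem theorem, countable atomic models of atomic theories, countable saturated
  models of small theories, and the omitting types theorem.

  For the number of countable models, a countable model of the theory of the union is a union of
  countable models of the \<open>T\<^sub>i\<close>, which bounds that number by the product; and replacing one component
  in a fixed union does not identify nonisomorphic models (\<open>dunion_cancel\<close>), because an isomorphism
  permutes the components and so preserves how many there are of each isomorphism type. If all factors
  are countable or continuum, there is room between the largest factor and the product only if
  the product is finite and not 1. Then some factor is not 1, and by Vaught's theorem that no complete theory has exactly two countable models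
  (\<open>never_two\<close>) it is at least 3.\<close>

section \<open>Satisfaction, renaming of variables and provability\<close>

instance form :: countable
  by countable_datatype

definition asg :: "'a struc \<Rightarrow> (nat \<Rightarrow> 'a) \<Rightarrow> bool" where
  "asg A s \<longleftrightarrow> (\<forall>v. s v \<in> univ A)"

lemma asgD [simp]: "asg A s \<Longrightarrow> s v \<in> univ A"
  and asg_upd [simp]: "asg A s \<Longrightarrow> a \<in> univ A \<Longrightarrow> asg A (s(x := a))"
  and asg_comp [simp]: "asg A s \<Longrightarrow> asg A (s \<circ> f)"
  and range_asg: "range s \<subseteq> univ A \<longleftrightarrow> asg A s"
  by (auto simp: asg_def)

definition valid :: "'a struc \<Rightarrow> form \<Rightarrow> bool" where
  "valid A \<phi> \<longleftrightarrow> (\<forall>s. asg A s \<longrightarrow> sat A s \<phi>)"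

lemma finite_fv [simp]: "finite (fv \<phi>)"
  by (induction \<phi>) auto

lemma sat_cong: "(\<And>v. v \<in> fv \<phi> \<Longrightarrow> s v = t v) \<Longrightarrow> sat A s \<phi> \<longleftrightarrow> sat A t \<phi>"
proof (induction \<phi> arbitrary: s t)
  case (All x \<phi>)
  have "sat A (s(x := a)) \<phi> \<longleftrightarrow> sat A (t(x := a)) \<phi>" for a
    by (rule All.IH) (use All.prems in auto)
  then show ?case by simp
next
  case (Imp \<phi> \<psi>)
  have "sat A s \<phi> \<longleftrightarrow> sat A t \<phi>" "sat A s \<psi> \<longleftrightarrow> sat A t \<psi>"
    by (rule Imp.IH; use Imp.prems in auto)+
  then show ?case by simp
qed auto

lemma sat_cong_forms:
  assumes "\<phi> \<in> forms l" "\<And>v. v < l \<Longrightarrow> s v = t v"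
  shows "sat A s \<phi> \<longleftrightarrow> sat A t \<phi>"
  using assms by (intro sat_cong) (auto simp: forms_def)

lemma sentence_indep: "\<phi> \<in> forms 0 \<Longrightarrow> sat A s \<phi> \<longleftrightarrow> sat A t \<phi>"
  by (rule sat_cong_forms[of _ 0]) auto

lemma is_struc_ex_asg: "is_struc A \<Longrightarrow> \<exists>s. asg A s"
  by (auto simp: is_struc_def asg_def intro: exI[of _ "\<lambda>_. a" for a])

lemma asg_extend:
  assumes "is_struc A" "\<And>j. j < l \<Longrightarrow> s j \<in> univ A"
  shows "\<exists>t. asg A t \<and> (\<forall>j<l. t j = s j)"
proof -
  obtain a where "a \<in> univ A" using assms(1) by (auto simp: is_struc_def)
  with assms(2) show ?thesis
    by (intro exI[of _ "\<lambda>j. if j < l then s j else a"]) (auto simp: asg_def)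
qed

lemma Th_iff: "is_struc A \<Longrightarrow> asg A s \<Longrightarrow> \<phi> \<in> Th A \<longleftrightarrow> \<phi> \<in> forms 0 \<and> sat A s \<phi>"
  unfolding Th_def range_asg using sentence_indep by blast

lemma Th_valid: "\<phi> \<in> Th A \<longleftrightarrow> \<phi> \<in> forms 0 \<and> valid A \<phi>"
  by (auto simp: Th_def valid_def range_asg)

lemma Neg_Th:
  assumes "is_struc A" "\<phi> \<in> forms 0"
  shows "Neg \<phi> \<in> Th A \<longleftrightarrow> \<phi> \<notin> Th A"
proof -
  obtain s where "asg A s" using is_struc_ex_asg[OF assms(1)] by blast
  with assms show ?thesis by (simp add: Th_iff) (simp add: forms_def)
qed

text \<open>Theories of structures are complete, so one inclusion between them forces equality.\<close>

lemma Th_subset_eq: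
  assumes "is_struc A" "is_struc B" "Th A \<subseteq> Th B"
  shows "Th A = Th B"
proof
  show "Th B \<subseteq> Th A"
  proof
    fix \<phi> assume *: "\<phi> \<in> Th B"
    then have "\<phi> \<in> forms 0" by (simp add: Th_def)
    with * assms Neg_Th show "\<phi> \<in> Th A" by (metis subsetD)
  qed
qed (fact assms)

lemma models_Th_iff: "is_struc X \<Longrightarrow> models A (Th X) \<longleftrightarrow> is_struc A \<and> Th A = Th X"
proof -
  assume X: "is_struc X"
  have "models A (Th X) \<longleftrightarrow> is_struc A \<and> Th X \<subseteq> Th A"
    by (auto simp: models_def Th_def)
  then show ?thesis using Th_subset_eq[OF X] by auto
qed

text \<open>A renaming of free variables that avoids capture: each bound variable is replaced by one
  larger than all images of the free variables below the quantifier.\<close>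

primrec ren :: "form \<Rightarrow> (nat \<Rightarrow> nat) \<Rightarrow> form" where
  "ren Fls f = Fls"
| "ren (Eq x y) f = Eq (f x) (f y)"
| "ren (Rel x y) f = Rel (f x) (f y)"
| "ren (Imp \<phi> \<psi>) f = Imp (ren \<phi> f) (ren \<psi> f)"
| "ren (All x \<phi>) f = (let y = Suc (Max (insert 0 (f ` (fv \<phi> - {x})))) in All y (ren \<phi> (f(x := y))))"

lemma fresh_Suc_Max: "finite S \<Longrightarrow> v \<in> S \<Longrightarrow> v < Suc (Max (insert (0::nat) S))"
  by (simp add: less_Suc_eq_le)

lemma sat_ren: "sat A s (ren \<phi> f) \<longleftrightarrow> sat A (s \<circ> f) \<phi>"
proof (induction \<phi> arbitrary: s f)
  case (All x \<phi>)
  define y where "y = Suc (Max (insert 0 (f ` (fv \<phi> - {x}))))"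
  have fresh: "f v < y" if "v \<in> fv \<phi>" "v \<noteq> x" for v
    unfolding y_def using that by (intro fresh_Suc_Max) auto
  have "sat A (s(y := a) \<circ> f(x := y)) \<phi> \<longleftrightarrow> sat A ((s \<circ> f)(x := a)) \<phi>" for a
    by (rule sat_cong) (use fresh in fastforce)
  moreover have "sat A t (ren \<phi> g) \<longleftrightarrow> sat A (t \<circ> g) \<phi>" for t g by (rule All.IH)
  ultimately show "sat A s (ren (All x \<phi>) f) \<longleftrightarrow> sat A (s \<circ> f) (All x \<phi>)"
    by (simp add: y_def[symmetric] Let_def)
qed (auto simp: o_def)

lemma fv_ren: "fv (ren \<phi> f) = f ` fv \<phi>"
proof (induction \<phi> arbitrary: f)
  case (All x \<phi>)
  define y where "y = Suc (Max (insert 0 (f ` (fv \<phi> - {x}))))"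
  have fresh: "f v < y" if "v \<in> fv \<phi>" "v \<noteq> x" for v
    unfolding y_def using that by (intro fresh_Suc_Max) auto
  have "fv (ren (All x \<phi>) f) = (f(x := y)) ` fv \<phi> - {y}"
    using All.IH by (simp add: y_def[symmetric] Let_def)
  also have "\<dots> = f ` (fv \<phi> - {x})" using fresh by (auto split: if_splits)
  finally show ?case by simp
qed auto

lemma sat_Conj: "sat A s (Conj \<phi>s) \<longleftrightarrow> (\<forall>\<phi>\<in>set \<phi>s. sat A s \<phi>)"
  by (induction \<phi>s) (auto simp: Conj_def)

lemma fv_Conj: "fv (Conj \<phi>s) = (\<Union>\<phi>\<in>set \<phi>s. fv \<phi>)"
  by (induction \<phi>s) (auto simp: Conj_def)

lemma fv_Exs: "fv (Exs xs \<phi>) = fv \<phi> - set xs"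
  by (induction xs) (auto simp: Exs_def)

lemma sat_Exs:
  "sat A s (Exs xs \<phi>) \<longleftrightarrow>
   (\<exists>t. (\<forall>v. v \<notin> set xs \<longrightarrow> t v = s v) \<and> (\<forall>v\<in>set xs. t v \<in> univ A) \<and> sat A t \<phi>)"
proof (induction xs arbitrary: s)
  case Nil
  have "t = s" if "\<forall>v. t v = s v" for t :: "nat \<Rightarrow> 'a" using that by blast
  then show ?case by (auto simp: Exs_def)
next
  case (Cons x xs)
  have "sat A s (Exs (x # xs) \<phi>) \<longleftrightarrow> (\<exists>a\<in>univ A. sat A (s(x := a)) (Exs xs \<phi>))"
    by (simp add: Exs_def)
  also have "\<dots> \<longleftrightarrow> (\<exists>a\<in>univ A. \<exists>t. (\<forall>v. v \<notin> set xs \<longrightarrow> t v = (s(x := a)) v) \<and>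
      (\<forall>v\<in>set xs. t v \<in> univ A) \<and> sat A t \<phi>)"
    using Cons.IH by simp
  also have "\<dots> \<longleftrightarrow> (\<exists>t. (\<forall>v. v \<notin> set (x # xs) \<longrightarrow> t v = s v) \<and>
      (\<forall>v\<in>set (x # xs). t v \<in> univ A) \<and> sat A t \<phi>)" (is "?L \<longleftrightarrow> ?R")
  proof
    assume ?L
    then obtain a t where *: "a \<in> univ A" "\<forall>v. v \<notin> set xs \<longrightarrow> t v = (s(x := a)) v"
      "\<forall>v\<in>set xs. t v \<in> univ A" "sat A t \<phi>" by blast
    then have "t x \<in> univ A" by (cases "x \<in> set xs") auto
    with * show ?R by (intro exI[of _ t]) auto
  next
    assume ?R
    then obtain t where "\<forall>v. v \<notin> set (x # xs) \<longrightarrow> t v = s v"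
      "\<forall>v\<in>set (x # xs). t v \<in> univ A" "sat A t \<phi>" by blast
    then show ?L by (intro bexI[of _ "t x"] exI[of _ t]) auto
  qed
  finally show ?case .
qed

text \<open>A variable that is substituted for another one must not be captured; this is what makes the axiom
  of instantiation sound.\<close>

lemma sat_subst: "free_for x y \<phi> \<Longrightarrow> sat A s (subst x y \<phi>) \<longleftrightarrow> sat A (s(x := s y)) \<phi>"
proof (induction \<phi> arbitrary: s)
  case (All z \<phi>)
  show "sat A s (subst x y (All z \<phi>)) \<longleftrightarrow> sat A (s(x := s y)) (All z \<phi>)"
  proof (cases "x \<in> fv (All z \<phi>)")
    case True
    then have "z \<noteq> y" "z \<noteq> x" and f: "free_for x y \<phi>" using All.prems by auto
    have IH: "sat A t (subst x y \<phi>) \<longleftrightarrow> sat A (t(x := t y)) \<phi>" for t by (rule All.IH[OF f])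
    have "sat A (s(z := a)) (subst x y \<phi>) \<longleftrightarrow> sat A ((s(x := s y))(z := a)) \<phi>" for a
      using IH[of "s(z := a)"] \<open>z \<noteq> y\<close> \<open>z \<noteq> x\<close> by (simp add: fun_upd_twist)
    then show ?thesis using \<open>z \<noteq> x\<close> by simp
  next
    case False
    have id: "x \<notin> fv \<psi> \<Longrightarrow> subst x y \<psi> = \<psi>" for \<psi> by (induction \<psi>) auto
    have "subst x y (All z \<phi>) = All z \<phi>" using False by (intro id)
    moreover have "sat A (s(x := s y)) (All z \<phi>) \<longleftrightarrow> sat A s (All z \<phi>)"
      by (rule sat_cong) (use False in auto)
    ultimately show ?thesis by (simp only:)
  qed
qed auto

lemma proves_sound:
  assumes "\<Gamma> \<turnstile> \<phi>" "\<And>\<psi>. \<psi> \<in> \<Gamma> \<Longrightarrow> valid A \<psi>"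
  shows "valid A \<phi>"
  using assms(1)
proof (induction)
  case (premise \<phi>)
  then show ?case using assms(2) by blast
next
  case (universal_instance x y \<phi>)
  then show ?case by (auto simp: valid_def sat_subst)
next
  case (all_imp x \<phi> \<psi>)
  have "sat A (s(x := a)) \<phi> \<longleftrightarrow> sat A s \<phi>" for s a
    by (rule sat_cong) (use all_imp in auto)
  then show ?case by (auto simp: valid_def)
qed (auto simp: valid_def)

text \<open>The theory of a structure is complete, so its consequences are the formulas valid in the
  structure: one closes the formula, finds the closure among the axioms and instantiates each
  quantified variable by itself. Provability from such theories thereby becomes a semantic notion.\<close>

lemma proves_Th_iff: "Th A \<turnstile> \<phi> \<longleftrightarrow> valid A \<phi>"
proof
  show "Th A \<turnstile> \<phi> \<Longrightarrow> valid A \<phi>"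
    by (erule proves_sound) (simp add: Th_valid)
next
  assume v: "valid A \<phi>"
  have id: "subst x x \<psi> = \<psi>" for x \<psi> by (induction \<psi>) auto
  have ff: "free_for x x \<psi>" for x \<psi> by (induction \<psi>) auto
  have strip: "Th A \<turnstile> foldr All xs \<phi> \<Longrightarrow> Th A \<turnstile> \<phi>" for xs
  proof (induction xs)
    case (Cons x xs)
    then show ?case
      using universal_instance[OF ff, of "Th A" x "foldr All xs \<phi>"] id modus_ponens by fastforce
  qed simp
  have val: "valid A (foldr All xs \<phi>)" for xs
    by (induction xs) (use v in \<open>auto simp: valid_def\<close>)
  have fvs: "fv (foldr All xs \<phi>) = fv \<phi> - set xs" for xs by (induction xs) auto
  obtain xs where "set xs = fv \<phi>" using finite_list[OF finite_fv] by blast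
  then have "foldr All xs \<phi> \<in> Th A" using val fvs by (simp add: Th_valid forms_def)
  then show "Th A \<turnstile> \<phi>" by (rule strip[OF premise])
qed

lemma valid_cong_Th: "Th A = Th B \<Longrightarrow> valid A \<phi> \<longleftrightarrow> valid B \<phi>"
  by (simp flip: proves_Th_iff)

lemma consistent_Th_iff: "consistent_with (Th A) \<phi> \<longleftrightarrow> (\<exists>s. asg A s \<and> sat A s \<phi>)"
  by (auto simp: consistent_with_def proves_Th_iff valid_def)

lemma satisfiable_cong_Th:
  "Th A = Th B \<Longrightarrow> (\<exists>s. asg A s \<and> sat A s \<phi>) \<longleftrightarrow> (\<exists>s. asg B s \<and> sat B s \<phi>)"
  by (simp flip: consistent_Th_iff)

lemma complete_form_Th_iff:
  "complete_form (Th A) l \<phi> \<longleftrightarrow> \<phi> \<in> forms l \<and> (\<exists>s. asg A s \<and> sat A s \<phi>) \<and>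
     (\<forall>\<psi>\<in>forms l. valid A (Imp \<phi> \<psi>) \<or> valid A (Imp \<phi> (Neg \<psi>)))"
  by (simp add: complete_form_def consistent_Th_iff proves_Th_iff)

section \<open>Generic constructions and term models\<close>

text \<open>An increasing chain that meets countably many dense families. Ordering by inclusion serves
  both for sets of formulas, whose union describes a model, and for finite partial isomorphisms,
  whose union is an isomorphism.\<close>

lemma generic_chain:
  fixes P :: "'c set set"
  assumes "countable D" "p0 \<in> P"
    and dense: "\<And>d p. d \<in> D \<Longrightarrow> p \<in> P \<Longrightarrow> \<exists>q\<in>P. p \<subseteq> q \<and> q \<in> d"
  obtains c :: "nat \<Rightarrow> 'c set" where "c 0 = p0" "\<And>k. c k \<in> P" "mono c"
    "\<And>d. d \<in> D \<Longrightarrow> \<exists>k. c k \<in> d"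
proof -
  define D' where "D' = insert UNIV D"
  have dense': "\<exists>q\<in>P. p \<subseteq> q \<and> q \<in> d" if "d \<in> D'" "p \<in> P" for d p
    using dense that by (auto simp: D'_def)
  have ne: "D' \<noteq> {}" "countable D'" using assms(1) by (auto simp: D'_def)
  define e where "e = from_nat_into D'"
  have e: "e k \<in> D'" for k unfolding e_def by (rule from_nat_into[OF ne(1)])
  define nx where "nx k p = (SOME q. q \<in> P \<and> p \<subseteq> q \<and> q \<in> e k)" for k p
  have nx: "nx k p \<in> P \<and> p \<subseteq> nx k p \<and> nx k p \<in> e k" if "p \<in> P" for k p
    unfolding nx_def by (rule someI_ex) (use dense'[OF e that] in blast)
  define c where "c = rec_nat p0 nx"
  have c0: "c 0 = p0" and cS: "c (Suc k) = nx k (c k)" for k by (auto simp: c_def)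
  have cP: "c k \<in> P" for k by (induction k) (use assms(2) nx in \<open>auto simp: c0 cS\<close>)
  have "mono c" unfolding mono_iff_le_Suc using nx[OF cP] by (simp add: cS)
  moreover have "\<exists>k. c k \<in> d" if "d \<in> D" for d
  proof -
    have "d \<in> D'" using that by (simp add: D'_def)
    then obtain k where "e k = d"
      using ne unfolding e_def by (metis from_nat_into_surj)
    then show ?thesis using nx[OF cP, of k k] cS by (metis)
  qed
  ultimately show ?thesis using that c0 cP by blast
qed

text \<open>Finite satisfiability in \<open>A\<close> is consistency with the theory of \<open>A\<close>, for sets of formulas in
  infinitely many variables.\<close>

definition fsat :: "'a struc \<Rightarrow> form set \<Rightarrow> bool" where
  "fsat A G \<longleftrightarrow> (\<forall>F\<subseteq>G. finite F \<longrightarrow> (\<exists>s. asg A s \<and> (\<forall>\<phi>\<in>F. sat A s \<phi>)))"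

lemma fsat_mono: "fsat A G \<Longrightarrow> F \<subseteq> G \<Longrightarrow> fsat A F"
  unfolding fsat_def by (meson order_trans)

lemma fsatI_sat: "asg A s \<Longrightarrow> (\<And>\<phi>. \<phi> \<in> G \<Longrightarrow> sat A s \<phi>) \<Longrightarrow> fsat A G"
  unfolding fsat_def by blast

lemma fsatD: "fsat A G \<Longrightarrow> F \<subseteq> G \<Longrightarrow> finite F \<Longrightarrow> \<exists>s. asg A s \<and> (\<forall>\<phi>\<in>F. sat A s \<phi>)"
  unfolding fsat_def by blast

lemma not_fsatE:
  assumes "\<not> fsat A G"
  obtains F where "F \<subseteq> G" "finite F" "\<And>s. asg A s \<Longrightarrow> \<exists>\<phi>\<in>F. \<not> sat A s \<phi>"
proof -
  from assms obtain F where "F \<subseteq> G" "finite F" "\<nexists>s. asg A s \<and> (\<forall>\<phi>\<in>F. sat A s \<phi>)"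
    unfolding fsat_def by metis
  then show ?thesis by (intro that[of F]) metis+
qed

lemma fsat_empty: "is_struc A \<Longrightarrow> fsat A {}"
  using is_struc_ex_asg by (auto simp: fsat_def)

text \<open>A finite set of formulas is one formula, whose satisfiability is an elementary property.\<close>

lemma fsat_cong_Th:
  assumes "Th A = Th B" shows "fsat A G \<longleftrightarrow> fsat B G"
proof -
  have "(\<exists>s. asg A s \<and> (\<forall>\<phi>\<in>F. sat A s \<phi>)) \<longleftrightarrow> (\<exists>s. asg B s \<and> (\<forall>\<phi>\<in>F. sat B s \<phi>))" if "finite F" for F
  proof -
    obtain xs where "set xs = F" using finite_list[OF \<open>finite F\<close>] by blast
    then show ?thesis using satisfiable_cong_Th[OF assms, of "Conj xs"] by (simp add: sat_Conj)
  qed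
  then show ?thesis by (simp add: fsat_def)
qed

lemma fsat_conseq:
  assumes G: "fsat A G" and F: "F \<subseteq> G" "finite F"
    and cons: "\<And>s. asg A s \<Longrightarrow> (\<And>\<psi>. \<psi> \<in> F \<Longrightarrow> sat A s \<psi>) \<Longrightarrow> sat A s \<phi>"
  shows "fsat A (insert \<phi> G)"
  unfolding fsat_def
proof (intro allI impI)
  fix H assume H: "H \<subseteq> insert \<phi> G" "finite H"
  then obtain s where "asg A s" "\<forall>\<psi>\<in>(H - {\<phi>}) \<union> F. sat A s \<psi>"
    using fsatD[OF G, of "(H - {\<phi>}) \<union> F"] F by blast
  with cons show "\<exists>s. asg A s \<and> (\<forall>\<psi>\<in>H. sat A s \<psi>)" by blast
qed

lemma fsat_decide:
  assumes "fsat A G" shows "fsat A (insert \<phi> G) \<or> fsat A (insert (Neg \<phi>) G)"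
proof (rule ccontr)
  assume "\<not> ?thesis"
  then have n: "\<not> fsat A (insert \<phi> G)" "\<not> fsat A (insert (Neg \<phi>) G)" by auto
  obtain F where F: "F \<subseteq> insert \<phi> G" "finite F" "\<And>s. asg A s \<Longrightarrow> \<exists>\<psi>\<in>F. \<not> sat A s \<psi>"
    using not_fsatE[OF n(1)] by metis
  obtain H where H: "H \<subseteq> insert (Neg \<phi>) G" "finite H" "\<And>s. asg A s \<Longrightarrow> \<exists>\<psi>\<in>H. \<not> sat A s \<psi>"
    using not_fsatE[OF n(2)] by metis
  obtain s where s: "asg A s" "\<forall>\<psi>\<in>(F - {\<phi>}) \<union> (H - {Neg \<phi>}). sat A s \<psi>"
    using fsatD[OF assms, of "(F - {\<phi>}) \<union> (H - {Neg \<phi>})"] F(1,2) H(1,2) by blast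
  obtain \<psi> where \<psi>: "\<psi> \<in> F" "\<not> sat A s \<psi>" using F(3)[OF s(1)] by blast
  obtain \<chi> where \<chi>: "\<chi> \<in> H" "\<not> sat A s \<chi>" using H(3)[OF s(1)] by blast
  have "\<psi> = \<phi>" using \<psi> s(2) by blast
  moreover have "\<chi> = Neg \<phi>" using \<chi> s(2) by blast
  ultimately show False using \<psi> \<chi> by simp
qed

text \<open>Henkin's construction, with the variables in the role of the constants: the elements of the
  model are the variables, identified when \<open>\<Gamma>\<close> says that they are equal. Finite satisfiability in \<open>A\<close>
  makes \<open>\<Gamma>\<close> closed under consequences that hold in \<open>A\<close>.\<close>

lemma term_model:
  fixes A :: "'a struc"
  assumes A: "is_struc A" and G: "fsat A \<Gamma>"
    and dec: "\<And>\<phi>. \<phi> \<in> \<Gamma> \<or> Neg \<phi> \<in> \<Gamma>"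
    and henkin: "\<And>x \<phi>. Neg (All x \<phi>) \<in> \<Gamma> \<Longrightarrow> \<exists>y. Neg (ren \<phi> (id(x := y))) \<in> \<Gamma>"
  obtains B :: "nat struc" and s where "is_struc B" "range s = univ B" "\<And>\<phi>. sat B s \<phi> \<longleftrightarrow> \<phi> \<in> \<Gamma>"
proof -
  have nc: "\<not> (\<phi> \<in> \<Gamma> \<and> Neg \<phi> \<in> \<Gamma>)" for \<phi>
    using fsatD[OF G, of "{\<phi>, Neg \<phi>}"] by auto
  have cons: "\<phi> \<in> \<Gamma>" if F: "F \<subseteq> \<Gamma>" "finite F" "\<And>s. asg A s \<Longrightarrow> \<forall>\<psi>\<in>F. sat A s \<psi> \<Longrightarrow> sat A s \<phi>" for F \<phi>
  proof (rule ccontr)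
    assume "\<phi> \<notin> \<Gamma>"
    with dec have "Neg \<phi> \<in> \<Gamma>" by blast
    then obtain s where "asg A s" "\<forall>\<psi>\<in>insert (Neg \<phi>) F. sat A s \<psi>"
      using fsatD[OF G, of "insert (Neg \<phi>) F"] F by blast
    with F(3)[of s] show False by auto
  qed
  have eq_refl: "Eq x x \<in> \<Gamma>" for x by (rule cons[of "{}"]) auto
  have eq_sym: "Eq y x \<in> \<Gamma>" if "Eq x y \<in> \<Gamma>" for x y
    by (rule cons[of "{Eq x y}"]) (use that in auto)
  have eq_trans: "Eq x z \<in> \<Gamma>" if "Eq x y \<in> \<Gamma>" "Eq y z \<in> \<Gamma>" for x y z
    by (rule cons[of "{Eq x y, Eq y z}"]) (use that in auto)
  have eq_rel: "Rel x' y' \<in> \<Gamma>" if "Eq x x' \<in> \<Gamma>" "Eq y y' \<in> \<Gamma>" "Rel x y \<in> \<Gamma>" for x y x' y'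
    by (rule cons[of "{Eq x x', Eq y y', Rel x y}"]) (use that in auto)
  define s where "s x = (LEAST y. Eq x y \<in> \<Gamma>)" for x
  have s: "Eq x (s x) \<in> \<Gamma>" for x unfolding s_def by (rule LeastI[of _ x]) (rule eq_refl)
  have s_eq: "s x = s y \<longleftrightarrow> Eq x y \<in> \<Gamma>" for x y
  proof
    assume "s x = s y" then show "Eq x y \<in> \<Gamma>" using s eq_sym eq_trans by metis
  next
    assume "Eq x y \<in> \<Gamma>"
    then have "(\<lambda>z. Eq x z \<in> \<Gamma>) = (\<lambda>z. Eq y z \<in> \<Gamma>)" using eq_sym eq_trans by blast
    then show "s x = s y" by (simp add: s_def)
  qed
  define B where "B = \<lparr>univ = range s, rel = {(s x, s y) | x y. Rel x y \<in> \<Gamma>}\<rparr>"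
  have uB: "univ B = range s" by (simp add: B_def)
  have B: "is_struc B" by (auto simp: is_struc_def B_def)
  have s_rel: "(s x, s y) \<in> rel B \<longleftrightarrow> Rel x y \<in> \<Gamma>" for x y
    unfolding B_def using s_eq eq_rel by (auto simp: eq_commute)
  have all_upd: "sat A (s' \<circ> f) (All x \<phi>) \<Longrightarrow> asg A s' \<Longrightarrow> sat A (s' \<circ> f(x := y)) \<phi>" for s' f x y \<phi>
  proof -
    assume "sat A (s' \<circ> f) (All x \<phi>)" "asg A s'"
    then have "sat A ((s' \<circ> f)(x := s' y)) \<phi>" by simp
    moreover have "(s' \<circ> f)(x := s' y) = s' \<circ> f(x := y)" by (rule ext) simp
    ultimately show "sat A (s' \<circ> f(x := y)) \<phi>" by (simp only:)
  qed
  \<comment> \<open>the renaming \<open>f\<close> gives the induction hypothesis for all values of the quantified variable\<close>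
  have main: "sat B (s \<circ> f) \<phi> \<longleftrightarrow> ren \<phi> f \<in> \<Gamma>" for f \<phi>
  proof (induction \<phi> arbitrary: f)
    case Fls
    then show ?case using nc cons[of "{Fls}"] by auto
  next
    case (Imp \<phi> \<psi>)
    have "Imp (ren \<phi> f) (ren \<psi> f) \<in> \<Gamma> \<longleftrightarrow> (ren \<phi> f \<in> \<Gamma> \<longrightarrow> ren \<psi> f \<in> \<Gamma>)"
    proof
      assume i: "Imp (ren \<phi> f) (ren \<psi> f) \<in> \<Gamma>"
      show "ren \<phi> f \<in> \<Gamma> \<longrightarrow> ren \<psi> f \<in> \<Gamma>"
      proof
        assume "ren \<phi> f \<in> \<Gamma>"
        with i show "ren \<psi> f \<in> \<Gamma>"
          by (intro cons[of "{Imp (ren \<phi> f) (ren \<psi> f), ren \<phi> f}"]) auto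
      qed
    next
      assume "ren \<phi> f \<in> \<Gamma> \<longrightarrow> ren \<psi> f \<in> \<Gamma>"
      then consider "Neg (ren \<phi> f) \<in> \<Gamma>" | "ren \<psi> f \<in> \<Gamma>" using dec by blast
      then show "Imp (ren \<phi> f) (ren \<psi> f) \<in> \<Gamma>"
      proof cases
        case 1
        then show ?thesis by (intro cons[of "{Neg (ren \<phi> f)}"]) auto
      next
        case 2
        then show ?thesis by (intro cons[of "{ren \<psi> f}"]) auto
      qed
    qed
    moreover have "sat B (s \<circ> f) \<phi> \<longleftrightarrow> ren \<phi> f \<in> \<Gamma>" "sat B (s \<circ> f) \<psi> \<longleftrightarrow> ren \<psi> f \<in> \<Gamma>"
      by (rule Imp.IH)+
    ultimately show "sat B (s \<circ> f) (Imp \<phi> \<psi>) \<longleftrightarrow> ren (Imp \<phi> \<psi>) f \<in> \<Gamma>"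
      by (simp only: sat.simps ren.simps)
  next
    case (All x \<phi>)
    have upd: "(s \<circ> f)(x := s y) = s \<circ> f(x := y)" for y by (rule ext) simp
    have IH: "sat B (s \<circ> g) \<phi> \<longleftrightarrow> ren \<phi> g \<in> \<Gamma>" for g by (rule All.IH)
    have "sat B (s \<circ> f) (All x \<phi>) \<longleftrightarrow> (\<forall>y. sat B ((s \<circ> f)(x := s y)) \<phi>)"
      using uB by simp
    also have "\<dots> \<longleftrightarrow> (\<forall>y. ren \<phi> (f(x := y)) \<in> \<Gamma>)"
      by (simp only: upd IH)
    also have "\<dots> \<longleftrightarrow> ren (All x \<phi>) f \<in> \<Gamma>"
    proof (rule iffI)
      assume r: "ren (All x \<phi>) f \<in> \<Gamma>"
      show "\<forall>y. ren \<phi> (f(x := y)) \<in> \<Gamma>"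
      proof
        fix y show "ren \<phi> (f(x := y)) \<in> \<Gamma>"
        proof (rule cons[of "{ren (All x \<phi>) f}"])
          fix s' assume "asg A s'" "\<forall>\<psi>\<in>{ren (All x \<phi>) f}. sat A s' \<psi>"
          then have "sat A s' (ren (All x \<phi>) f)" by blast
          with \<open>asg A s'\<close> show "sat A s' (ren \<phi> (f(x := y)))"
            using all_upd[of s' f x \<phi> y] unfolding sat_ren by blast
        qed (use r in auto)
      qed
    next
      assume r: "\<forall>y. ren \<phi> (f(x := y)) \<in> \<Gamma>"
      show "ren (All x \<phi>) f \<in> \<Gamma>"
      proof (rule ccontr)
        assume "ren (All x \<phi>) f \<notin> \<Gamma>"
        with dec have n: "Neg (ren (All x \<phi>) f) \<in> \<Gamma>" by blast
        define z where "z = Suc (Max (insert 0 (f ` (fv \<phi> - {x}))))"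
        have fresh: "f v < z" if "v \<in> fv \<phi>" "v \<noteq> x" for v
          unfolding z_def using that by (intro fresh_Suc_Max) auto
        have "ren (All x \<phi>) f = All z (ren \<phi> (f(x := z)))" by (simp add: z_def Let_def)
        then obtain y where y: "Neg (ren (ren \<phi> (f(x := z))) (id(z := y))) \<in> \<Gamma>"
          using henkin n by metis
        have "sat A (s' \<circ> id(z := y) \<circ> f(x := z)) \<phi> \<longleftrightarrow> sat A (s' \<circ> f(x := y)) \<phi>" for s'
          by (rule sat_cong) (use fresh in fastforce)
        then have "Neg (ren \<phi> (f(x := y))) \<in> \<Gamma>"
          using y by (intro cons[of "{Neg (ren (ren \<phi> (f(x := z))) (id(z := y)))}"])
            (simp_all add: sat_ren)
        with r nc show False by blast
      qed
    qed
    finally show "sat B (s \<circ> f) (All x \<phi>) \<longleftrightarrow> ren (All x \<phi>) f \<in> \<Gamma>" .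
  qed (auto simp: s_eq s_rel)
  have "sat B s \<phi> \<longleftrightarrow> \<phi> \<in> \<Gamma>" for \<phi>
  proof -
    have "sat B s \<phi> \<longleftrightarrow> ren \<phi> id \<in> \<Gamma>" using main[of id] by simp
    also have "\<dots> \<longleftrightarrow> \<phi> \<in> \<Gamma>"
    proof
      show "ren \<phi> id \<in> \<Gamma> \<Longrightarrow> \<phi> \<in> \<Gamma>" by (intro cons[of "{ren \<phi> id}"]) (simp_all add: sat_ren)
      show "\<phi> \<in> \<Gamma> \<Longrightarrow> ren \<phi> id \<in> \<Gamma>" by (intro cons[of "{\<phi>}"]) (simp_all add: sat_ren)
    qed
    finally show ?thesis .
  qed
  with that[OF B uB[symmetric]] show ?thesis by blast
qed

text \<open>Conditions are finitely satisfiable sets of formulas in finitely many variables. The families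
  of conditions that decide a formula or contain a witness for an existential formula are dense
  anyway, so a generic union is the diagram of a countable model; further dense families
  control which types that model realizes.\<close>

definition conditions :: "'a struc \<Rightarrow> form set set \<Rightarrow> bool" where
  "conditions A P \<longleftrightarrow> (\<forall>p\<in>P. fsat A p \<and> (\<exists>l. p \<subseteq> forms l) \<and>
     (\<forall>\<phi>. fsat A (insert \<phi> p) \<longrightarrow> insert \<phi> p \<in> P))"

lemma generic_model:
  fixes A :: "'a struc"
  assumes A: "is_struc A" and P: "conditions A P" and p0: "p0 \<in> P" and D: "countable D"
    and dense: "\<And>d p. d \<in> D \<Longrightarrow> p \<in> P \<Longrightarrow> \<exists>q\<in>P. p \<subseteq> q \<and> q \<in> d"
  obtains B :: "nat struc" and s where "is_struc B" "range s = univ B" "Th B = Th A"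
    "\<And>\<phi>. \<phi> \<in> p0 \<Longrightarrow> sat B s \<phi>" "\<And>d. d \<in> D \<Longrightarrow> \<exists>q\<in>d. q \<in> P \<and> (\<forall>\<phi>\<in>q. sat B s \<phi>)"
proof -
  \<comment> \<open>\<open>D1\<close> decides every formula, \<open>D2\<close> provides witnesses\<close>
  define D1 where "D1 = range (\<lambda>\<phi>. {q. \<phi> \<in> q \<or> Neg \<phi> \<in> q})"
  define D2 where "D2 = range (\<lambda>(x, \<phi>). {q. All x \<phi> \<in> q \<or> (\<exists>y. Neg (ren \<phi> (id(x := y))) \<in> q)})"
  have cnt: "countable (D \<union> D1 \<union> D2)" using D by (auto simp: D1_def D2_def)
  have dec: "\<exists>q\<in>P. p \<subseteq> q \<and> (\<phi> \<in> q \<or> Neg \<phi> \<in> q)" if "p \<in> P" for p \<phi>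
    using fsat_decide[of A p \<phi>] P that unfolding conditions_def by (metis insertI1 subset_insertI)
  have dns: "\<exists>q\<in>P. p \<subseteq> q \<and> q \<in> d" if d: "d \<in> D \<union> D1 \<union> D2" and p: "p \<in> P" for d p
  proof -
    have "\<exists>q\<in>P. p \<subseteq> q \<and> q \<in> d" if "d \<in> D2"
    proof -
      from that obtain x \<phi> where d: "d = {q. All x \<phi> \<in> q \<or> (\<exists>y. Neg (ren \<phi> (id(x := y))) \<in> q)}"
        by (auto simp: D2_def)
      obtain q where q: "q \<in> P" "p \<subseteq> q" "All x \<phi> \<in> q \<or> Neg (All x \<phi>) \<in> q" using dec[OF p] by blast
      show ?thesis
      proof (cases "All x \<phi> \<in> q")
        case True then show ?thesis using q d by blast
      next
        case False
        with q have nq: "Neg (All x \<phi>) \<in> q" by blast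
        obtain l where l: "q \<subseteq> forms l" and fq: "fsat A q" using P q(1) by (auto simp: conditions_def)
        \<comment> \<open>the members of \<open>q\<close> do not contain the variable \<open>l\<close>, so it can name a witness\<close>
        define y where "y = l"
        let ?\<psi> = "Neg (ren \<phi> (id(x := y)))"
        have "fsat A (insert ?\<psi> q)"
          unfolding fsat_def
        proof (intro allI impI)
          fix H assume H: "H \<subseteq> insert ?\<psi> q" "finite H"
          then obtain t where t: "asg A t" "\<forall>\<psi>\<in>insert (Neg (All x \<phi>)) (H - {?\<psi>}). sat A t \<psi>"
            using fsatD[OF fq, of "insert (Neg (All x \<phi>)) (H - {?\<psi>})"] nq by blast
          then obtain a where a: "a \<in> univ A" "\<not> sat A (t(x := a)) \<phi>" by auto
          have "Neg (All x \<phi>) \<in> forms l" using nq l by blast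
          then have "fv \<phi> - {x} \<subseteq> {..<l}" by (simp add: forms_def)
          then have "sat A (t(y := a) \<circ> id(x := y)) \<phi> \<longleftrightarrow> sat A (t(x := a)) \<phi>"
            by (intro sat_cong) (auto simp: y_def)
          then have "sat A (t(y := a)) ?\<psi>" using a by (simp add: sat_ren)
          moreover have "sat A (t(y := a)) \<psi>" if "\<psi> \<in> H" "\<psi> \<noteq> ?\<psi>" for \<psi>
          proof -
            have "\<psi> \<in> forms l" using that H l by blast
            then have "sat A (t(y := a)) \<psi> \<longleftrightarrow> sat A t \<psi>"
              by (rule sat_cong_forms) (simp add: y_def)
            then show ?thesis using t that by blast
          qed
          ultimately have "\<forall>\<psi>\<in>H. sat A (t(y := a)) \<psi>" by blast
          moreover have "asg A (t(y := a))" using t(1) a(1) by simp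
          ultimately show "\<exists>s. asg A s \<and> (\<forall>\<psi>\<in>H. sat A s \<psi>)" by blast
        qed
        then have "insert ?\<psi> q \<in> P" using P q(1) by (auto simp: conditions_def)
        then show ?thesis using q(2) d by (intro bexI[of _ "insert ?\<psi> q"]) auto
      qed
    qed
    moreover have "\<exists>q\<in>P. p \<subseteq> q \<and> q \<in> d" if "d \<in> D1" using that dec[OF p] by (auto simp: D1_def)
    ultimately show ?thesis using d dense p by blast
  qed
  obtain c :: "nat \<Rightarrow> form set" where c: "c 0 = p0" "\<And>k. c k \<in> P" "mono c"
    and cD: "\<And>d. d \<in> D \<union> D1 \<union> D2 \<Longrightarrow> \<exists>k. c k \<in> d"
    using generic_chain[OF cnt p0 dns] by metis
  define \<Gamma> where "\<Gamma> = (\<Union>k. c k)"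
  have sub: "c k \<subseteq> \<Gamma>" for k by (auto simp: \<Gamma>_def)
  have fG: "fsat A \<Gamma>"
    unfolding fsat_def
  proof (intro allI impI)
    fix F assume "F \<subseteq> \<Gamma>" "finite F"
    from \<open>finite F\<close> \<open>F \<subseteq> \<Gamma>\<close> have "\<exists>k. F \<subseteq> c k"
    proof (induction F rule: finite_induct)
      case (insert \<phi> F)
      then obtain k j where "F \<subseteq> c k" "\<phi> \<in> c j" by (auto simp: \<Gamma>_def)
      then have "insert \<phi> F \<subseteq> c (max k j)"
        using monoD[OF c(3) max.cobounded1[of k j]] monoD[OF c(3) max.cobounded2[of j k]] by auto
      then show ?case by blast
    qed simp
    then obtain k where "F \<subseteq> c k" by blast
    moreover have "fsat A (c k)" using c(2) P by (auto simp: conditions_def)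
    ultimately show "\<exists>s. asg A s \<and> (\<forall>\<phi>\<in>F. sat A s \<phi>)" using fsatD \<open>finite F\<close> by blast
  qed
  have decG: "\<phi> \<in> \<Gamma> \<or> Neg \<phi> \<in> \<Gamma>" for \<phi>
    using cD[of "{q. \<phi> \<in> q \<or> Neg \<phi> \<in> q}"] sub by (auto simp: D1_def)
  moreover have "\<exists>y. Neg (ren \<phi> (id(x := y))) \<in> \<Gamma>" if "Neg (All x \<phi>) \<in> \<Gamma>" for x \<phi>
  proof -
    have "All x \<phi> \<notin> \<Gamma>" using that fsatD[OF fG, of "{All x \<phi>, Neg (All x \<phi>)}"] by auto
    moreover have "{q. All x \<phi> \<in> q \<or> (\<exists>y. Neg (ren \<phi> (id(x := y))) \<in> q)} \<in> D2"
      by (auto simp: D2_def)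
    ultimately show ?thesis
      using cD[of "{q. All x \<phi> \<in> q \<or> (\<exists>y. Neg (ren \<phi> (id(x := y))) \<in> q)}"] sub by blast
  qed
  ultimately obtain B :: "nat struc" and s
    where B: "is_struc B" "range s = univ B" "\<And>\<phi>. sat B s \<phi> \<longleftrightarrow> \<phi> \<in> \<Gamma>"
    using term_model[OF A fG] by blast
  have asB: "asg B s" using B(2) by (simp flip: range_asg)
  have "Th B \<subseteq> Th A"
  proof
    fix \<phi> assume "\<phi> \<in> Th B"
    then have "\<phi> \<in> forms 0" "\<phi> \<in> \<Gamma>" using Th_iff[OF B(1) asB] B(3) by auto
    moreover from this obtain t where "asg A t" "sat A t \<phi>" using fsatD[OF fG, of "{\<phi>}"] by auto
    ultimately show "\<phi> \<in> Th A" using Th_iff[OF A] by blast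
  qed
  then have "Th B = Th A" by (rule Th_subset_eq[OF B(1) A])
  moreover have "sat B s \<phi>" if "\<phi> \<in> p0" for \<phi> using that sub[of 0] c(1) B(3) by auto
  moreover have "\<exists>q\<in>d. q \<in> P \<and> (\<forall>\<phi>\<in>q. sat B s \<phi>)" if "d \<in> D" for d
    using cD[of d] that c(2) sub B(3) by blast
  ultimately show ?thesis using that[OF B(1,2)] by blast
qed

section \<open>Countable models with prescribed types\<close>

lemma forms_mono: "l \<le> l' \<Longrightarrow> forms l \<subseteq> forms l'"
  by (auto simp: forms_def)

lemma finite_subset_forms: "finite F \<Longrightarrow> \<exists>l. F \<subseteq> forms l"
proof (induction rule: finite_induct)
  case (insert \<phi> F)
  then obtain l where l: "F \<subseteq> forms l" by blast
  have "\<phi> \<in> forms (Suc (Max (insert 0 (fv \<phi>))))"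
    using fresh_Suc_Max[OF finite_fv] by (auto simp: forms_def)
  then have "insert \<phi> F \<subseteq> forms (max l (Suc (Max (insert 0 (fv \<phi>)))))"
    using l forms_mono[OF max.cobounded1] forms_mono[OF max.cobounded2] by blast
  then show ?case by blast
qed simp

text \<open>The conditions that extend a fixed set \<open>p\<close> by finitely many formulas. Their finite parts can be
  summarized by one formula, which is what atomic models and omitted types need.\<close>

definition fin_ext :: "'a struc \<Rightarrow> form set \<Rightarrow> form set set" where
  "fin_ext A p = {q. fsat A q \<and> (\<exists>F. finite F \<and> q = p \<union> F)}"

lemma conditions_fin_ext:
  assumes "p \<subseteq> forms k" shows "conditions A (fin_ext A p)"
  unfolding conditions_def
proof (intro ballI conjI allI impI)
  fix q assume "q \<in> fin_ext A p"
  then obtain F where q: "fsat A q" "finite F" "q = p \<union> F" by (auto simp: fin_ext_def)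
  show "fsat A q" by fact
  obtain l where "F \<subseteq> forms l" using finite_subset_forms q by blast
  then have "q \<subseteq> forms (max k l)"
    using q(3) assms forms_mono[OF max.cobounded1, of k l] forms_mono[OF max.cobounded2, of l k] by blast
  then show "\<exists>l. q \<subseteq> forms l" ..
  fix \<phi> assume "fsat A (insert \<phi> q)"
  moreover have "finite (insert \<phi> F)" "insert \<phi> q = p \<union> insert \<phi> F" using q by auto
  ultimately show "insert \<phi> q \<in> fin_ext A p" unfolding fin_ext_def by blast
qed

lemma fin_ext_base: "fsat A p \<Longrightarrow> p \<in> fin_ext A p"
  unfolding fin_ext_def by (auto intro: exI[of _ "{}"])

lemma countable_model_realizing:
  assumes "is_struc A" "fsat A p" "p \<subseteq> forms k"
  obtains B :: "nat struc" and s where "is_struc B" "Th B = Th A" "asg B s" "\<And>\<phi>. \<phi> \<in> p \<Longrightarrow> sat B s \<phi>"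
proof -
  obtain B :: "nat struc" and s where B: "is_struc B" "range s = univ B" "Th B = Th A"
    "\<And>\<phi>. \<phi> \<in> p \<Longrightarrow> sat B s \<phi>"
    using generic_model[OF assms(1) conditions_fin_ext[OF assms(3)] fin_ext_base[OF assms(2)], of "{}"]
    by auto
  moreover have "asg B s" using B(2) by (simp flip: range_asg)
  ultimately show ?thesis using that by blast
qed

lemma Lowenheim_Skolem:
  assumes "is_struc A" obtains B :: "nat struc" where "is_struc B" "Th B = Th A"
  by (rule countable_model_realizing[OF assms fsat_empty[OF assms], of 0]) auto

definition tp :: "nat \<Rightarrow> 'a struc \<Rightarrow> (nat \<Rightarrow> 'a) \<Rightarrow> form set" where
  "tp l A s = {\<phi> \<in> forms l. sat A s \<phi>}"

lemma tp_cong: "(\<And>j. j < l \<Longrightarrow> s j = t j) \<Longrightarrow> tp l A s = tp l A t"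
  unfolding tp_def using sat_cong_forms by blast

lemma Neg_forms [simp]: "Neg \<phi> \<in> forms l \<longleftrightarrow> \<phi> \<in> forms l"
  by (simp add: forms_def)

lemma complete_types_Th_iff:
  assumes A: "is_struc A"
  shows "p \<in> complete_types l (Th A) \<longleftrightarrow>
    p \<subseteq> forms l \<and> fsat A p \<and> (\<forall>\<phi>\<in>forms l. \<phi> \<in> p \<or> Neg \<phi> \<in> p)"
proof -
  have "(\<forall>\<phi>s. set \<phi>s \<subseteq> p \<longrightarrow> consistent_with (Th A) (Conj \<phi>s)) \<longleftrightarrow> fsat A p"
    unfolding fsat_def consistent_Th_iff sat_Conj by (metis finite_list finite_set)
  then show ?thesis unfolding complete_types_def by auto
qed

lemma tp_complete_type:
  assumes "is_struc A" "is_struc B" "Th B = Th A" "\<And>j. j < l \<Longrightarrow> s j \<in> univ B"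
  shows "tp l B s \<in> complete_types l (Th A)"
proof -
  obtain t where t: "asg B t" "\<forall>j<l. t j = s j" using asg_extend[of B l s, OF assms(2,4)] by blast
  have e: "tp l B s = tp l B t" by (rule tp_cong) (simp add: t(2))
  have "fsat B (tp l B t)" by (rule fsatI_sat[OF t(1)]) (simp add: tp_def)
  then have "fsat A (tp l B t)" using fsat_cong_Th[OF assms(3)] by blast
  then show ?thesis unfolding e complete_types_Th_iff[OF assms(1)] by (auto simp: tp_def)
qed

lemma complete_type_maximal:
  assumes A: "is_struc A" and "p \<in> complete_types l (Th A)" "q \<in> complete_types l (Th A)" "p \<subseteq> q"
  shows "p = q"
proof -
  have "\<phi> \<in> p" if "\<phi> \<in> q" for \<phi>
  proof (rule ccontr)
    assume "\<phi> \<notin> p"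
    then have "Neg \<phi> \<in> q" using assms that unfolding complete_types_Th_iff[OF A] by blast
    moreover have "fsat A q" using assms by (simp add: complete_types_Th_iff)
    ultimately show False using fsatD[of A q "{\<phi>, Neg \<phi>}"] that by auto
  qed
  then show ?thesis using assms(4) by blast
qed

lemma complete_type_realized:
  assumes A: "is_struc A" and p: "p \<in> complete_types l (Th A)"
  obtains B :: "nat struc" and s where "is_struc B" "Th B = Th A" "asg B s" "p = tp l B s"
proof -
  have p': "p \<subseteq> forms l" "fsat A p" using p by (simp_all add: complete_types_Th_iff[OF A])
  obtain B :: "nat struc" and s where B: "is_struc B" "Th B = Th A" "asg B s" "\<And>\<phi>. \<phi> \<in> p \<Longrightarrow> sat B s \<phi>"
    using countable_model_realizing[OF A p'(2,1)] by metis
  have "p \<subseteq> tp l B s" using B(4) p' by (auto simp: tp_def)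
  then have "p = tp l B s"
    using B(3) by (intro complete_type_maximal[OF A p tp_complete_type[OF A B(1,2)]]) simp_all
  then show ?thesis by (rule that[OF B(1-3)])
qed

lemma extend_to_complete_type:
  assumes A: "is_struc A" and "fsat A p" "p \<subseteq> forms l"
  obtains q where "q \<in> complete_types l (Th A)" "p \<subseteq> q"
proof -
  obtain B :: "nat struc" and s where B: "is_struc B" "Th B = Th A" "asg B s" "\<And>\<phi>. \<phi> \<in> p \<Longrightarrow> sat B s \<phi>"
    using countable_model_realizing[OF assms] by metis
  have "tp l B s \<in> complete_types l (Th A)" using B(3) by (intro tp_complete_type[OF A B(1,2)]) simp
  moreover have "p \<subseteq> tp l B s" using B(4) assms(3) by (auto simp: tp_def)
  ultimately show ?thesis using that by blast
qed

text \<open>A complete formula has the same consequences in all models of the theory.\<close>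

lemma complete_form_same_sat:
  assumes \<chi>: "complete_form T l \<chi>" and "Th A = T" "Th B = T" "is_struc A" "is_struc B"
    and s: "\<And>j. j < l \<Longrightarrow> s j \<in> univ A" "sat A s \<chi>"
    and t: "\<And>j. j < l \<Longrightarrow> t j \<in> univ B" "sat B t \<chi>"
    and \<psi>: "\<psi> \<in> forms l"
  shows "sat A s \<psi> \<longleftrightarrow> sat B t \<psi>"
proof -
  obtain s' where s': "asg A s'" "\<forall>j<l. s' j = s j" using asg_extend[of A l s, OF assms(4) s(1)] by blast
  obtain t' where t': "asg B t'" "\<forall>j<l. t' j = t j" using asg_extend[of B l t, OF assms(5) t(1)] by blast
  have \<chi>l: "\<chi> \<in> forms l" using \<chi> by (simp add: complete_form_def)
  have A: "sat A s \<phi> \<longleftrightarrow> sat A s' \<phi>" and B: "sat B t \<phi> \<longleftrightarrow> sat B t' \<phi>" if "\<phi> \<in> forms l" for \<phi>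
    using s'(2) t'(2) by (auto intro!: sat_cong_forms[OF that])
  have "valid A \<phi> \<longleftrightarrow> valid B \<phi>" for \<phi> using assms(2,3) by (intro valid_cong_Th) simp
  moreover have "valid A (Imp \<chi> \<psi>) \<or> valid A (Imp \<chi> (Neg \<psi>))"
    using \<chi> \<psi> assms(2) complete_form_Th_iff by blast
  ultimately have "valid A (Imp \<chi> \<psi>) \<and> valid B (Imp \<chi> \<psi>) \<or>
      valid A (Imp \<chi> (Neg \<psi>)) \<and> valid B (Imp \<chi> (Neg \<psi>))" by blast
  then show ?thesis using A[OF \<chi>l] B[OF \<chi>l] A[OF \<psi>] B[OF \<psi>] s(2) t(2) s'(1) t'(1)
    unfolding valid_def sat.simps by blast
qed

lemma complete_formI:
  assumes "\<chi> \<in> forms l" "asg A s" "sat A s \<chi>"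
    and "\<And>t \<psi>. asg A t \<Longrightarrow> sat A t \<chi> \<Longrightarrow> \<psi> \<in> forms l \<Longrightarrow> sat A s \<psi> \<Longrightarrow> sat A t \<psi>"
  shows "complete_form (Th A) l \<chi>"
  unfolding complete_form_Th_iff
proof (intro conjI ballI)
  fix \<psi> assume \<psi>: "\<psi> \<in> forms l"
  show "valid A (Imp \<chi> \<psi>) \<or> valid A (Imp \<chi> (Neg \<psi>))"
  proof (cases "sat A s \<psi>")
    case True then show ?thesis using assms(4) \<psi> by (auto simp: valid_def)
  next
    case False
    then have "sat A s (Neg \<psi>)" by simp
    then show ?thesis using assms(4)[of _ "Neg \<psi>"] \<psi> by (auto simp: valid_def)
  qed
qed (use assms in auto)

text \<open>\<open>proj l f \<phi>\<close> expresses in the variables \<open>v\<^sub>0, \<dots>, v\<^sub>l\<^sub>-\<^sub>1\<close> what \<open>\<phi>\<close> says about the variables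
  \<open>f 0, \<dots>, f (l - 1)\<close>, quantifying all the others existentially.\<close>

definition proj :: "nat \<Rightarrow> (nat \<Rightarrow> nat) \<Rightarrow> form \<Rightarrow> form" where
  "proj l f \<phi> = Exs [l..<l + Suc (Max (insert 0 (fv \<phi> \<union> f ` {..<l})))]
     (And (ren \<phi> (\<lambda>v. v + l)) (Conj (map (\<lambda>j. Eq j (f j + l)) [0..<l])))"

lemma proj_forms: "proj l f \<phi> \<in> forms l"
proof -
  define N where "N = Suc (Max (insert 0 (fv \<phi> \<union> f ` {..<l})))"
  have "v < N" if "v \<in> fv \<phi> \<union> f ` {..<l}" for v
    unfolding N_def using that by (intro fresh_Suc_Max) auto
  then have "fv (proj l f \<phi>) \<subseteq> {..<l}"
    unfolding proj_def fv_Exs N_def[symmetric] by (fastforce simp: fv_ren fv_Conj)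
  then show ?thesis by (simp add: forms_def)
qed

lemma sat_proj:
  assumes s: "asg A s"
  shows "sat A s (proj l f \<phi>) \<longleftrightarrow> (\<exists>t. asg A t \<and> (\<forall>j<l. t (f j) = s j) \<and> sat A t \<phi>)"
proof
  define N where "N = Suc (Max (insert 0 (fv \<phi> \<union> f ` {..<l})))"
  have N: "v < N" if "v \<in> fv \<phi> \<union> f ` {..<l}" for v
    unfolding N_def using that by (intro fresh_Suc_Max) auto
  {
    assume "sat A s (proj l f \<phi>)"
    then obtain t where t0: "\<forall>v. v \<notin> set [l..<l + N] \<longrightarrow> t v = s v" "\<forall>v\<in>set [l..<l + N]. t v \<in> univ A"
      "sat A t (And (ren \<phi> (\<lambda>v. v + l)) (Conj (map (\<lambda>j. Eq j (f j + l)) [0..<l])))"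
      unfolding proj_def sat_Exs N_def[symmetric] by blast
    then have t: "\<And>v. v \<notin> {l..<l + N} \<Longrightarrow> t v = s v" "\<And>v. v \<in> {l..<l + N} \<Longrightarrow> t v \<in> univ A"
      "sat A (t \<circ> (\<lambda>v. v + l)) \<phi>" "\<And>j. j < l \<Longrightarrow> t j = t (f j + l)"
      by (auto simp: sat_Conj sat_ren)
    have "t v \<in> univ A" for v using t(1)[of v] t(2)[of v] s by (cases "v \<in> {l..<l + N}") auto
    then have "asg A t" by (simp add: asg_def)
    moreover have "t (f j + l) = s j" if "j < l" for j using t(1)[of j] t(4)[OF that] that by auto
    ultimately show "\<exists>t. asg A t \<and> (\<forall>j<l. t (f j) = s j) \<and> sat A t \<phi>"
      using t(3) by (intro exI[of _ "t \<circ> (\<lambda>v. v + l)"]) auto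
  next
    assume "\<exists>t. asg A t \<and> (\<forall>j<l. t (f j) = s j) \<and> sat A t \<phi>"
    then obtain t where t: "asg A t" "\<And>j. j < l \<Longrightarrow> t (f j) = s j" "sat A t \<phi>" by blast
    define u where "u v = (if v < l then s v else if v < l + N then t (v - l) else s v)" for v
    have "sat A (u \<circ> (\<lambda>v. v + l)) \<phi> \<longleftrightarrow> sat A t \<phi>"
      by (rule sat_cong) (use N in \<open>auto simp: u_def\<close>)
    moreover have "u j = u (f j + l)" if "j < l" for j
      using that N[of "f j"] t(2)[of j] by (auto simp: u_def)
    ultimately show "sat A s (proj l f \<phi>)"
      unfolding proj_def sat_Exs N_def[symmetric] using t s
      by (intro exI[of _ u]) (auto simp: sat_Conj sat_ren u_def)
  }
qed


text \<open>A condition is a single formula, up to equivalence, so what it says about the variables \<open>ys\<close> can be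
  completed. A generic model therefore satisfies a complete formula at each list of variables.\<close>

theorem countable_atomic_model_exists:
  fixes A :: "'a struc"
  assumes A: "is_struc A" and at: "atomic_theory (Th A)"
  shows "\<exists>B :: nat struc. countable_atomic_model (Th A) B"
proof -
  let ?P = "fin_ext A {}"
  define d where "d ys = {q. \<exists>\<chi>. complete_form (Th A) (length ys) \<chi> \<and> ren \<chi> ((!) ys) \<in> q}"
    for ys :: "nat list"
  have dense: "\<exists>q\<in>?P. p \<subseteq> q \<and> q \<in> d ys" if p: "p \<in> ?P" for p ys
  proof -
    have "finite p" "fsat A p" using p by (auto simp: fin_ext_def)
    then obtain ps where ps: "set ps = p" using finite_list by blast
    obtain s where s: "asg A s" "sat A s (Conj ps)"
      using fsatD[OF \<open>fsat A p\<close> subset_refl \<open>finite p\<close>] ps by (auto simp: sat_Conj)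
    let ?\<psi> = "proj (length ys) ((!) ys) (Conj ps)"
    have "asg A (s \<circ> (!) ys)" using s(1) by auto
    then have "sat A (s \<circ> (!) ys) ?\<psi>" using s by (subst sat_proj) auto
    then have "consistent_with (Th A) ?\<psi>"
      using \<open>asg A (s \<circ> (!) ys)\<close> unfolding consistent_Th_iff by blast
    then obtain \<chi> where \<chi>: "complete_form (Th A) (length ys) \<chi>" "valid A (Imp \<chi> ?\<psi>)"
      using at proj_forms[of "length ys"] unfolding atomic_theory_def completable_form_def proves_Th_iff
      by blast
    then obtain t where t: "asg A t" "sat A t \<chi>" by (auto simp: complete_form_Th_iff)
    then have "sat A t ?\<psi>" using \<chi>(2) by (auto simp: valid_def)
    then obtain u where u: "asg A u" "\<And>j. j < length ys \<Longrightarrow> u (ys ! j) = t j" "sat A u (Conj ps)"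
      using sat_proj[OF t(1)] by blast
    have "\<chi> \<in> forms (length ys)" using \<chi>(1) by (simp add: complete_form_def)
    then have "sat A (u \<circ> (!) ys) \<chi> \<longleftrightarrow> sat A t \<chi>" by (rule sat_cong_forms) (simp add: u(2))
    then have "sat A u (ren \<chi> ((!) ys))" using t(2) by (simp add: sat_ren)
    then have "fsat A (insert (ren \<chi> ((!) ys)) p)"
      using u ps by (intro fsatI_sat[OF u(1)]) (auto simp: sat_Conj)
    then have "insert (ren \<chi> ((!) ys)) p \<in> ?P"
      using conditions_fin_ext[of "{}" 0 A] p by (auto simp: conditions_def)
    then show ?thesis using \<chi>(1) by (intro bexI[of _ "insert (ren \<chi> ((!) ys)) p"]) (auto simp: d_def)
  qed
  obtain B :: "nat struc" and s where B: "is_struc B" "range s = univ B" "Th B = Th A"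
    and dB: "\<And>e. e \<in> range d \<Longrightarrow> \<exists>q\<in>e. q \<in> ?P \<and> (\<forall>\<phi>\<in>q. sat B s \<phi>)"
  proof (rule generic_model[OF A conditions_fin_ext[of "{}" 0] fin_ext_base[OF fsat_empty[OF A]], of "range d"])
    show "\<exists>q\<in>?P. p \<subseteq> q \<and> q \<in> e" if "e \<in> range d" "p \<in> ?P" for e p
      using that dense by blast
  qed auto
  have "atomic_model B"
    unfolding atomic_model_def
  proof (intro allI impI)
    fix xs assume "set xs \<subseteq> univ B"
    then have "xs \<in> lists (range s)" using B(2) by auto
    then obtain ys where ys: "xs = map s ys" unfolding lists_image by blast
    obtain \<chi> where \<chi>: "complete_form (Th A) (length ys) \<chi>" "sat B s (ren \<chi> ((!) ys))"
      using dB[of "d ys"] by (auto simp: d_def)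
    have "\<chi> \<in> forms (length ys)" using \<chi>(1) by (simp add: complete_form_def)
    then have "sat B (s \<circ> (!) ys) \<chi> \<longleftrightarrow> sat B ((!) xs) \<chi>" by (rule sat_cong_forms) (simp add: ys)
    then show "\<exists>\<phi>. complete_form (Th B) (length xs) \<phi> \<and> sat B ((!) xs) \<phi>"
      using \<chi> B(3) ys by (auto simp: sat_ren)
  qed
  then show ?thesis using B(1,3) A by (auto simp: countable_atomic_model_def models_Th_iff)
qed

text \<open>Omitting types: the model realizes \<open>p\<close> by a tuple no extension of which realizes \<open>r\<close>. The
  hypothesis says that no single formula isolates \<open>r\<close> over \<open>p\<close>; it lets a condition be extended
  by the negation of some member of \<open>r\<close>.\<close>

theorem omitting_types:
  fixes A :: "'a struc"
  assumes A: "is_struc A" and p: "fsat A p" "p \<subseteq> forms k" and r: "r \<subseteq> forms l" and kl: "k \<le> l"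
    and noniso: "\<And>\<psi>. \<psi> \<in> forms l \<Longrightarrow> fsat A (insert \<psi> p) \<Longrightarrow> \<exists>\<phi>\<in>r. fsat A (insert (Neg \<phi>) (insert \<psi> p))"
  obtains B :: "nat struc" and s where "is_struc B" "Th B = Th A" "asg B s" "\<And>\<phi>. \<phi> \<in> p \<Longrightarrow> sat B s \<phi>"
    "\<And>t. asg B t \<Longrightarrow> (\<And>j. j < k \<Longrightarrow> t j = s j) \<Longrightarrow> \<exists>\<phi>\<in>r. \<not> sat B t \<phi>"
proof -
  let ?P = "fin_ext A p"
  \<comment> \<open>the first \<open>k\<close> variables of \<open>r\<close> stay, the others are mapped to \<open>ys\<close>\<close>
  define f where "f ys j = (if j < k then j else ys ! (j - k))" for ys :: "nat list" and j :: nat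
  define d where "d ys = {q. \<exists>\<phi>\<in>r. Neg (ren \<phi> (f ys)) \<in> q}" for ys
  have dense: "\<exists>q'\<in>?P. q \<subseteq> q' \<and> q' \<in> d ys" if q: "q \<in> ?P" for q ys
  proof -
    obtain F where F: "finite F" "q = p \<union> F" "fsat A q" using q by (auto simp: fin_ext_def)
    then obtain Fs where Fs: "set Fs = F" using finite_list by blast
    let ?\<psi> = "proj l (f ys) (Conj Fs)"
    have "fsat A (insert ?\<psi> p)"
      unfolding fsat_def
    proof (intro allI impI)
      fix H assume H: "H \<subseteq> insert ?\<psi> p" "finite H"
      then obtain s where s: "asg A s" "\<forall>\<phi>\<in>(H - {?\<psi>}) \<union> F. sat A s \<phi>"
        using fsatD[OF F(3), of "(H - {?\<psi>}) \<union> F"] F by blast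
      have as: "asg A (s \<circ> f ys)" using s(1) by simp
      have "sat A s (Conj Fs)" using s(2) Fs by (simp add: sat_Conj)
      with s(1) as have "sat A (s \<circ> f ys) ?\<psi>" by (subst sat_proj[OF as]) auto
      moreover have "sat A (s \<circ> f ys) \<phi>" if "\<phi> \<in> H" "\<phi> \<noteq> ?\<psi>" for \<phi>
      proof -
        have "\<phi> \<in> forms k" using that H p(2) by blast
        then have "sat A (s \<circ> f ys) \<phi> \<longleftrightarrow> sat A s \<phi>" by (rule sat_cong_forms) (simp add: f_def)
        then show ?thesis using s(2) that by blast
      qed
      ultimately show "\<exists>s. asg A s \<and> (\<forall>\<phi>\<in>H. sat A s \<phi>)" using as by blast
    qed
    then obtain \<phi> where \<phi>: "\<phi> \<in> r" "fsat A (insert (Neg \<phi>) (insert ?\<psi> p))"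
      using noniso[OF proj_forms] by blast
    let ?\<chi> = "Neg (ren \<phi> (f ys))"
    have "fsat A (insert ?\<chi> q)"
      unfolding fsat_def
    proof (intro allI impI)
      fix H assume H: "H \<subseteq> insert ?\<chi> q" "finite H"
      then have "H \<inter> p \<union> {?\<psi>, Neg \<phi>} \<subseteq> insert (Neg \<phi>) (insert ?\<psi> p)" "finite (H \<inter> p \<union> {?\<psi>, Neg \<phi>})"
        by auto
      from fsatD[OF \<phi>(2) this] obtain s where s: "asg A s" "\<forall>\<theta>\<in>H \<inter> p \<union> {?\<psi>, Neg \<phi>}. sat A s \<theta>"
        by blast
      then have "sat A s ?\<psi>" by blast
      then obtain t where t: "asg A t" "\<And>j. j < l \<Longrightarrow> t (f ys j) = s j" "sat A t (Conj Fs)"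
        using sat_proj[OF s(1)] by blast
      have "\<phi> \<in> forms l" using \<phi>(1) r by blast
      then have "sat A (t \<circ> f ys) \<phi> \<longleftrightarrow> sat A s \<phi>" by (rule sat_cong_forms) (simp add: t(2))
      then have "sat A t ?\<chi>" using s(2) by (simp add: sat_ren)
      moreover have "sat A t \<theta>" if "\<theta> \<in> H" "\<theta> \<in> p" for \<theta>
      proof -
        have "\<theta> \<in> forms k" using that p(2) by blast
        then have "sat A t \<theta> \<longleftrightarrow> sat A s \<theta>"
        proof (rule sat_cong_forms)
          fix j assume "j < k" then show "t j = s j" using t(2)[of j] kl by (simp add: f_def)
        qed
        then show ?thesis using s(2) that by blast
      qed
      moreover have "sat A t \<theta>" if "\<theta> \<in> F" for \<theta> using t(3) that Fs by (simp add: sat_Conj)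
      ultimately have "\<forall>\<theta>\<in>H. sat A t \<theta>" using H(1) F(2) by blast
      then show "\<exists>s. asg A s \<and> (\<forall>\<phi>\<in>H. sat A s \<phi>)" using t(1) by blast
    qed
    then have "insert ?\<chi> q \<in> ?P" using conditions_fin_ext[OF p(2), of A] q by (auto simp: conditions_def)
    then show ?thesis using \<phi>(1) by (intro bexI[of _ "insert ?\<chi> q"]) (auto simp: d_def)
  qed
  obtain B :: "nat struc" and s where B: "is_struc B" "range s = univ B" "Th B = Th A"
    and pB: "\<And>\<phi>. \<phi> \<in> p \<Longrightarrow> sat B s \<phi>"
    and dB: "\<And>e. e \<in> range d \<Longrightarrow> \<exists>q\<in>e. q \<in> ?P \<and> (\<forall>\<phi>\<in>q. sat B s \<phi>)"
  proof (rule generic_model[OF A conditions_fin_ext[OF p(2)] fin_ext_base[OF p(1)], of "range d"])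
    show "\<exists>q\<in>?P. p' \<subseteq> q \<and> q \<in> e" if "e \<in> range d" "p' \<in> ?P" for e p'
      using that dense by blast
  qed auto
  have "\<exists>\<phi>\<in>r. \<not> sat B t \<phi>" if t: "asg B t" "\<And>j. j < k \<Longrightarrow> t j = s j" for t
  proof -
    have "map t [k..<l] \<in> lists (range s)" using t(1) B(2) by auto
    then obtain ys where ys: "map t [k..<l] = map s ys" unfolding lists_image by blast
    obtain \<phi> where \<phi>: "\<phi> \<in> r" "sat B s (Neg (ren \<phi> (f ys)))" using dB[of "d ys"] by (auto simp: d_def)
    have "\<phi> \<in> forms l" using \<phi>(1) r by blast
    then have "sat B (s \<circ> f ys) \<phi> \<longleftrightarrow> sat B t \<phi>"
    proof (rule sat_cong_forms)
      fix j assume "j < l"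
      show "(s \<circ> f ys) j = t j"
      proof (cases "j < k")
        case True then show ?thesis by (simp add: f_def t(2))
      next
        case False
        have "length ys = l - k" using arg_cong[OF ys, of length] by simp
        then have "s (ys ! (j - k)) = map t [k..<l] ! (j - k)" using ys False \<open>j < l\<close> by simp
        then show ?thesis using False \<open>j < l\<close> by (simp add: f_def)
      qed
    qed
    then show ?thesis using \<phi> by (auto simp: sat_ren)
  qed
  moreover have "asg B s" using B(2) by (simp flip: range_asg)
  ultimately show ?thesis using that B(1,3) pB by blast
qed

text \<open>There are only countably many tasks: realize over the variables \<open>ys\<close> the complete type \<open>r\<close>. A
  condition has finitely many variables, so if \<open>r\<close> over \<open>ys\<close> is consistent with it, it can be realized
  by a fresh variable.\<close>

theorem countably_saturated_model_exists:
  fixes A :: "'a struc"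
  assumes A: "is_struc A" and sm: "small_theory (Th A)"
  shows "\<exists>B :: nat struc. countably_saturated_model (Th A) B"
proof -
  define P where "P = {p. fsat A p \<and> (\<exists>l. p \<subseteq> forms l)}"
  define tr where "tr ys y r = (\<lambda>\<phi>. ren \<phi> ((!) (ys @ [y]))) ` r" for ys :: "nat list" and y r
  \<comment> \<open>the second alternative records, with a fresh \<open>y\<close>, that the task cannot be fulfilled\<close>
  define d where "d = (\<lambda>(ys, r). {q. (\<exists>y. tr ys y r \<subseteq> q) \<or>
     (\<exists>y. q \<subseteq> forms y \<and> set ys \<subseteq> {..<y} \<and> \<not> fsat A (q \<union> tr ys y r))})"
  define I where "I = {(ys :: nat list, r). r \<in> complete_types (Suc (length ys)) (Th A)}"
  have "I \<subseteq> UNIV \<times> (\<Union>l. complete_types l (Th A))" by (auto simp: I_def)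
  moreover have "countable ((UNIV :: nat list set) \<times> (\<Union>l. complete_types l (Th A)))"
    using sm by (intro countable_SIGMA) (simp_all add: small_theory_def)
  ultimately have cI: "countable (d ` I)" using countable_subset by blast
  have cP: "conditions A P"
    unfolding conditions_def
  proof (intro ballI conjI allI impI)
    fix p \<phi> assume "p \<in> P" and "fsat A (insert \<phi> p)"
    obtain l where l: "p \<subseteq> forms l" using \<open>p \<in> P\<close> by (auto simp: P_def)
    obtain l' where l': "{\<phi>} \<subseteq> forms l'" using finite_subset_forms by blast
    have "insert \<phi> p \<subseteq> forms (max l l')"
      using l l' forms_mono[OF max.cobounded1, of l l'] forms_mono[OF max.cobounded2, of l' l] by blast
    then show "insert \<phi> p \<in> P" using \<open>fsat A (insert \<phi> p)\<close> by (auto simp: P_def)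
  qed (auto simp: P_def)
  have dense: "\<exists>q\<in>P. p \<subseteq> q \<and> q \<in> e" if e: "e \<in> d ` I" and p: "p \<in> P" for e p
  proof -
    obtain ys r where e: "e = d (ys, r)" and r: "r \<in> complete_types (Suc (length ys)) (Th A)"
      using e by (auto simp: I_def)
    obtain l where l: "p \<subseteq> forms l" using p by (auto simp: P_def)
    define y where "y = Suc (Max (insert 0 (set ys \<union> {l})))"
    have y: "v < y" if "v \<in> set ys \<union> {l}" for v unfolding y_def using that by (intro fresh_Suc_Max) auto
    have py: "p \<subseteq> forms y" using l y[of l] forms_mono[of l y] by auto
    show ?thesis
    proof (cases "fsat A (p \<union> tr ys y r)")
      case True
      have "r \<subseteq> forms (Suc (length ys))" using r by (simp add: complete_types_def)
      have "tr ys y r \<subseteq> forms (Suc y)"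
      proof
        fix \<psi> assume "\<psi> \<in> tr ys y r"
        then obtain \<phi> where \<phi>: "\<phi> \<in> r" "\<psi> = ren \<phi> ((!) (ys @ [y]))" by (auto simp: tr_def)
        then have "fv \<phi> \<subseteq> {..<Suc (length ys)}" using \<open>r \<subseteq> _\<close> by (auto simp: forms_def)
        moreover have "(ys @ [y]) ! j < Suc y" if "j < Suc (length ys)" for j
        proof -
          have "(ys @ [y]) ! j \<in> set (ys @ [y])" using that by (intro nth_mem) simp
          then show ?thesis using y by (auto intro: less_SucI)
        qed
        ultimately show "\<psi> \<in> forms (Suc y)" unfolding forms_def \<phi>(2) mem_Collect_eq fv_ren by blast
      qed
      then have "p \<union> tr ys y r \<subseteq> forms (Suc y)" using py forms_mono[of y "Suc y"] by auto
      then have "p \<union> tr ys y r \<in> P" using True by (auto simp: P_def)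
      then show ?thesis unfolding e d_def by (intro bexI[of _ "p \<union> tr ys y r"]) auto
    next
      case False
      then have "p \<in> e" using py y unfolding e d_def by auto
      then show ?thesis using p by blast
    qed
  qed
  obtain B :: "nat struc" and s where B: "is_struc B" "range s = univ B" "Th B = Th A"
    and dB: "\<And>e. e \<in> d ` I \<Longrightarrow> \<exists>q\<in>e. q \<in> P \<and> (\<forall>\<phi>\<in>q. sat B s \<phi>)"
  proof (rule generic_model[OF A cP _ cI dense])
    show "{} \<in> P" using fsat_empty[OF A] by (simp add: P_def)
  qed auto
  have asB: "asg B s" using B(2) by (simp flip: range_asg)
  have "omega_saturated B"
    unfolding omega_saturated_def
  proof (intro allI impI, elim conjE)
    fix xs p
    assume xs: "set xs \<subseteq> univ B" and p: "p \<subseteq> forms (Suc (length xs))"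
      and fin: "\<forall>q\<subseteq>p. finite q \<longrightarrow> (\<exists>b\<in>univ B. \<forall>\<phi>\<in>q. sat B ((!) (xs @ [b])) \<phi>)"
    have "xs \<in> lists (range s)" using xs B(2) by auto
    then obtain ys where ys: "xs = map s ys" unfolding lists_image by blast
    define l where "l = length ys"
    have len: "length xs = l" by (simp add: ys l_def)
    define u where "u = s \<circ> (!) ys"
    have uxs: "u j = xs ! j" if "j < l" for j using that by (simp add: u_def ys l_def)
    have asu: "asg B u" using asB by (simp add: u_def)
    have xb: "sat B ((!) (xs @ [b])) \<phi> \<longleftrightarrow> sat B (u(l := b)) \<phi>" if "\<phi> \<in> forms (Suc l)" for \<phi> b
      by (rule sat_cong_forms[OF that]) (auto simp: nth_append len uxs less_Suc_eq)
    have ul: "sat B (u(l := b)) \<phi> \<longleftrightarrow> sat B u \<phi>" if "\<phi> \<in> forms l" for \<phi> b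
      by (rule sat_cong_forms[OF that]) simp
    have "fsat B (p \<union> tp l B u)"
      unfolding fsat_def
    proof (intro allI impI)
      fix F assume F: "F \<subseteq> p \<union> tp l B u" "finite F"
      obtain b where b: "b \<in> univ B" "\<forall>\<phi>\<in>F \<inter> p. sat B ((!) (xs @ [b])) \<phi>"
        using fin[rule_format, of "F \<inter> p"] F by auto
      have "sat B (u(l := b)) \<phi>" if "\<phi> \<in> F" for \<phi>
      proof (cases "\<phi> \<in> p")
        case True
        then have "\<phi> \<in> forms (Suc l)" using p len by auto
        then show ?thesis using xb b True that by blast
      next
        case False
        then have "\<phi> \<in> tp l B u" using F that by blast
        then show ?thesis using ul by (auto simp: tp_def)
      qed
      then show "\<exists>s. asg B s \<and> (\<forall>\<phi>\<in>F. sat B s \<phi>)"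
        using asu b(1) by (intro exI[of _ "u(l := b)"]) auto
    qed
    then have "fsat A (p \<union> tp l B u)" using fsat_cong_Th[OF B(3)] by blast
    moreover have "p \<union> tp l B u \<subseteq> forms (Suc l)"
      using p len forms_mono[of l "Suc l"] by (auto simp: tp_def)
    ultimately obtain r where r: "r \<in> complete_types (Suc l) (Th A)" "p \<union> tp l B u \<subseteq> r"
      using extend_to_complete_type[OF A] by metis
    have rl: "r \<subseteq> forms (Suc l)" and fr: "fsat B r"
      using r(1) fsat_cong_Th[OF B(3)] by (auto simp: complete_types_Th_iff[OF A])
    have "(ys, r) \<in> I" using r(1) by (simp add: I_def l_def)
    then obtain q where q: "q \<in> d (ys, r)" "\<forall>\<phi>\<in>q. sat B s \<phi>" using dB by blast
    then consider y where "tr ys y r \<subseteq> q"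
      | y where "q \<subseteq> forms y" "set ys \<subseteq> {..<y}" "\<not> fsat A (q \<union> tr ys y r)"
      by (auto simp: d_def)
    \<comment> \<open>the second case is impossible, because \<open>r\<close> extends the type of \<open>xs\<close> in \<open>B\<close>\<close>
    then show "\<exists>b\<in>univ B. \<forall>\<phi>\<in>p. sat B ((!) (xs @ [b])) \<phi>"
    proof cases
      case 1
      have "sat B ((!) (xs @ [s y])) \<phi>" if "\<phi> \<in> p" for \<phi>
      proof -
        have "ren \<phi> ((!) (ys @ [y])) \<in> q" using 1 that r(2) by (auto simp: tr_def)
        then have *: "sat B (s \<circ> (!) (ys @ [y])) \<phi>" using q(2) by (auto simp: sat_ren)
        have f: "\<phi> \<in> forms (Suc l)" using that p len by auto
        have "sat B (s \<circ> (!) (ys @ [y])) \<phi> \<longleftrightarrow> sat B ((!) (xs @ [s y])) \<phi>"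
          by (rule sat_cong_forms[OF f]) (auto simp: nth_append ys l_def less_Suc_eq)
        with * show ?thesis by blast
      qed
      moreover have "s y \<in> univ B" using asB by simp
      ultimately show ?thesis by blast
    next
      case 2
      have "fsat B (q \<union> tr ys y r)"
        unfolding fsat_def
      proof (intro allI impI)
        fix F assume F: "F \<subseteq> q \<union> tr ys y r" "finite F"
        have "finite (F \<inter> tr ys y r)" "F \<inter> tr ys y r \<subseteq> (\<lambda>\<phi>. ren \<phi> ((!) (ys @ [y]))) ` r"
          using F by (auto simp: tr_def)
        then obtain R where R: "R \<subseteq> r" "finite R" "F \<inter> tr ys y r = (\<lambda>\<phi>. ren \<phi> ((!) (ys @ [y]))) ` R"
          by (rule finite_subset_image[elim_format]) blast
        obtain Rs where Rs: "set Rs = R" using finite_list[OF R(2)] by blast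
        let ?\<psi> = "Ex l (Conj Rs)"
        have "fv (Conj Rs) \<subseteq> {..<Suc l}" using R(1) rl Rs by (auto simp: fv_Conj forms_def)
        then have \<psi>l: "?\<psi> \<in> forms l" by (auto simp: forms_def less_Suc_eq)
        have "sat B u ?\<psi>"
        proof (rule ccontr)
          assume "\<not> sat B u ?\<psi>"
          then have "Neg ?\<psi> \<in> r" using \<psi>l r(2) by (auto simp: tp_def)
          then obtain t where t: "asg B t" "\<forall>\<phi>\<in>insert (Neg ?\<psi>) R. sat B t \<phi>"
            using fsatD[OF fr, of "insert (Neg ?\<psi>) R"] R by blast
          then have "sat B t (Neg ?\<psi>)" by blast
          then have "\<forall>a\<in>univ B. \<not> sat B (t(l := a)) (Conj Rs)" by simp
          then have "\<not> sat B (t(l := t l)) (Conj Rs)" using asgD[OF t(1)] by blast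
          then show False using t(2) Rs by (simp add: sat_Conj)
        qed
        then obtain b where b: "b \<in> univ B" "sat B (u(l := b)) (Conj Rs)" by auto
        have "sat B (s(y := b)) \<phi>" if "\<phi> \<in> F" for \<phi>
        proof (cases "\<phi> \<in> tr ys y r")
          case True
          then have "\<phi> \<in> (\<lambda>\<phi>. ren \<phi> ((!) (ys @ [y]))) ` R" unfolding R(3)[symmetric] using that by simp
          then obtain \<theta> where \<theta>: "\<theta> \<in> R" "\<phi> = ren \<theta> ((!) (ys @ [y]))" by blast
          have f: "\<theta> \<in> forms (Suc l)" using \<theta>(1) R(1) rl by blast
          have "sat B (s(y := b) \<circ> (!) (ys @ [y])) \<theta> \<longleftrightarrow> sat B (u(l := b)) \<theta>"
          proof (rule sat_cong_forms[OF f])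
            fix j assume "j < Suc l"
            then consider "j = l" | "j < l" by linarith
            then show "(s(y := b) \<circ> (!) (ys @ [y])) j = (u(l := b)) j"
            proof cases
              case 1 then show ?thesis by (simp add: l_def nth_append)
            next
              case j: 2
              then have "ys ! j \<in> set ys" by (simp add: l_def)
              then have "ys ! j < y" using 2(2) by auto
              then show ?thesis using j by (simp add: l_def nth_append u_def)
            qed
          qed
          then show ?thesis using b(2) \<theta> Rs by (auto simp: sat_Conj sat_ren)
        next
          case False
          then have "\<phi> \<in> q" using that F by blast
          then have "\<phi> \<in> forms y" using 2(1) by blast
          then have "sat B (s(y := b)) \<phi> \<longleftrightarrow> sat B s \<phi>" by (rule sat_cong_forms) simp
          then show ?thesis using q(2) \<open>\<phi> \<in> q\<close> by blast
        qed
        then show "\<exists>s. asg B s \<and> (\<forall>\<phi>\<in>F. sat B s \<phi>)"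
          using asB b(1) by (intro exI[of _ "s(y := b)"]) auto
      qed
      then show ?thesis using 2(3) fsat_cong_Th[OF B(3)] by blast
    qed
  qed
  then show ?thesis using B(1,3) A by (auto simp: countably_saturated_model_def models_Th_iff)
qed

section \<open>Isomorphisms and uniqueness of countable atomic models\<close>

lemma sat_iso:
  assumes f: "bij_betw f (univ A) (univ B)"
    and r: "\<And>x y. x \<in> univ A \<Longrightarrow> y \<in> univ A \<Longrightarrow> (x, y) \<in> rel A \<longleftrightarrow> (f x, f y) \<in> rel B"
    and s: "asg A s"
  shows "sat A s \<phi> \<longleftrightarrow> sat B (f \<circ> s) \<phi>"
  using s
proof (induction \<phi> arbitrary: s)
  case (Eq x y)
  then show ?case using bij_betw_imp_inj_on[OF f] by (auto dest: inj_onD)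
next
  case (All x \<phi>)
  have im: "univ B = f ` univ A" using f by (simp add: bij_betw_def)
  have IH: "sat A t \<phi> \<longleftrightarrow> sat B (f \<circ> t) \<phi>" if "asg A t" for t by (rule All.IH[OF that])
  have "sat A (s(x := a)) \<phi> \<longleftrightarrow> sat B ((f \<circ> s)(x := f a)) \<phi>" if "a \<in> univ A" for a
  proof -
    have "f \<circ> s(x := a) = (f \<circ> s)(x := f a)" by (rule ext) simp
    then show ?thesis using IH[of "s(x := a)"] All.prems that by simp
  qed
  then show "sat A s (All x \<phi>) \<longleftrightarrow> sat B (f \<circ> s) (All x \<phi>)" by (simp add: im)
qed (use r in auto)

lemma iso_struc_Th:
  assumes "is_struc A" "iso_struc A B" shows "Th A = Th B"
proof -
  obtain f where f: "bij_betw f (univ A) (univ B)"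
    "\<And>x y. x \<in> univ A \<Longrightarrow> y \<in> univ A \<Longrightarrow> (x, y) \<in> rel A \<longleftrightarrow> (f x, f y) \<in> rel B"
    using assms(2) by (auto simp: iso_struc_def)
  obtain s where s: "asg A s" using is_struc_ex_asg[OF assms(1)] by blast
  have fs: "asg B (f \<circ> s)" using s f(1) by (auto simp: asg_def bij_betw_def)
  have iA: "\<phi> \<in> Th A \<longleftrightarrow> \<phi> \<in> forms 0 \<and> sat A s \<phi>" for \<phi> by (rule Th_iff[OF assms(1) s])
  have "\<phi> \<in> Th B \<longleftrightarrow> \<phi> \<in> forms 0 \<and> sat B (f \<circ> s) \<phi>" for \<phi>
    unfolding Th_def range_asg using sentence_indep fs by blast
  with iA sat_iso[OF f s] show ?thesis by blast
qed

lemma iso_refl: "iso_struc A A"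
  unfolding iso_struc_def by (intro exI[of _ id]) auto

lemma iso_sym: assumes "iso_struc A B" shows "iso_struc B A"
proof -
  obtain f where f: "bij_betw f (univ A) (univ B)"
    "\<And>x y. x \<in> univ A \<Longrightarrow> y \<in> univ A \<Longrightarrow> (x, y) \<in> rel A \<longleftrightarrow> (f x, f y) \<in> rel B"
    using assms by (auto simp: iso_struc_def)
  let ?g = "inv_into (univ A) f"
  have g: "?g x \<in> univ A" "f (?g x) = x" if "x \<in> univ B" for x
    using bij_betw_inv_into_right[OF f(1) that] bij_betw_apply[OF bij_betw_inv_into[OF f(1)] that] by auto
  have "bij_betw ?g (univ B) (univ A)" by (rule bij_betw_inv_into[OF f(1)])
  then show ?thesis unfolding iso_struc_def using f(2) g by (intro exI[of _ ?g]) auto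
qed

lemma iso_trans: assumes "iso_struc A B" "iso_struc B C" shows "iso_struc A C"
proof -
  obtain f where f: "bij_betw f (univ A) (univ B)"
    "\<forall>x\<in>univ A. \<forall>y\<in>univ A. (x, y) \<in> rel A \<longleftrightarrow> (f x, f y) \<in> rel B"
    using assms(1) unfolding iso_struc_def by blast
  obtain g where g: "bij_betw g (univ B) (univ C)"
    "\<forall>x\<in>univ B. \<forall>y\<in>univ B. (x, y) \<in> rel B \<longleftrightarrow> (g x, g y) \<in> rel C"
    using assms(2) unfolding iso_struc_def by blast
  have "bij_betw (g \<circ> f) (univ A) (univ C)" using bij_betw_trans f g by blast
  moreover have "f x \<in> univ B" if "x \<in> univ A" for x using that f(1) bij_betw_apply by metis
  ultimately show ?thesis unfolding iso_struc_def using f(2) g(2) by (intro exI[of _ "g \<circ> f"]) auto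
qed

lemma equiv_iso_rel: "equiv {A. is_struc A} iso_rel"
  unfolding equiv_def refl_on_def sym_def trans_def iso_rel_def
  using iso_refl iso_sym iso_trans by auto

text \<open>An isomorphism as the union of a generic chain of finite partial isomorphisms.\<close>

lemma back_and_forth:
  fixes A :: "'a struc" and B :: "'b struc"
  assumes P: "g0 \<in> P" and cA: "countable (univ A)" and cB: "countable (univ B)"
    and part: "\<And>g a b a' b'. g \<in> P \<Longrightarrow> (a, b) \<in> g \<Longrightarrow> (a', b') \<in> g \<Longrightarrow>
      a \<in> univ A \<and> b \<in> univ B \<and> (a = a' \<longleftrightarrow> b = b') \<and> ((a, a') \<in> rel A \<longleftrightarrow> (b, b') \<in> rel B)"
    and forth: "\<And>g a. g \<in> P \<Longrightarrow> a \<in> univ A \<Longrightarrow> \<exists>h\<in>P. g \<subseteq> h \<and> a \<in> Domain h"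
    and bck: "\<And>g b. g \<in> P \<Longrightarrow> b \<in> univ B \<Longrightarrow> \<exists>h\<in>P. g \<subseteq> h \<and> b \<in> Range h"
  shows "iso_struc A B"
proof -
  define D where "D = (\<lambda>a. {g. a \<in> Domain g}) ` univ A \<union> (\<lambda>b. {g. b \<in> Range g}) ` univ B"
  have cD: "countable D" using cA cB by (simp add: D_def)
  have dense: "\<exists>h\<in>P. g \<subseteq> h \<and> h \<in> d" if "d \<in> D" "g \<in> P" for d g
    using that forth bck by (auto simp: D_def)
  obtain c :: "nat \<Rightarrow> ('a \<times> 'b) set" where c: "c 0 = g0" "\<And>k. c k \<in> P" "mono c" "\<And>d. d \<in> D \<Longrightarrow> \<exists>k. c k \<in> d"
    using generic_chain[OF cD P dense] by metis
  define G where "G = (\<Union>k. c k)"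
  have G: "a \<in> univ A \<and> b \<in> univ B \<and> (a = a' \<longleftrightarrow> b = b') \<and> ((a, a') \<in> rel A \<longleftrightarrow> (b, b') \<in> rel B)"
    if ab: "(a, b) \<in> G" "(a', b') \<in> G" for a b a' b'
  proof -
    obtain j k where "(a, b) \<in> c j" "(a', b') \<in> c k" using ab by (auto simp: G_def)
    moreover have "c j \<subseteq> c (max j k)" "c k \<subseteq> c (max j k)" by (simp_all add: monoD[OF c(3)])
    ultimately have "(a, b) \<in> c (max j k)" "(a', b') \<in> c (max j k)" by auto
    from part[OF c(2) this] show ?thesis .
  qed
  have dom: "\<exists>b. (a, b) \<in> G" if "a \<in> univ A" for a
  proof -
    have "{g. a \<in> Domain g} \<in> D" using that by (auto simp: D_def)
    from c(4)[OF this] show ?thesis by (auto simp: G_def)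
  qed
  have ran: "\<exists>a. (a, b) \<in> G" if "b \<in> univ B" for b
  proof -
    have "{g. b \<in> Range g} \<in> D" using that by (auto simp: D_def)
    from c(4)[OF this] show ?thesis by (auto simp: G_def)
  qed
  define f where "f a = (SOME b. (a, b) \<in> G)" for a
  have f: "(a, f a) \<in> G" if "a \<in> univ A" for a unfolding f_def using someI_ex[OF dom[OF that]] .
  have "bij_betw f (univ A) (univ B)"
    unfolding bij_betw_def
  proof
    show "inj_on f (univ A)"
    proof (rule inj_onI)
      fix x y assume "x \<in> univ A" "y \<in> univ A" "f x = f y"
      then show "x = y" using G[OF f f] by metis
    qed
    show "f ` univ A = univ B"
    proof
      show "f ` univ A \<subseteq> univ B" using G f by blast
      show "univ B \<subseteq> f ` univ A"
      proof
        fix b assume "b \<in> univ B"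
        then obtain a where a: "(a, b) \<in> G" using ran by blast
        then have aA: "a \<in> univ A" using G by blast
        then have "b = f a" using G[OF a f[OF aA]] by simp
        with aA show "b \<in> f ` univ A" by blast
      qed
    qed
  qed
  moreover have "(x, y) \<in> rel A \<longleftrightarrow> (f x, f y) \<in> rel B" if "x \<in> univ A" "y \<in> univ A" for x y
    using G[OF f[OF that(1)] f[OF that(2)]] by simp
  ultimately show ?thesis unfolding iso_struc_def by blast
qed

text \<open>A complete formula of the extended tuple survives existential quantification over its last
  variable, so elementary tuples of atomic models can be extended.\<close>

lemma atomic_forth:
  fixes A :: "'a struc" and B :: "'b struc"
  assumes A: "is_struc A" and B: "is_struc B" and Th: "Th A = Th B" and at: "atomic_model A"
    and len: "length xs = length ys" and xs: "set xs \<subseteq> univ A" and ys: "set ys \<subseteq> univ B"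
    and eq: "\<And>\<phi>. \<phi> \<in> forms (length xs) \<Longrightarrow> sat A ((!) xs) \<phi> \<longleftrightarrow> sat B ((!) ys) \<phi>"
    and a: "a \<in> univ A"
  shows "\<exists>b\<in>univ B. \<forall>\<phi>\<in>forms (Suc (length xs)). sat A ((!) (xs @ [a])) \<phi> \<longleftrightarrow> sat B ((!) (ys @ [b])) \<phi>"
proof -
  define l where "l = length xs"
  have "set (xs @ [a]) \<subseteq> univ A" using xs a by simp
  then obtain \<chi> where \<chi>: "complete_form (Th A) (Suc l) \<chi>" "sat A ((!) (xs @ [a])) \<chi>"
    using at unfolding atomic_model_def l_def by (metis length_append_singleton)
  have \<chi>l: "\<chi> \<in> forms (Suc l)" using \<chi>(1) by (simp add: complete_form_def)
  have "sat A ((!) (xs @ [a])) \<chi> \<longleftrightarrow> sat A (((!) xs)(l := a)) \<chi>"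
    by (rule sat_cong_forms[OF \<chi>l]) (auto simp: nth_append l_def less_Suc_eq)
  then have "sat A ((!) xs) (Ex l \<chi>)" using \<chi>(2) a by auto
  moreover have "Ex l \<chi> \<in> forms l" using \<chi>l by (auto simp: forms_def less_Suc_eq)
  ultimately have "sat B ((!) ys) (Ex l \<chi>)" using eq[of "Ex l \<chi>"] by (simp only: l_def)
  then obtain b where b: "b \<in> univ B" "sat B (((!) ys)(l := b)) \<chi>" by auto
  have "sat B ((!) (ys @ [b])) \<chi> \<longleftrightarrow> sat B (((!) ys)(l := b)) \<chi>"
    by (rule sat_cong_forms[OF \<chi>l]) (use len in \<open>auto simp: nth_append l_def less_Suc_eq\<close>)
  then have sb: "sat B ((!) (ys @ [b])) \<chi>" using b(2) by simp
  have "sat A ((!) (xs @ [a])) \<phi> \<longleftrightarrow> sat B ((!) (ys @ [b])) \<phi>" if "\<phi> \<in> forms (Suc l)" for \<phi>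
  proof (rule complete_form_same_sat[OF \<chi>(1) refl Th[symmetric] A B _ \<chi>(2) _ sb that])
    show "(xs @ [a]) ! j \<in> univ A" if "j < Suc l" for j
      using that \<open>set (xs @ [a]) \<subseteq> univ A\<close> by (metis l_def length_append_singleton nth_mem subsetD)
    show "(ys @ [b]) ! j \<in> univ B" if "j < Suc l" for j
    proof -
      have "set (ys @ [b]) \<subseteq> univ B" using ys b by simp
      then show ?thesis using that len by (metis l_def length_append_singleton nth_mem subsetD)
    qed
  qed
  then show ?thesis using b(1) by (auto simp: l_def)
qed

theorem countable_atomic_models_iso:
  fixes A :: "'a struc" and B :: "'b struc"
  assumes A: "is_struc A" and B: "is_struc B" and Th: "Th A = Th B"
    and cA: "countable (univ A)" and cB: "countable (univ B)"
    and atA: "atomic_model A" and atB: "atomic_model B"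
  shows "iso_struc A B"
proof -
  define E where "E = {(xs, ys). length xs = length ys \<and> set xs \<subseteq> univ A \<and> set ys \<subseteq> univ B \<and>
    (\<forall>\<phi>\<in>forms (length xs). sat A ((!) xs) \<phi> \<longleftrightarrow> sat B ((!) ys) \<phi>)}"
  define P where "P = (\<lambda>(xs, ys). set (zip xs ys)) ` E"
  have P_forth: "\<exists>h\<in>P. g \<subseteq> h \<and> a \<in> Domain h" if gP: "g \<in> P" and aA: "a \<in> univ A" for g a
  proof -
    obtain xs ys where g: "(xs, ys) \<in> E" "g = set (zip xs ys)" using gP by (auto simp: P_def)
    then obtain b where "b \<in> univ B"
      "\<forall>\<phi>\<in>forms (Suc (length xs)). sat A ((!) (xs @ [a])) \<phi> \<longleftrightarrow> sat B ((!) (ys @ [b])) \<phi>"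
      using atomic_forth[OF A B Th atA, of xs ys a] aA by (auto simp: E_def)
    then have "(xs @ [a], ys @ [b]) \<in> E" using g aA by (auto simp: E_def)
    then have "set (zip (xs @ [a]) (ys @ [b])) \<in> P" by (force simp: P_def)
    moreover have "set (zip (xs @ [a]) (ys @ [b])) = insert (a, b) g"
      using g by (auto simp: E_def)
    ultimately show ?thesis by (intro bexI[of _ "insert (a, b) g"]) auto
  qed
  have P_back: "\<exists>h\<in>P. g \<subseteq> h \<and> b \<in> Range h" if gP: "g \<in> P" and aA: "b \<in> univ B" for g b
  proof -
    obtain xs ys where g: "(xs, ys) \<in> E" "g = set (zip xs ys)" using gP by (auto simp: P_def)
    then obtain a where "a \<in> univ A"
      "\<forall>\<phi>\<in>forms (Suc (length ys)). sat B ((!) (ys @ [b])) \<phi> \<longleftrightarrow> sat A ((!) (xs @ [a])) \<phi>"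
      using atomic_forth[OF B A Th[symmetric] atB, of ys xs b] aA by (auto simp: E_def)
    then have "(xs @ [a], ys @ [b]) \<in> E" using g aA by (auto simp: E_def)
    then have "set (zip (xs @ [a]) (ys @ [b])) \<in> P" by (force simp: P_def)
    moreover have "set (zip (xs @ [a]) (ys @ [b])) = insert (a, b) g"
      using g by (auto simp: E_def)
    ultimately show ?thesis by (intro bexI[of _ "insert (a, b) g"]) auto
  qed
  have "([], []) \<in> E"
  proof -
    obtain s t where st: "asg A s" "asg B t" using is_struc_ex_asg A B by metis
    have "sat A ((!) []) \<phi> \<longleftrightarrow> sat B ((!) []) \<phi>" if "\<phi> \<in> forms 0" for \<phi>
      using Th_iff[OF A st(1)] Th_iff[OF B st(2)] that Th sentence_indep by metis
    then show ?thesis by (simp add: E_def)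
  qed
  then have P0: "{} \<in> P" by (force simp: P_def)
  show ?thesis
  proof (rule back_and_forth[OF P0 cA cB _ P_forth P_back])
    fix g a b a' b' assume gP: "g \<in> P" and ab: "(a, b) \<in> g" "(a', b') \<in> g"
    obtain xs ys where g: "(xs, ys) \<in> E" "g = set (zip xs ys)" using gP by (auto simp: P_def)
    have len: "length xs = length ys" "set xs \<subseteq> univ A" "set ys \<subseteq> univ B" using g by (auto simp: E_def)
    obtain i where i: "i < length xs" "a = xs ! i" "b = ys ! i" using ab(1) g(2) by (auto simp: set_zip)
    obtain j where j: "j < length xs" "a' = xs ! j" "b' = ys ! j" using ab(2) g(2) by (auto simp: set_zip)
    have "Eq i j \<in> forms (length xs)" "Rel i j \<in> forms (length xs)" using i j by (auto simp: forms_def)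
    then have "sat A ((!) xs) (Eq i j) \<longleftrightarrow> sat B ((!) ys) (Eq i j)"
      "sat A ((!) xs) (Rel i j) \<longleftrightarrow> sat B ((!) ys) (Rel i j)"
      using g(1) unfolding E_def by blast+
    moreover have "a \<in> univ A" "b \<in> univ B" using i len nth_mem by fastforce+
    ultimately show "a \<in> univ A \<and> b \<in> univ B \<and> (a = a' \<longleftrightarrow> b = b') \<and> ((a, a') \<in> rel A \<longleftrightarrow> (b, b') \<in> rel B)"
      using i j by simp
  qed
qed

text \<open>Only finitely many tuples have to be told apart from the given one.\<close>

lemma finite_atomic_model:
  fixes A :: "'a struc"
  assumes A: "is_struc A" and fin: "finite (univ A)"
  shows "atomic_model A"
  unfolding atomic_model_def
proof (intro allI impI)
  fix xs assume xs: "set xs \<subseteq> univ A"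
  define l where "l = length xs"
  define S where "S = {ys. set ys \<subseteq> univ A \<and> length ys = l \<and>
    (\<exists>\<phi>\<in>forms l. sat A ((!) xs) \<phi> \<and> \<not> sat A ((!) ys) \<phi>)}"
  have fS: "finite S"
    by (rule finite_subset[OF _ finite_lists_length_eq[OF fin, of l]]) (auto simp: S_def)
  define F where "F ys = (SOME \<phi>. \<phi> \<in> forms l \<and> sat A ((!) xs) \<phi> \<and> \<not> sat A ((!) ys) \<phi>)" for ys
  have F: "F ys \<in> forms l \<and> sat A ((!) xs) (F ys) \<and> \<not> sat A ((!) ys) (F ys)" if "ys \<in> S" for ys
    unfolding F_def by (rule someI_ex) (use that in \<open>auto simp: S_def\<close>)
  obtain Ss where Ss: "set Ss = S" using finite_list[OF fS] by blast
  define \<chi> where "\<chi> = Conj (map F Ss)"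
  have \<chi>: "\<chi> \<in> forms l" "sat A ((!) xs) \<chi>"
    using F Ss unfolding \<chi>_def by (auto simp: forms_def fv_Conj sat_Conj)
  have "xs ! j \<in> univ A" if "j < l" for j using that xs by (auto simp: l_def)
  then obtain s where s: "asg A s" "\<forall>j<l. s j = xs ! j" using asg_extend[OF A, of l "(!) xs"] by blast
  have xs_s: "sat A ((!) xs) \<phi> \<longleftrightarrow> sat A s \<phi>" if "\<phi> \<in> forms l" for \<phi>
    by (rule sat_cong_forms[OF that]) (simp add: s(2))
  have "complete_form (Th A) l \<chi>"
  proof (rule complete_formI[OF \<chi>(1) s(1)])
    show "sat A s \<chi>" using \<chi> xs_s by blast
    fix t \<psi> assume t: "asg A t" "sat A t \<chi>" and \<psi>: "\<psi> \<in> forms l" "sat A s \<psi>"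
    define ys where "ys = map t [0..<l]"
    have ys_t: "sat A ((!) ys) \<phi> \<longleftrightarrow> sat A t \<phi>" if "\<phi> \<in> forms l" for \<phi>
      by (rule sat_cong_forms[OF that]) (simp add: ys_def)
    have "ys \<notin> S"
    proof
      assume "ys \<in> S"
      then have "\<not> sat A t (F ys)" "F ys \<in> set (map F Ss)" using F ys_t Ss by auto
      then show False using t(2) unfolding \<chi>_def sat_Conj by blast
    qed
    moreover have "set ys \<subseteq> univ A" "length ys = l" using t(1) by (auto simp: ys_def)
    ultimately have "sat A ((!) xs) \<psi> \<longrightarrow> sat A ((!) ys) \<psi>" using \<psi>(1) by (auto simp: S_def)
    then show "sat A t \<psi>" using \<psi> xs_s ys_t by blast
  qed
  then show "\<exists>\<phi>. complete_form (Th A) (length xs) \<phi> \<and> sat A ((!) xs) \<phi>" using \<chi>(2) l_def by blast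
qed

lemma finite_Th_transfer:
  fixes A :: "'a struc" and B :: "'b struc"
  assumes A: "is_struc A" and B: "is_struc B" and Th: "Th A = Th B" and fin: "finite (univ A)"
  shows "finite (univ B)"
proof (rule ccontr)
  assume "infinite (univ B)"
  define N where "N = Suc (card (univ A))"
  \<comment> \<open>"there are at least \<open>N\<close> elements"\<close>
  define \<theta> where "\<theta> = Exs [0..<N] (Conj [Neg (Eq i j). j \<leftarrow> [0..<N], i \<leftarrow> [0..<j]])"
  have "fv \<theta> = {}" unfolding \<theta>_def fv_Exs fv_Conj by auto
  then have \<theta>0: "\<theta> \<in> forms 0" by (simp add: forms_def)
  obtain T where T: "T \<subseteq> univ B" "finite T" "card T = N"
    using infinite_arbitrarily_large[OF \<open>infinite (univ B)\<close>] by metis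
  obtain h where h: "bij_betw h {0..<N} T" using ex_bij_betw_nat_finite[OF T(2)] T(3) by auto
  obtain t where t: "asg B t" using is_struc_ex_asg[OF B] by blast
  have hB: "h i \<in> univ B" if "i < N" for i
    using that h T(1) by (metis atLeastLessThan_iff bij_betw_apply subsetD zero_le)
  have "sat B t \<theta>"
    unfolding \<theta>_def sat_Exs
  proof (intro exI[of _ "\<lambda>v. if v < N then h v else t v"] conjI)
    have "h i \<noteq> h j" if "i < j" "j < N" for i j
      using that inj_onD[OF bij_betw_imp_inj_on[OF h], of i j] by auto
    then show "sat B (\<lambda>v. if v < N then h v else t v) (Conj [Neg (Eq i j). j \<leftarrow> [0..<N], i \<leftarrow> [0..<j]])"
      unfolding sat_Conj by auto
  qed (use hB in auto)
  then have "\<theta> \<in> Th A" using Th_iff[OF B t] \<theta>0 Th by blast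
  obtain s where s: "asg A s" using is_struc_ex_asg[OF A] by blast
  have "sat A s \<theta>" using \<open>\<theta> \<in> Th A\<close> Th_iff[OF A s] by blast
  then obtain u where u: "\<forall>v\<in>set [0..<N]. u v \<in> univ A"
    "sat A u (Conj [Neg (Eq i j). j \<leftarrow> [0..<N], i \<leftarrow> [0..<j]])"
    unfolding \<theta>_def sat_Exs by blast
  have neq: "u i \<noteq> u j" if "i < j" "j < N" for i j
  proof -
    have "Neg (Eq i j) \<in> set [Neg (Eq i j). j \<leftarrow> [0..<N], i \<leftarrow> [0..<j]]"
      using that by (auto intro!: bexI[of _ j])
    then have "sat A u (Neg (Eq i j))" using u(2) unfolding sat_Conj by blast
    then show ?thesis by simp
  qed
  have "inj_on u {0..<N}"
  proof (rule inj_onI)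
    fix i j assume "i \<in> {0..<N}" "j \<in> {0..<N}" "u i = u j"
    then show "i = j" using neq[of i j] neq[of j i] by (cases i j rule: linorder_cases) auto
  qed
  then have "card {0..<N} \<le> card (univ A)" using u(1) by (intro card_inj_on_le[OF _ _ fin]) auto
  then show False by (simp add: N_def)
qed

text \<open>Finite structures are atomic, so this is an instance of the uniqueness of countable atomic models.\<close>

lemma finite_Th_iso:
  fixes A :: "'a struc" and B :: "'b struc"
  assumes "is_struc A" "is_struc B" "Th A = Th B" "finite (univ A)"
  shows "iso_struc A B"
  using assms finite_Th_transfer[OF assms]
  by (intro countable_atomic_models_iso finite_atomic_model) (auto simp: countable_finite)

section \<open>The number of countable models is never two\<close>

definition Mods :: "'a struc \<Rightarrow> nat struc set" where
  "Mods A = {B. is_struc B \<and> Th B = Th A}"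

lemma Mods_quotient_finite:
  assumes A: "is_struc A" and fin: "finite (univ A)"
  shows "\<exists>C. Mods A // iso_rel = {C}"
proof -
  obtain B :: "nat struc" where B: "is_struc B" "Th B = Th A" using Lowenheim_Skolem[OF A] by metis
  have fB: "finite (univ B)" using finite_Th_transfer[OF A B(1) _ fin] B(2) by simp
  have "iso_rel `` {C} = iso_rel `` {B}" if "C \<in> Mods A" for C
  proof -
    have "iso_struc B C" using that finite_Th_iso[OF B(1) _ _ fB, of C] B by (simp add: Mods_def)
    then have "(B, C) \<in> iso_rel" using that B by (simp add: iso_rel_def Mods_def)
    then show ?thesis using equiv_class_eq[OF equiv_iso_rel] by metis
  qed
  then have "Mods A // iso_rel = {iso_rel `` {B}}"
    using B unfolding quotient_def Mods_def by blast
  then show ?thesis by blast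
qed

text \<open>For theories with finite models the isomorphism classes of all countable models also give the number
  1, since there is only one such class. This treats the two cases of \<open>num_models\<close> uniformly.\<close>

lemma num_models_eq:
  assumes A: "is_struc A"
  shows "num_models (Th A) =o |Mods A // iso_rel|"
proof (cases "finite (univ A)")
  case True
  obtain B :: "nat struc" where B: "is_struc B" "Th B = Th A" using Lowenheim_Skolem[OF A] by metis
  have fB: "finite (univ B)" using finite_Th_transfer[OF A B(1) _ True] B(2) by simp
  obtain C where C: "Mods A // iso_rel = {C}" using Mods_quotient_finite[OF A True] by blast
  have "\<exists>A' :: nat struc. models A' (Th A) \<and> finite (univ A')"
    using B fB A by (auto simp: models_Th_iff)
  then have "num_models (Th A) = |{{}}|" by (simp add: num_models_def)
  moreover have "|{{}} :: nat struc set set| =o |{C}|" by (rule card_of_ordIsoI[of "\<lambda>_. C"]) (simp add: bij_betw_def)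
  ultimately show ?thesis by (simp add: C)
next
  case False
  have inf: "infinite (univ B)" if "is_struc B" "Th B = Th A" for B :: "nat struc"
    using finite_Th_transfer[OF that(1) A that(2)] False by blast
  then have no_fin: "\<not> (\<exists>A' :: nat struc. models A' (Th A) \<and> finite (univ A'))"
    using A by (auto simp: models_Th_iff)
  have all_inf: "{B :: nat struc. models B (Th A) \<and> infinite (univ B)} = Mods A"
    using inf A by (auto simp: models_Th_iff Mods_def)
  show ?thesis unfolding num_models_def if_not_P[OF no_fin] all_inf by (rule card_of_refl)
qed

lemma quotient_iso_nonempty: "is_struc A \<Longrightarrow> Mods A // iso_rel \<noteq> {}"
  using Lowenheim_Skolem[of A] unfolding quotient_def Mods_def by blast

lemma iso_class_eq_iff:
  "is_struc B \<Longrightarrow> is_struc C \<Longrightarrow> iso_rel `` {B} = iso_rel `` {C} \<longleftrightarrow> iso_struc B C"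
  using eq_equiv_class_iff[OF equiv_iso_rel, of B C] by (simp add: iso_rel_def)

text \<open>Every type is realized in some countable model, and each of these realizes only countably
  many types.\<close>

lemma small_if_countably_many_models:
  assumes A: "is_struc A" and cnt: "countable (Mods A // iso_rel)"
  shows "small_theory (Th A)"
proof -
  define rep where "rep C = (SOME B. B \<in> C)" for C :: "nat struc set"
  define R where "R = (\<lambda>(C, xs). tp (length xs) (rep C) ((!) xs)) ` ((Mods A // iso_rel) \<times> (UNIV :: nat list set))"
  have "countable R" unfolding R_def using cnt by (intro countable_image countable_SIGMA) auto
  moreover have "(\<Union>l. complete_types l (Th A)) \<subseteq> R"
  proof
    fix p assume "p \<in> (\<Union>l. complete_types l (Th A))"
    then obtain l where p: "p \<in> complete_types l (Th A)" by blast
    obtain B :: "nat struc" and s where B: "is_struc B" "Th B = Th A" "asg B s" "p = tp l B s"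
      using complete_type_realized[OF A p] by metis
    let ?C = "iso_rel `` {B}"
    have C: "?C \<in> Mods A // iso_rel" using B by (auto simp: Mods_def quotient_def)
    have "B \<in> ?C" using B(1) iso_refl by (auto simp: iso_rel_def)
    then have "rep ?C \<in> ?C" unfolding rep_def by (rule someI)
    then have "(B, rep ?C) \<in> iso_rel" by blast
    moreover have "(B, B') \<in> iso_rel \<Longrightarrow> iso_struc B B'" for B' by (simp add: iso_rel_def)
    ultimately have "iso_struc B (rep ?C)" by blast
    then obtain f where f: "bij_betw f (univ B) (univ (rep ?C))"
      "\<And>x y. x \<in> univ B \<Longrightarrow> y \<in> univ B \<Longrightarrow> (x, y) \<in> rel B \<longleftrightarrow> (f x, f y) \<in> rel (rep ?C)"
      by (auto simp: iso_struc_def)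
    have "tp l B s = tp l (rep ?C) (f \<circ> s)" unfolding tp_def using sat_iso[OF f B(3)] by blast
    also have "\<dots> = tp l (rep ?C) ((!) (map (f \<circ> s) [0..<l]))" by (rule tp_cong) simp
    finally have "p = (\<lambda>(C, xs). tp (length xs) (rep C) ((!) xs)) (?C, map (f \<circ> s) [0..<l])"
      using B(4) by simp
    then show "p \<in> R" unfolding R_def using C by blast
  qed
  ultimately show ?thesis unfolding small_theory_def by (rule countable_subset[rotated])
qed

text \<open>Isolation relative to a type \<open>p\<close> in the first variables replaces isolation in the theory of a
  model with names for a realization of \<open>p\<close>. Over the empty set it is isolation in the usual sense.\<close>

definition isolated_over :: "'a struc \<Rightarrow> form set \<Rightarrow> nat \<Rightarrow> form set \<Rightarrow> bool" where
  "isolated_over A p l r \<longleftrightarrow> (\<exists>\<psi>\<in>forms l. fsat A (insert \<psi> p) \<and>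
     (\<forall>\<phi>\<in>r. \<not> fsat A (insert (Neg \<phi>) (insert \<psi> p))))"

lemma isolated_imp_complete_form:
  assumes A: "is_struc A" and p: "p \<in> complete_types k (Th A)" and iso: "isolated_over A {} k p"
  shows "\<exists>\<chi>\<in>p. complete_form (Th A) k \<chi>"
proof -
  obtain \<psi> where \<psi>: "\<psi> \<in> forms k" "fsat A {\<psi>}" "\<And>\<phi>. \<phi> \<in> p \<Longrightarrow> \<not> fsat A {Neg \<phi>, \<psi>}"
    using iso by (auto simp: isolated_over_def)
  have v: "valid A (Imp \<psi> \<phi>)" if "\<phi> \<in> p" for \<phi>
    unfolding valid_def
  proof (intro allI impI)
    fix s assume s: "asg A s"
    show "sat A s (Imp \<psi> \<phi>)"
    proof (rule ccontr)
      assume "\<not> sat A s (Imp \<psi> \<phi>)"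
      then have "fsat A {Neg \<phi>, \<psi>}" by (intro fsatI_sat[OF s]) auto
      then show False using \<psi>(3) that by blast
    qed
  qed
  obtain s where s: "asg A s" "sat A s \<psi>" using fsatD[OF \<psi>(2) subset_refl] by auto
  have pp: "\<phi> \<in> p \<or> Neg \<phi> \<in> p" if "\<phi> \<in> forms k" for \<phi>
    using that p by (simp add: complete_types_def)
  have "Neg \<psi> \<notin> p" using v[of "Neg \<psi>"] s by (auto simp: valid_def)
  then have "\<psi> \<in> p" using pp \<psi>(1) by blast
  moreover have "complete_form (Th A) k \<psi>"
    unfolding complete_form_Th_iff using \<psi>(1) s pp v by blast
  ultimately show ?thesis by blast
qed

text \<open>All models are atomic, and countable atomic models are unique.\<close>

lemma all_isolated_imp_iso:
  fixes A :: "'a struc"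
  assumes A: "is_struc A" and iso: "\<And>l p. p \<in> complete_types l (Th A) \<Longrightarrow> isolated_over A {} l p"
    and B: "B \<in> Mods A" and C: "C \<in> Mods A"
  shows "iso_struc B C"
proof -
  have at: "atomic_model B" if B: "B \<in> Mods A" for B
    unfolding atomic_model_def
  proof (intro allI impI)
    fix xs assume xs: "set xs \<subseteq> univ B"
    have "tp (length xs) B ((!) xs) \<in> complete_types (length xs) (Th A)"
      using B xs by (intro tp_complete_type[OF A]) (auto simp: Mods_def)
    from isolated_imp_complete_form[OF A this iso[OF this]]
    show "\<exists>\<phi>. complete_form (Th B) (length xs) \<phi> \<and> sat B ((!) xs) \<phi>"
      using B by (auto simp: tp_def Mods_def)
  qed
  show ?thesis
    using B C at by (intro countable_atomic_models_iso) (auto simp: Mods_def)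
qed

lemma fsat_complete_type: "is_struc A \<Longrightarrow> r \<in> complete_types l (Th A) \<Longrightarrow> fsat A r"
  by (simp add: complete_types_Th_iff)

lemma complete_type_not_both:
  assumes "is_struc A" "r \<in> complete_types l (Th A)" "\<phi> \<in> r" shows "Neg \<phi> \<notin> r"
proof
  assume "Neg \<phi> \<in> r"
  then show False using fsatD[OF fsat_complete_type[OF assms(1,2)], of "{\<phi>, Neg \<phi>}"] assms(3) by auto
qed

text \<open>Over a type, compactness turns isolation of all complete types into finiteness of their
  number: the negations of the isolating formulas cannot be satisfied together.\<close>

lemma finite_if_all_isolated_over:
  assumes A: "is_struc A" and p: "p \<subseteq> forms l"
    and iso: "\<And>r. r \<in> complete_types l (Th A) \<Longrightarrow> p \<subseteq> r \<Longrightarrow> isolated_over A p l r"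
  shows "finite {r \<in> complete_types l (Th A). p \<subseteq> r}"
proof -
  define R where "R = {r \<in> complete_types l (Th A). p \<subseteq> r}"
  define \<Psi> where "\<Psi> r = (SOME \<psi>. \<psi> \<in> forms l \<and> fsat A (insert \<psi> p) \<and>
    (\<forall>\<phi>\<in>r. \<not> fsat A (insert (Neg \<phi>) (insert \<psi> p))))" for r
  have \<Psi>: "\<Psi> r \<in> forms l \<and> fsat A (insert (\<Psi> r) p) \<and>
    (\<forall>\<phi>\<in>r. \<not> fsat A (insert (Neg \<phi>) (insert (\<Psi> r) p)))" if "r \<in> R" for r
    unfolding \<Psi>_def by (rule someI_ex) (use iso[of r] that in \<open>auto simp: R_def isolated_over_def\<close>)
  have Rfsat: "fsat A r" and Rdec: "\<And>\<phi>. \<phi> \<in> forms l \<Longrightarrow> \<phi> \<in> r \<or> Neg \<phi> \<in> r" and Rsub: "p \<subseteq> r"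
    if "r \<in> R" for r
    using that by (simp_all add: R_def complete_types_Th_iff[OF A])
  have uniq: "r0 = r" if r: "r \<in> R" "r0 \<in> R" "\<Psi> r0 \<in> r" for r r0
  proof -
    have "r0 \<subseteq> r"
    proof
      fix \<phi> assume \<phi>: "\<phi> \<in> r0"
      have "\<phi> \<in> forms l" using \<phi> r(2) by (auto simp: R_def complete_types_def)
      moreover have "Neg \<phi> \<notin> r"
      proof
        assume "Neg \<phi> \<in> r"
        then have "insert (Neg \<phi>) (insert (\<Psi> r0) p) \<subseteq> r" using r(3) Rsub[OF r(1)] by auto
        then show False using \<Psi>[OF r(2)] fsat_mono[OF Rfsat[OF r(1)]] \<phi> by blast
      qed
      ultimately show "\<phi> \<in> r" using Rdec[OF r(1)] by blast
    qed
    then show ?thesis using complete_type_maximal[OF A] r(1,2) by (auto simp: R_def)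
  qed
  \<comment> \<open>the formula that isolates \<open>r\<close> belongs to \<open>r\<close> and, by \<open>uniq\<close>, to no other type over \<open>p\<close>\<close>
  have own: "\<Psi> r \<in> r" if r: "r \<in> R" for r
  proof (rule ccontr)
    assume "\<Psi> r \<notin> r"
    then have "Neg (\<Psi> r) \<in> r" using Rdec[OF r] \<Psi>[OF r] by blast
    then have "\<not> fsat A (insert (Neg (Neg (\<Psi> r))) (insert (\<Psi> r) p))" using \<Psi>[OF r] by blast
    moreover have "fsat A (insert (Neg (Neg (\<Psi> r))) (insert (\<Psi> r) p))"
      by (rule fsat_conseq[of _ _ "{\<Psi> r}"]) (use \<Psi>[OF r] in auto)
    ultimately show False by blast
  qed
  let ?N = "p \<union> (\<lambda>r. Neg (\<Psi> r)) ` R"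
  have "\<not> fsat A ?N"
  proof
    assume f: "fsat A ?N"
    have "?N \<subseteq> forms l" using p \<Psi> by auto
    then obtain r where r: "r \<in> complete_types l (Th A)" "?N \<subseteq> r"
      using extend_to_complete_type[OF A f] by metis
    then have "r \<in> R" by (auto simp: R_def)
    then have "Neg (\<Psi> r) \<in> r" "\<Psi> r \<in> r" using r(2) own by auto
    then show False using complete_type_not_both[OF A r(1)] by blast
  qed
  then obtain F where F: "F \<subseteq> ?N" "finite F" "\<And>s. asg A s \<Longrightarrow> \<exists>\<phi>\<in>F. \<not> sat A s \<phi>"
    using not_fsatE by metis
  have "finite (F \<inter> (\<lambda>r. Neg (\<Psi> r)) ` R)" using F(2) by simp
  then obtain R0 where R0: "R0 \<subseteq> R" "finite R0" "F \<inter> (\<lambda>r. Neg (\<Psi> r)) ` R = (\<lambda>r. Neg (\<Psi> r)) ` R0"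
    using finite_subset_image[of "F \<inter> (\<lambda>r. Neg (\<Psi> r)) ` R" "\<lambda>r. Neg (\<Psi> r)" R] by blast
  have "R \<subseteq> R0"
  proof
    fix r assume r: "r \<in> R"
    have "\<not> F \<subseteq> r"
    proof
      assume "F \<subseteq> r"
      then obtain s where "asg A s" "\<forall>\<phi>\<in>F. sat A s \<phi>" using fsatD[OF Rfsat[OF r] _ F(2)] by blast
      then show False using F(3) by blast
    qed
    then obtain \<phi> where \<phi>: "\<phi> \<in> F" "\<phi> \<notin> r" by blast
    then have "\<phi> \<in> F \<inter> (\<lambda>r. Neg (\<Psi> r)) ` R" using F(1) Rsub[OF r] by auto
    then obtain r0 where r0: "r0 \<in> R0" "\<phi> = Neg (\<Psi> r0)" unfolding R0(3) by blast
    then have "r0 \<in> R" using R0 by blast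
    moreover from this have "\<Psi> r0 \<in> r" using Rdec[OF r, of "\<Psi> r0"] \<Psi> \<phi>(2) r0(2) by blast
    ultimately show "r \<in> R0" using uniq[OF r] r0(1) by blast
  qed
  then show ?thesis using R0(2) finite_subset unfolding R_def by blast
qed

text \<open>Choose for each of the other types a formula in \<open>p\<close> that is not in it; their conjunction isolates \<open>p\<close>.\<close>

lemma isolated_if_finitely_many_types:
  assumes A: "is_struc A" and fin: "finite (complete_types k (Th A))" and p: "p \<in> complete_types k (Th A)"
  shows "isolated_over A {} k p"
proof -
  define Q where "Q = complete_types k (Th A) - {p}"
  have "\<exists>\<phi>. \<phi> \<in> p \<and> \<phi> \<notin> q" if "q \<in> Q" for q
    using complete_type_maximal[OF A p, of q] that by (auto simp: Q_def)
  then obtain F where F: "\<And>q. q \<in> Q \<Longrightarrow> F q \<in> p \<and> F q \<notin> q" by metis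
  have "finite Q" using fin by (simp add: Q_def)
  then obtain Qs where Qs: "set Qs = Q" using finite_list by blast
  define \<chi> where "\<chi> = Conj (map F Qs)"
  have pf: "p \<subseteq> forms k" "fsat A p" using p by (simp_all add: complete_types_Th_iff[OF A])
  have "F q \<in> forms k" if "q \<in> Q" for q using F[OF that] pf(1) by blast
  then have "\<chi> \<in> forms k" using Qs by (auto simp: \<chi>_def forms_def fv_Conj)
  moreover have "fsat A {\<chi>}"
  proof -
    have "fsat A (insert \<chi> p)"
      by (rule fsat_conseq[OF pf(2), of "F ` Q"]) (use F Qs \<open>finite Q\<close> in \<open>auto simp: \<chi>_def sat_Conj\<close>)
    then show ?thesis by (rule fsat_mono) simp
  qed
  moreover have "\<not> fsat A {Neg \<phi>, \<chi>}" if \<phi>: "\<phi> \<in> p" for \<phi>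
  proof
    assume "fsat A {Neg \<phi>, \<chi>}"
    then obtain s where s: "asg A s" "sat A s (Neg \<phi>)" "sat A s \<chi>" using fsatD[OF _ subset_refl] by blast
    have q: "tp k A s \<in> complete_types k (Th A)" using s(1) by (intro tp_complete_type[OF A A]) auto
    have "\<phi> \<notin> tp k A s" using s(2) by (simp add: tp_def)
    then have "tp k A s \<in> Q" using \<phi> q by (auto simp: Q_def)
    then have "F (tp k A s) \<notin> tp k A s" "F (tp k A s) \<in> p" using F by auto
    then have "\<not> sat A s (F (tp k A s))" using pf(1) by (auto simp: tp_def)
    then show False using s(3) Qs \<open>tp k A s \<in> Q\<close> by (auto simp: \<chi>_def sat_Conj)
  qed
  ultimately show ?thesis unfolding isolated_over_def by blast
qed

text \<open>The second half of a \<open>2k\<close>-tuple whose first half realizes \<open>p\<close> can have any \<open>k\<close>-type. If \<open>p\<close> is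
  not isolated there are infinitely many \<open>k\<close>-types, hence infinitely many \<open>2k\<close>-types over \<open>p\<close>.\<close>

lemma nonisolated_over_nonisolated:
  assumes A: "is_struc A" and p: "p \<in> complete_types k (Th A)" and ni: "\<not> isolated_over A {} k p"
  obtains r where "r \<in> complete_types (k + k) (Th A)" "p \<subseteq> r" "\<not> isolated_over A p (k + k) r"
proof -
  have "\<exists>r\<in>complete_types (k + k) (Th A). p \<subseteq> r \<and> \<not> isolated_over A p (k + k) r"
  proof (rule ccontr)
    assume n: "\<not> ?thesis"
    have pf: "p \<subseteq> forms k" "fsat A p" using p by (simp_all add: complete_types_Th_iff[OF A])
    have p2: "p \<subseteq> forms (k + k)" by (rule order_trans[OF pf(1) forms_mono]) simp
    let ?R = "{r \<in> complete_types (k + k) (Th A). p \<subseteq> r}"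
    have fR: "finite ?R" using n by (intro finite_if_all_isolated_over[OF A p2]) auto
    let ?sh = "\<lambda>\<theta>. ren \<theta> (\<lambda>v. v + k)"
    define h where "h r = {\<theta> \<in> forms k. ?sh \<theta> \<in> r}" for r
    have "complete_types k (Th A) \<subseteq> h ` ?R"
    proof
      fix q assume q: "q \<in> complete_types k (Th A)"
      have qf: "q \<subseteq> forms k" "fsat A q" using q by (simp_all add: complete_types_Th_iff[OF A])
      have "fsat A (p \<union> ?sh ` q)"
        unfolding fsat_def
      proof (intro allI impI)
        fix F assume F: "F \<subseteq> p \<union> ?sh ` q" "finite F"
        obtain s where s: "asg A s" "\<forall>\<phi>\<in>F \<inter> p. sat A s \<phi>" using fsatD[OF pf(2), of "F \<inter> p"] F(2) by auto
        have "finite (F \<inter> ?sh ` q)" using F(2) by simp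
        then obtain G where G: "G \<subseteq> q" "finite G" "F \<inter> ?sh ` q = ?sh ` G"
          using finite_subset_image[of "F \<inter> ?sh ` q" ?sh q] by blast
        obtain t where t: "asg A t" "\<forall>\<phi>\<in>G. sat A t \<phi>" using fsatD[OF qf(2) G(1,2)] by blast
        \<comment> \<open>juxtapose a realization of a part of \<open>p\<close> and one of a part of \<open>q\<close>\<close>
        define u where "u v = (if v < k then s v else t (v - k))" for v
        have "asg A u" using s(1) t(1) by (simp add: u_def asg_def)
        moreover have "sat A u \<phi>" if "\<phi> \<in> F" for \<phi>
        proof (cases "\<phi> \<in> p")
          case True
          then have "\<phi> \<in> forms k" using pf(1) by blast
          then have "sat A u \<phi> \<longleftrightarrow> sat A s \<phi>" by (rule sat_cong_forms) (simp add: u_def)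
          then show ?thesis using s(2) that True by blast
        next
          case False
          then have "\<phi> \<in> ?sh ` G" using that F(1) unfolding G(3)[symmetric] by blast
          then obtain \<theta> where \<theta>: "\<theta> \<in> G" "\<phi> = ?sh \<theta>" by blast
          have "u \<circ> (\<lambda>v. v + k) = t" by (rule ext) (simp add: u_def)
          then show ?thesis using t(2) \<theta> by (simp add: sat_ren)
        qed
        ultimately show "\<exists>s. asg A s \<and> (\<forall>\<phi>\<in>F. sat A s \<phi>)" by blast
      qed
      moreover have "?sh \<theta> \<in> forms (k + k)" if "\<theta> \<in> q" for \<theta>
      proof -
        have "fv \<theta> \<subseteq> {..<k}" using that qf(1) by (auto simp: forms_def)
        then show ?thesis by (auto simp: forms_def fv_ren)
      qed
      then have "p \<union> ?sh ` q \<subseteq> forms (k + k)" using p2 by blast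
      ultimately obtain r where r: "r \<in> complete_types (k + k) (Th A)" "p \<union> ?sh ` q \<subseteq> r"
        using extend_to_complete_type[OF A] by metis
      have "h r = q"
      proof
        show "q \<subseteq> h r" using r(2) qf(1) by (auto simp: h_def)
        show "h r \<subseteq> q"
        proof
          fix \<theta> assume \<theta>: "\<theta> \<in> h r"
          show "\<theta> \<in> q"
          proof (rule ccontr)
            assume "\<theta> \<notin> q"
            then have "Neg \<theta> \<in> q" using \<theta> q by (auto simp: h_def complete_types_def)
            then have "?sh (Neg \<theta>) \<in> r" using r(2) by blast
            then show False using complete_type_not_both[OF A r(1), of "?sh \<theta>"] \<theta> by (simp add: h_def)
          qed
        qed
      qed
      then show "q \<in> h ` ?R" using r by blast
    qed
    then have "finite (complete_types k (Th A))" using fR finite_subset by blast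
    then show False using isolated_if_finitely_many_types[OF A _ p] ni by blast
  qed
  then show ?thesis using that by blast
qed

text \<open>Saturation realizes types in one variable over a tuple, hence types in several variables one variable
  at a time.\<close>

lemma saturated_extends:
  fixes B :: "'b struc"
  assumes A: "is_struc A" and B: "is_struc B" "Th B = Th A" "omega_saturated B"
    and r: "r \<in> complete_types l (Th A)" and kl: "k \<le> l"
    and s: "asg B s" "\<And>\<phi>. \<phi> \<in> r \<inter> forms k \<Longrightarrow> sat B s \<phi>"
  shows "\<exists>t. asg B t \<and> (\<forall>j<k. t j = s j) \<and> (\<forall>\<phi>\<in>r. sat B t \<phi>)"
proof -
  have rl: "r \<subseteq> forms l" and rf: "fsat B r" and rd: "\<And>\<phi>. \<phi> \<in> forms l \<Longrightarrow> \<phi> \<in> r \<or> Neg \<phi> \<in> r"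
    using r fsat_cong_Th[OF B(2)] by (auto simp: complete_types_Th_iff[OF A])
  have "\<exists>t. asg B t \<and> (\<forall>j<k. t j = s j) \<and> (\<forall>\<phi>\<in>r \<inter> forms i. sat B t \<phi>)" if "k \<le> i" "i \<le> l" for i
    using that
  proof (induction i rule: dec_induct)
    case base
    then show ?case using s by blast
  next
    case (step i)
    then obtain t where t: "asg B t" "\<forall>j<k. t j = s j" "\<forall>\<phi>\<in>r \<inter> forms i. sat B t \<phi>" by auto
    let ?xs = "map t [0..<i]"
    have eq: "sat B ((!) (?xs @ [b])) \<phi> \<longleftrightarrow> sat B (t(i := b)) \<phi>" if "\<phi> \<in> forms (Suc i)" for b \<phi>
      by (rule sat_cong_forms[OF that]) (auto simp: nth_append less_Suc_eq)
    have "\<exists>b\<in>univ B. \<forall>\<phi>\<in>Q. sat B ((!) (?xs @ [b])) \<phi>" if Q: "Q \<subseteq> r \<inter> forms (Suc i)" "finite Q" for Q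
    proof -
      obtain Qs where Qs: "set Qs = Q" using finite_list[OF Q(2)] by blast
      let ?\<psi> = "Ex i (Conj Qs)"
      have "fv (Conj Qs) \<subseteq> {..<Suc i}" using Q(1) Qs by (auto simp: fv_Conj forms_def)
      then have \<psi>i: "?\<psi> \<in> forms i" by (auto simp: forms_def less_Suc_eq)
      then have "?\<psi> \<in> forms l" using forms_mono[of i l] step.prems by auto
      moreover have "Neg ?\<psi> \<notin> r"
      proof
        assume "Neg ?\<psi> \<in> r"
        then obtain u where u: "asg B u" "\<forall>\<phi>\<in>insert (Neg ?\<psi>) Q. sat B u \<phi>"
          using fsatD[OF rf, of "insert (Neg ?\<psi>) Q"] Q by auto
        then have "sat B u (Neg ?\<psi>)" by blast
        then have "\<forall>a\<in>univ B. \<not> sat B (u(i := a)) (Conj Qs)" by simp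
        then have "\<not> sat B (u(i := u i)) (Conj Qs)" using asgD[OF u(1)] by blast
        then show False using u(2) Qs by (simp add: sat_Conj)
      qed
      ultimately have "?\<psi> \<in> r \<inter> forms i" using rd \<psi>i by blast
      then have "sat B t ?\<psi>" using t(3) by blast
      then obtain b where b: "b \<in> univ B" "sat B (t(i := b)) (Conj Qs)" by auto
      then show ?thesis using eq Q(1) Qs by (intro bexI[OF _ b(1)]) (auto simp: sat_Conj)
    qed
    moreover have "set ?xs \<subseteq> univ B" using t(1) by auto
    ultimately obtain b where b: "b \<in> univ B" "\<forall>\<phi>\<in>r \<inter> forms (Suc i). sat B ((!) (?xs @ [b])) \<phi>"
      using B(3)[unfolded omega_saturated_def, rule_format, of ?xs "r \<inter> forms (Suc i)"] by auto
    have "asg B (t(i := b))" using t(1) b(1) by simp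
    moreover have "\<forall>j<k. (t(i := b)) j = s j" using t(2) step.hyps by simp
    moreover have "\<forall>\<phi>\<in>r \<inter> forms (Suc i). sat B (t(i := b)) \<phi>" using b(2) eq by blast
    ultimately show ?case by blast
  qed
  from this[OF kl order_refl] show ?thesis using rl by blast
qed

text \<open>The isomorphism invariant that distinguishes the saturated model from the model that realizes \<open>p\<close>
  without extending the realization to one of \<open>r\<close>.\<close>

definition realizing_extends :: "'b struc \<Rightarrow> form set \<Rightarrow> nat \<Rightarrow> form set \<Rightarrow> bool" where
  "realizing_extends B p k r \<longleftrightarrow> (\<forall>s. asg B s \<longrightarrow> (\<forall>\<phi>\<in>p. sat B s \<phi>) \<longrightarrow>
     (\<exists>t. asg B t \<and> (\<forall>j<k. t j = s j) \<and> (\<forall>\<phi>\<in>r. sat B t \<phi>)))"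

lemma realizing_extends_iso:
  assumes "iso_struc B C" "realizing_extends C p k r" shows "realizing_extends B p k r"
  unfolding realizing_extends_def
proof (intro allI impI)
  obtain f where f: "bij_betw f (univ B) (univ C)"
    "\<And>x y. x \<in> univ B \<Longrightarrow> y \<in> univ B \<Longrightarrow> (x, y) \<in> rel B \<longleftrightarrow> (f x, f y) \<in> rel C"
    using assms(1) by (auto simp: iso_struc_def)
  fix s assume s: "asg B s" "\<forall>\<phi>\<in>p. sat B s \<phi>"
  have "asg C (f \<circ> s)" using s(1) f(1) by (auto simp: asg_def bij_betw_def)
  moreover have "\<forall>\<phi>\<in>p. sat C (f \<circ> s) \<phi>" using s sat_iso[OF f s(1)] by blast
  ultimately obtain t where t: "asg C t" "\<forall>j<k. t j = (f \<circ> s) j" "\<forall>\<phi>\<in>r. sat C t \<phi>"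
    using assms(2) unfolding realizing_extends_def by blast
  let ?g = "inv_into (univ B) f"
  have asg: "asg B (?g \<circ> t)"
    using t(1) bij_betw_apply[OF bij_betw_inv_into[OF f(1)]] by (simp add: asg_def)
  have ft: "f \<circ> (?g \<circ> t) = t"
    using bij_betw_inv_into_right[OF f(1)] t(1) by (auto simp: asg_def)
  have "(?g \<circ> t) j = s j" if "j < k" for j
    using t(2) that bij_betw_inv_into_left[OF f(1)] s(1) by (simp add: asg_def)
  moreover have "\<forall>\<phi>\<in>r. sat B (?g \<circ> t) \<phi>" using sat_iso[OF f asg] t(3) unfolding ft by blast
  ultimately show "\<exists>t. asg B t \<and> (\<forall>j<k. t j = s j) \<and> (\<forall>\<phi>\<in>r. sat B t \<phi>)" using asg by blast
qed

text \<open>Vaught's never-two theorem. If all types were isolated, all countable models would be atomic, hence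
  isomorphic. Let \<open>p\<close> be a nonisolated type and \<open>r\<close> a type that extends \<open>p\<close> and is
  not isolated over it. One countable model omits \<open>p\<close>, one realizes \<open>p\<close> by a tuple that cannot
  be extended to a realization of \<open>r\<close>, and the countable saturated model does neither.\<close>

theorem never_two:
  assumes A: "is_struc A" and cnt: "countable (Mods A // iso_rel)"
    and two: "B \<in> Mods A" "C \<in> Mods A" "\<not> iso_struc B C"
  shows "\<exists>B1\<in>Mods A. \<exists>B2\<in>Mods A. \<exists>B3\<in>Mods A.
    \<not> iso_struc B1 B2 \<and> \<not> iso_struc B1 B3 \<and> \<not> iso_struc B2 B3"
proof -
  obtain k p where p: "p \<in> complete_types k (Th A)" and ni: "\<not> isolated_over A {} k p"
    using all_isolated_imp_iso[OF A _ two(1,2)] two(3) by blast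
  obtain r where r: "r \<in> complete_types (k + k) (Th A)" "p \<subseteq> r" "\<not> isolated_over A p (k + k) r"
    using nonisolated_over_nonisolated[OF A p ni] by metis
  have pf: "p \<subseteq> forms k" "fsat A p" and rf: "r \<subseteq> forms (k + k)"
    using p r(1) by (simp_all add: complete_types_Th_iff[OF A])
  obtain B1 :: "nat struc" where B1: "is_struc B1" "Th B1 = Th A"
    and B1o: "\<And>t. asg B1 t \<Longrightarrow> \<exists>\<phi>\<in>p. \<not> sat B1 t \<phi>"
  proof (rule omitting_types[OF A fsat_empty[OF A] _ pf(1), of 0])
    show "\<exists>\<phi>\<in>p. fsat A {Neg \<phi>, \<psi>}" if "\<psi> \<in> forms k" "fsat A {\<psi>}" for \<psi>
      using ni that unfolding isolated_over_def by blast
  qed auto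
  obtain B2 :: "nat struc" and s where B2: "is_struc B2" "Th B2 = Th A" "asg B2 s" "\<And>\<phi>. \<phi> \<in> p \<Longrightarrow> sat B2 s \<phi>"
    and B2o: "\<And>t. asg B2 t \<Longrightarrow> (\<And>j. j < k \<Longrightarrow> t j = s j) \<Longrightarrow> \<exists>\<phi>\<in>r. \<not> sat B2 t \<phi>"
  proof (rule omitting_types[OF A pf(2,1) rf])
    show "\<exists>\<phi>\<in>r. fsat A (insert (Neg \<phi>) (insert \<psi> p))" if "\<psi> \<in> forms (k + k)" "fsat A (insert \<psi> p)" for \<psi>
      using r(3) that unfolding isolated_over_def by blast
  qed auto
  obtain B3 :: "nat struc" where B3: "is_struc B3" "Th B3 = Th A" "omega_saturated B3"
    using countably_saturated_model_exists[OF A small_if_countably_many_models[OF A cnt]] A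
    by (auto simp: countably_saturated_model_def models_Th_iff)
  have rk: "\<phi> \<in> p" if "\<phi> \<in> r \<inter> forms k" for \<phi>
    using that p r(2) complete_type_not_both[OF A r(1), of \<phi>] by (auto simp: complete_types_def)
  have "realizing_extends B3 p k r"
    unfolding realizing_extends_def
    using saturated_extends[OF A B3 r(1), of k] rk by auto
  moreover have "\<not> realizing_extends B2 p k r"
    unfolding realizing_extends_def using B2 B2o by blast
  ultimately have n23: "\<not> iso_struc B2 B3" using realizing_extends_iso by blast
  have om: "\<not> iso_struc C' B1" if "asg C' t" "\<forall>\<phi>\<in>p. sat C' t \<phi>" for C' :: "nat struc" and t
  proof
    assume "iso_struc C' B1"
    then obtain f where f: "bij_betw f (univ C') (univ B1)"
      "\<And>x y. x \<in> univ C' \<Longrightarrow> y \<in> univ C' \<Longrightarrow> (x, y) \<in> rel C' \<longleftrightarrow> (f x, f y) \<in> rel B1"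
      by (auto simp: iso_struc_def)
    have "asg B1 (f \<circ> t)" using that(1) f(1) by (auto simp: asg_def bij_betw_def)
    then show False using B1o that(2) sat_iso[OF f that(1)] by blast
  qed
  have n12: "\<not> iso_struc B1 B2" using om[OF B2(3)] B2(4) iso_sym by blast
  obtain s0 where s0: "asg B3 s0" using is_struc_ex_asg[OF B3(1)] by blast
  have "sat B3 s0 \<phi>" if \<phi>: "\<phi> \<in> p \<inter> forms 0" for \<phi>
  proof -
    obtain t where "asg A t" "sat A t \<phi>" using fsatD[OF pf(2), of "{\<phi>}"] \<phi> by auto
    then have "\<phi> \<in> Th A" using Th_iff[OF A] \<phi> by blast
    then show ?thesis using B3(2) Th_iff[OF B3(1) s0] by blast
  qed
  then obtain t where "asg B3 t" "\<forall>\<phi>\<in>p. sat B3 t \<phi>"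
    using saturated_extends[OF A B3 p, of 0 s0] s0 by auto
  then have "\<not> iso_struc B1 B3" using om iso_sym by blast
  with n12 n23 B1 B2(1,2) B3(1,2) show ?thesis unfolding Mods_def by blast
qed

lemma three_le_quotient:
  assumes A: "is_struc A" and cnt: "countable (Mods A // iso_rel)"
    and ne: "\<not> |Mods A // iso_rel| =o cone"
  shows "|{..<3 :: nat}| \<le>o |Mods A // iso_rel|"
proof -
  have "\<exists>B\<in>Mods A. \<exists>C\<in>Mods A. \<not> iso_struc B C"
  proof (rule ccontr)
    assume n: "\<not> ?thesis"
    obtain B where B: "B \<in> Mods A" using Lowenheim_Skolem[OF A] unfolding Mods_def by blast
    have "iso_rel `` {C} = iso_rel `` {B}" if "C \<in> Mods A" for C
      using n that B by (subst iso_class_eq_iff) (auto simp: Mods_def)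
    then have "Mods A // iso_rel = {iso_rel `` {B}}" using B unfolding quotient_def by blast
    then have "|Mods A // iso_rel| =o cone" unfolding cone_def
      by (simp add: card_of_ordIsoI[of "\<lambda>_. ()"] bij_betw_def)
    with ne show False by blast
  qed
  then obtain B1 B2 B3 where B: "B1 \<in> Mods A" "B2 \<in> Mods A" "B3 \<in> Mods A"
    "\<not> iso_struc B1 B2" "\<not> iso_struc B1 B3" "\<not> iso_struc B2 B3"
    using never_two[OF A cnt] by blast
  let ?c = "\<lambda>B. iso_rel `` {B}"
  define f where "f i = (if i = 0 then ?c B1 else if i = 1 then ?c B2 else ?c B3)" for i :: nat
  have "?c B1 \<noteq> ?c B2" "?c B1 \<noteq> ?c B3" "?c B2 \<noteq> ?c B3"
    using B by (auto simp: Mods_def iso_class_eq_iff)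
  then have "inj_on f {..<3}" by (auto simp: inj_on_def f_def)
  moreover have "f ` {..<3} \<subseteq> Mods A // iso_rel" using B by (auto simp: f_def intro: quotientI)
  ultimately show ?thesis unfolding card_of_ordLeq[symmetric] by blast
qed

section \<open>Decomposing formulas over disjoint unions\<close>

definition comps :: "nat \<Rightarrow> (nat \<Rightarrow> 'a struc) \<Rightarrow> bool" where
  "comps n X \<longleftrightarrow> (\<forall>i<n. is_struc (X i)) \<and> disjoint_strucs n X"

lemma comps_struc: "comps n X \<Longrightarrow> i < n \<Longrightarrow> is_struc (X i)"
  by (simp add: comps_def)

lemma comps_disj:
  "comps n X \<Longrightarrow> i < n \<Longrightarrow> j < n \<Longrightarrow> a \<in> univ (X i) \<Longrightarrow> a \<in> univ (X j) \<Longrightarrow> i = j"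
  unfolding comps_def disjoint_strucs_def disjoint_family_on_def by blast

lemma univ_dunion: "univ (dunion n X) = (\<Union>i<n. univ (X i))"
  and rel_dunion: "rel (dunion n X) = (\<Union>i<n. rel (X i))"
  by (simp_all add: dunion_def)

lemma dunion_struc: "comps n X \<Longrightarrow> n \<ge> 1 \<Longrightarrow> is_struc (dunion n X)"
proof -
  assume X: "comps n X" and n: "n \<ge> 1"
  have "is_struc (X i)" if "i < n" for i using X that by (simp add: comps_def)
  then have "univ (X 0) \<noteq> {}" "\<forall>i<n. rel (X i) \<subseteq> univ (X i) \<times> univ (X i)"
    using n by (auto simp: is_struc_def)
  then show ?thesis using n by (fastforce simp: is_struc_def univ_dunion rel_dunion)
qed

lemma rel_dunion_comp:
  assumes X: "comps n X" and i: "i < n" and a: "a \<in> univ (X i)"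
  shows "(a, b) \<in> rel (dunion n X) \<longleftrightarrow> (a, b) \<in> rel (X i)"
    and "(b, a) \<in> rel (dunion n X) \<longleftrightarrow> (b, a) \<in> rel (X i)"
proof -
  have "rel (X j) \<subseteq> univ (X j) \<times> univ (X j)" if "j < n" for j
    using comps_struc[OF X that] by (simp add: is_struc_def)
  then have "(a, b) \<in> rel (X j) \<Longrightarrow> j < n \<Longrightarrow> j = i" "(b, a) \<in> rel (X j) \<Longrightarrow> j < n \<Longrightarrow> j = i" for j
    using comps_disj[OF X i _ a] by blast+
  then show "(a, b) \<in> rel (dunion n X) \<longleftrightarrow> (a, b) \<in> rel (X i)"
    "(b, a) \<in> rel (dunion n X) \<longleftrightarrow> (b, a) \<in> rel (X i)"
    unfolding rel_dunion using i by blast+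
qed

text \<open>A list stands for a disjunction; its entries assign to each component a formula, and these
  are to hold simultaneously. Only the entries below \<open>n\<close> count.\<close>

definition dnf_holds :: "nat \<Rightarrow> (nat \<Rightarrow> form) list \<Rightarrow> (nat \<Rightarrow> 'a struc) \<Rightarrow> (nat \<Rightarrow> 'a) \<Rightarrow> bool" where
  "dnf_holds n D X s \<longleftrightarrow> (\<exists>g\<in>set D. \<forall>i<n. sat (X i) s (g i))"

text \<open>Negation by de Morgan's laws: for each disjunct some component violates its formula.\<close>

primrec dneg :: "nat \<Rightarrow> (nat \<Rightarrow> form) list \<Rightarrow> (nat \<Rightarrow> form) list" where
  "dneg n [] = [\<lambda>_. Neg Fls]"
| "dneg n (g # D) = concat (map (\<lambda>i. map (\<lambda>h. h(i := And (Neg (g i)) (h i))) (dneg n D)) [0..<n])"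

lemma dneg_holds: "dnf_holds n (dneg n D) X s \<longleftrightarrow> \<not> dnf_holds n D X s"
proof (induction D)
  case Nil
  then show ?case by (simp add: dnf_holds_def)
next
  case (Cons g D)
  have upd: "(\<forall>j<n. sat (X j) s ((h(i := And (Neg (g i)) (h i))) j)) \<longleftrightarrow>
      \<not> sat (X i) s (g i) \<and> (\<forall>j<n. sat (X j) s (h j))" if "i < n" for h i
    using that by auto
  have "dnf_holds n (dneg n (g # D)) X s \<longleftrightarrow> (\<exists>i<n. \<exists>h\<in>set (dneg n D).
      \<forall>j<n. sat (X j) s ((h(i := And (Neg (g i)) (h i))) j))"
    unfolding dnf_holds_def
    by (simp del: fun_upd_apply sat.simps) (simp only: Bex_def atLeast0LessThan lessThan_iff)
  also have "\<dots> \<longleftrightarrow> (\<exists>i<n. \<exists>h\<in>set (dneg n D). \<not> sat (X i) s (g i) \<and> (\<forall>j<n. sat (X j) s (h j)))"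
    by (intro ex_cong1 conj_cong refl bex_cong upd)
  also have "\<dots> \<longleftrightarrow> (\<exists>i<n. \<not> sat (X i) s (g i)) \<and> dnf_holds n (dneg n D) X s"
    unfolding dnf_holds_def by blast
  also have "\<dots> \<longleftrightarrow> \<not> dnf_holds n (g # D) X s" using Cons.IH by (auto simp: dnf_holds_def)
  finally show ?case .
qed

lemma fv_dneg:
  "(\<And>g i. g \<in> set D \<Longrightarrow> fv (g i) \<subseteq> V i) \<Longrightarrow> h \<in> set (dneg n D) \<Longrightarrow> fv (h i) \<subseteq> V i"
proof (induction D arbitrary: h i)
  case (Cons g D)
  then obtain j h' where h': "h' \<in> set (dneg n D)" "h = h'(j := And (Neg (g j)) (h' j))" by auto
  have "fv (h' i) \<subseteq> V i" for i using Cons h'(1) by auto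
  then show ?case using Cons.prems(1)[of g] h'(2) by (auto split: if_splits)
qed auto

text \<open>The disjunction equivalent to \<open>\<phi>\<close> in unions of \<open>n\<close> components, when \<open>c\<close> tells for each free
  variable the component of its value. An existential quantifier splits into the \<open>n\<close> cases for
  the component of the witness, and there it only touches the formula of that component.\<close>

primrec dnf :: "form \<Rightarrow> nat \<Rightarrow> (nat \<Rightarrow> nat) \<Rightarrow> (nat \<Rightarrow> form) list" where
  "dnf Fls n c = []"
| "dnf (Eq x y) n c = (if c x = c y then [(\<lambda>_. Neg Fls)(c x := Eq x y)] else [])"
| "dnf (Rel x y) n c = (if c x = c y then [(\<lambda>_. Neg Fls)(c x := Rel x y)] else [])"
| "dnf (Imp \<phi> \<psi>) n c = dneg n (dnf \<phi> n c) @ dnf \<psi> n c"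
| "dnf (All x \<phi>) n c = dneg n (concat (map (\<lambda>i.
     map (\<lambda>g. g(i := Ex x (g i))) (dneg n (dnf \<phi> n (c(x := i))))) [0..<n]))"

lemma fv_dnf: "g \<in> set (dnf \<phi> n c) \<Longrightarrow> fv (g i) \<subseteq> {v \<in> fv \<phi>. c v = i}"
proof (induction \<phi> arbitrary: c g i)
  case (Imp \<phi> \<psi>)
  have "fv (g i) \<subseteq> {v \<in> fv \<phi>. c v = i}" if "g \<in> set (dneg n (dnf \<phi> n c))"
    by (rule fv_dneg[OF _ that, of "\<lambda>i. {v \<in> fv \<phi>. c v = i}"]) (rule Imp.IH(1))
  moreover have "fv (g i) \<subseteq> {v \<in> fv \<psi>. c v = i}" if "g \<in> set (dnf \<psi> n c)"
    using that by (rule Imp.IH(2))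
  ultimately show ?case using Imp.prems by auto
next
  case (All x \<phi>)
  define D where "D = concat (map (\<lambda>i. map (\<lambda>g. g(i := Ex x (g i))) (dneg n (dnf \<phi> n (c(x := i))))) [0..<n])"
  have D: "fv (g' j) \<subseteq> {v \<in> fv (All x \<phi>). c v = j}"
    if g': "g' \<in> set D"
    for g' j
  proof -
    obtain i h where h: "h \<in> set (dneg n (dnf \<phi> n (c(x := i))))" "g' = h(i := Ex x (h i))"
      using g' unfolding D_def by auto
    have "fv (h j) \<subseteq> {v \<in> fv \<phi>. (c(x := i)) v = j}" for j
      by (rule fv_dneg[OF _ h(1), of "\<lambda>j. {v \<in> fv \<phi>. (c(x := i)) v = j}"]) (rule All.IH)
    moreover have "fv (g' j) \<subseteq> fv (h j)" and "j = i \<Longrightarrow> x \<notin> fv (g' j)"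
      unfolding h(2) by auto
    ultimately have "fv (g' j) \<subseteq> {v \<in> fv \<phi>. (c(x := i)) v = j} - {x}" by (cases "j = i") fastforce+
    then show "fv (g' j) \<subseteq> {v \<in> fv (All x \<phi>). c v = j}" by (auto split: if_splits)
  qed
  have g: "g \<in> set (dneg n D)" using All.prems by (simp add: D_def)
  show "fv (g i) \<subseteq> {v \<in> fv (All x \<phi>). c v = i}"
    by (rule fv_dneg[OF _ g, of "\<lambda>i. {v \<in> fv (All x \<phi>). c v = i}"]) (rule D)
qed (auto split: if_splits)

lemma dnf_holds_Ex:
  assumes i: "i < n" and D: "\<And>g j. g \<in> set D \<Longrightarrow> j \<noteq> i \<Longrightarrow> x \<notin> fv (g j)"
  shows "dnf_holds n (map (\<lambda>g. g(i := Ex x (g i))) D) X s \<longleftrightarrow>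
    (\<exists>a\<in>univ (X i). dnf_holds n D X (s(x := a)))"
proof -
  have "(\<forall>j<n. sat (X j) s ((g(i := Ex x (g i))) j)) \<longleftrightarrow>
      (\<exists>a\<in>univ (X i). \<forall>j<n. sat (X j) (s(x := a)) (g j))" if g: "g \<in> set D" for g
  proof -
    have "sat (X j) (s(x := a)) (g j) \<longleftrightarrow> sat (X j) s (g j)" if "j \<noteq> i" for j a
      by (rule sat_cong) (use D[OF g that] in auto)
    then have *: "(\<forall>j<n. sat (X j) (s(x := a)) (g j)) \<longleftrightarrow>
        sat (X i) (s(x := a)) (g i) \<and> (\<forall>j<n. j \<noteq> i \<longrightarrow> sat (X j) s (g j))" for a
      using i by metis
    have "(\<forall>j<n. sat (X j) s ((g(i := Ex x (g i))) j)) \<longleftrightarrow>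
        sat (X i) s (Ex x (g i)) \<and> (\<forall>j<n. j \<noteq> i \<longrightarrow> sat (X j) s (g j))" using i by auto
    then show ?thesis unfolding * by auto
  qed
  then show ?thesis unfolding dnf_holds_def by auto
qed

text \<open>The decomposition theorem of Feferman and Vaught for disjoint unions.\<close>

theorem sat_dunion_dnf:
  assumes X: "comps n X" and c: "\<And>v. v \<in> fv \<phi> \<Longrightarrow> c v < n \<and> s v \<in> univ (X (c v))"
  shows "sat (dunion n X) s \<phi> \<longleftrightarrow> dnf_holds n (dnf \<phi> n c) X s"
  using c
proof (induction \<phi> arbitrary: c s)
  case Fls
  then show ?case by (simp add: dnf_holds_def)
next
  case (Eq x y)
  then have x: "c x < n" "s x \<in> univ (X (c x))" and y: "c y < n" "s y \<in> univ (X (c y))" by auto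
  show ?case
  proof (cases "c x = c y")
    case True
    then show ?thesis using x by (auto simp: dnf_holds_def)
  next
    case False
    then have "s x \<noteq> s y" using comps_disj[OF X x(1) y(1) x(2)] y(2) by auto
    then show ?thesis using False by (simp add: dnf_holds_def)
  qed
next
  case (Rel x y)
  then have x: "c x < n" "s x \<in> univ (X (c x))" and y: "c y < n" "s y \<in> univ (X (c y))" by auto
  show ?case
  proof (cases "c x = c y")
    case True
    then show ?thesis using x rel_dunion_comp(1)[OF X x] by (auto simp: dnf_holds_def)
  next
    case False
    have "(s x, s y) \<notin> rel (X (c x))"
    proof
      assume "(s x, s y) \<in> rel (X (c x))"
      then have "s y \<in> univ (X (c x))" using comps_struc[OF X x(1)] by (auto simp: is_struc_def)
      then show False using comps_disj[OF X x(1) y(1)] y(2) False by blast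
    qed
    then show ?thesis using False rel_dunion_comp(1)[OF X x] by (simp add: dnf_holds_def)
  qed
next
  case (Imp \<phi> \<psi>)
  have "sat (dunion n X) s \<phi> \<longleftrightarrow> dnf_holds n (dnf \<phi> n c) X s"
    by (rule Imp.IH(1)) (use Imp.prems in auto)
  moreover have "sat (dunion n X) s \<psi> \<longleftrightarrow> dnf_holds n (dnf \<psi> n c) X s"
    by (rule Imp.IH(2)) (use Imp.prems in auto)
  moreover have "dnf_holds n (D1 @ D2) X s \<longleftrightarrow> dnf_holds n D1 X s \<or> dnf_holds n D2 X s" for D1 D2
    by (auto simp: dnf_holds_def)
  ultimately show ?case by (simp add: dneg_holds)
next
  case (All x \<phi>)
  let ?D = "\<lambda>i. dneg n (dnf \<phi> n (c(x := i)))"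
  have "dnf_holds n (map (\<lambda>g. g(i := Ex x (g i))) (?D i)) X s \<longleftrightarrow>
      (\<exists>a\<in>univ (X i). \<not> sat (dunion n X) (s(x := a)) \<phi>)" if i: "i < n" for i
  proof -
    have "sat (dunion n X) (s(x := a)) \<phi> \<longleftrightarrow> dnf_holds n (dnf \<phi> n (c(x := i))) X (s(x := a))"
      if "a \<in> univ (X i)" for a
      by (rule All.IH) (use All.prems that i in auto)
    moreover have "dnf_holds n (map (\<lambda>g. g(i := Ex x (g i))) (?D i)) X s \<longleftrightarrow>
      (\<exists>a\<in>univ (X i). dnf_holds n (?D i) X (s(x := a)))"
    proof (rule dnf_holds_Ex[OF i])
      fix g j assume g: "g \<in> set (?D i)" and j: "j \<noteq> i"
      have "fv (g j) \<subseteq> {v \<in> fv \<phi>. (c(x := i)) v = j}"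
        by (rule fv_dneg[OF _ g, of "\<lambda>j. {v \<in> fv \<phi>. (c(x := i)) v = j}"]) (rule fv_dnf)
      then show "x \<notin> fv (g j)" using j by auto
    qed
    ultimately show ?thesis by (simp add: dneg_holds)
  qed
  moreover have "dnf_holds n (concat (map F [0..<n])) X s \<longleftrightarrow> (\<exists>i<n. dnf_holds n (F i) X s)"
    for F :: "nat \<Rightarrow> (nat \<Rightarrow> form) list"
    unfolding dnf_holds_def by (simp add: Bex_def) blast
  ultimately have "dnf_holds n (dnf (All x \<phi>) n c) X s \<longleftrightarrow>
      \<not> (\<exists>i<n. \<exists>a\<in>univ (X i). \<not> sat (dunion n X) (s(x := a)) \<phi>)"
    by (auto simp: dneg_holds)
  moreover have "sat (dunion n X) s (All x \<phi>) \<longleftrightarrow> (\<forall>i<n. \<forall>a\<in>univ (X i). sat (dunion n X) (s(x := a)) \<phi>)"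
    by (auto simp: univ_dunion)
  ultimately show "sat (dunion n X) s (All x \<phi>) \<longleftrightarrow> dnf_holds n (dnf (All x \<phi>) n c) X s" by blast
qed

text \<open>In particular the type of a tuple in a disjoint union is determined by the types of its
  parts in the components.\<close>

lemma sat_dunion_cong:
  assumes X: "comps n X" and Y: "comps n Y"
    and c: "\<And>v. v \<in> fv \<phi> \<Longrightarrow> c v < n \<and> s v \<in> univ (X (c v)) \<and> t v \<in> univ (Y (c v))"
    and eq: "\<And>i \<psi>. i < n \<Longrightarrow> fv \<psi> \<subseteq> {v \<in> fv \<phi>. c v = i} \<Longrightarrow> sat (X i) s \<psi> \<longleftrightarrow> sat (Y i) t \<psi>"
  shows "sat (dunion n X) s \<phi> \<longleftrightarrow> sat (dunion n Y) t \<phi>"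
proof -
  have "sat (X i) s (g i) \<longleftrightarrow> sat (Y i) t (g i)" if "g \<in> set (dnf \<phi> n c)" "i < n" for g i
    using eq[OF that(2) fv_dnf[OF that(1)]] .
  then have "dnf_holds n (dnf \<phi> n c) X s \<longleftrightarrow> dnf_holds n (dnf \<phi> n c) Y t"
    unfolding dnf_holds_def by blast
  moreover have "sat (dunion n X) s \<phi> \<longleftrightarrow> dnf_holds n (dnf \<phi> n c) X s"
    by (rule sat_dunion_dnf[OF X]) (use c in blast)
  moreover have "sat (dunion n Y) t \<phi> \<longleftrightarrow> dnf_holds n (dnf \<phi> n c) Y t"
    by (rule sat_dunion_dnf[OF Y]) (use c in blast)
  ultimately show ?thesis by blast
qed

lemma sentence_cong_Th:
  assumes "is_struc A" "is_struc B" "Th A = Th B" "\<psi> \<in> forms 0"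
  shows "sat A s \<psi> \<longleftrightarrow> sat B t \<psi>"
proof -
  obtain s' t' where st: "asg A s'" "asg B t'" using is_struc_ex_asg assms(1,2) by metis
  have "sat A s' \<psi> \<longleftrightarrow> sat B t' \<psi>"
    using Th_iff[OF assms(1) st(1)] Th_iff[OF assms(2) st(2)] assms(3,4) by blast
  moreover have "sat A s \<psi> \<longleftrightarrow> sat A s' \<psi>" "sat B t \<psi> \<longleftrightarrow> sat B t' \<psi>"
    by (rule sentence_indep[OF assms(4)])+
  ultimately show ?thesis by simp
qed

lemma Th_dunion_cong:
  assumes n: "n \<ge> 1" and X: "comps n X" and Y: "comps n Y"
    and eq: "\<And>i. i < n \<Longrightarrow> Th (X i) = Th (Y i)"
  shows "Th (dunion n X) = Th (dunion n Y)"
proof -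
  have SX: "is_struc (dunion n X)" and SY: "is_struc (dunion n Y)" using dunion_struc X Y n by auto
  obtain s t where st: "asg (dunion n X) s" "asg (dunion n Y) t" using is_struc_ex_asg SX SY by metis
  have "sat (dunion n X) s \<phi> \<longleftrightarrow> sat (dunion n Y) t \<phi>" if \<phi>: "\<phi> \<in> forms 0" for \<phi>
  proof (rule sat_dunion_cong[OF X Y])
    fix i \<psi> assume i: "i < n" and \<psi>: "fv \<psi> \<subseteq> {v \<in> fv \<phi>. 0 = i}"
    then have "\<psi> \<in> forms 0" using \<phi> by (auto simp: forms_def)
    then show "sat (X i) s \<psi> \<longleftrightarrow> sat (Y i) t \<psi>"
      by (rule sentence_cong_Th[OF comps_struc[OF X i] comps_struc[OF Y i] eq[OF i]])
  qed (use \<phi> in \<open>auto simp: forms_def\<close>)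
  then show ?thesis using Th_iff[OF SX st(1)] Th_iff[OF SY st(2)] by blast
qed

section \<open>Components of bounded diameter are definable\<close>

lemma rel_rs_univ: "is_struc A \<Longrightarrow> (x, y) \<in> rel_rs A \<Longrightarrow> x \<in> univ A \<and> y \<in> univ A"
  by (auto simp: rel_rs_def is_struc_def)

lemma rel_rs_sym: "(x, y) \<in> rel_rs A \<Longrightarrow> (y, x) \<in> rel_rs A"
  by (auto simp: rel_rs_def)

lemma rel_rs_refl: "x \<in> univ A \<Longrightarrow> (x, x) \<in> rel_rs A"
  by (auto simp: rel_rs_def)

lemma pow_univ: "is_struc A \<Longrightarrow> x \<in> univ A \<Longrightarrow> (x, y) \<in> rel_rs A ^^ k \<Longrightarrow> y \<in> univ A"
proof (induction k arbitrary: y)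
  case (Suc k) then show ?case using rel_rs_univ by (metis relpow_Suc_E)
qed auto

lemma pow_sym: "(x, y) \<in> rel_rs A ^^ k \<Longrightarrow> (y, x) \<in> rel_rs A ^^ k"
proof (induction k arbitrary: y)
  case (Suc k)
  then obtain z where "(x, z) \<in> rel_rs A ^^ k" "(z, y) \<in> rel_rs A" by (meson relpow_Suc_E)
  then show ?case using Suc.IH rel_rs_sym relpow_Suc_I2 by metis
qed auto

lemma pow_mono: "x \<in> univ A \<Longrightarrow> j \<le> k \<Longrightarrow> (x, y) \<in> rel_rs A ^^ j \<Longrightarrow> (x, y) \<in> rel_rs A ^^ k"
proof -
  assume x: "x \<in> univ A" and jk: "j \<le> k" and xy: "(x, y) \<in> rel_rs A ^^ j"
  have "(x, x) \<in> rel_rs A ^^ i" for i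
    by (induction i) (use rel_rs_refl[OF x] relpow_Suc_I in auto)
  then have "(x, y) \<in> rel_rs A ^^ (k - j) O rel_rs A ^^ j" using xy by blast
  then show ?thesis using jk by (simp add: relpow_add[symmetric])
qed

definition conn :: "'a struc \<Rightarrow> nat \<Rightarrow> bool" where
  "conn A m \<longleftrightarrow> (\<forall>x\<in>univ A. \<forall>y\<in>univ A. (x, y) \<in> rel_rs A ^^ m)"

lemma is_path_iff: "(\<exists>zs. is_path A k x y zs) \<longleftrightarrow> (x, y) \<in> rel_rs A ^^ k"
proof
  assume "\<exists>zs. is_path A k x y zs"
  then obtain zs where "is_path A k x y zs" by blast
  then show "(x, y) \<in> rel_rs A ^^ k"
    unfolding relpow_fun_conv is_path_def by (intro exI[of _ "(!) zs"]) auto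
next
  assume "(x, y) \<in> rel_rs A ^^ k"
  then obtain f where "f 0 = x" "f k = y" "\<forall>i<k. (f i, f (Suc i)) \<in> rel_rs A"
    unfolding relpow_fun_conv by blast
  then have "is_path A k x y (map f [0..<Suc k])" by (auto simp: is_path_def simp del: upt_Suc)
  then show "\<exists>zs. is_path A k x y zs" ..
qed

lemma diameter_le_iff_conn: "diameter_le A m \<longleftrightarrow> conn A m"
proof -
  have "(\<exists>j\<le>m. (x, y) \<in> rel_rs A ^^ j) \<longleftrightarrow> (x, y) \<in> rel_rs A ^^ m" if "x \<in> univ A" for x y
    using pow_mono[OF that] by auto
  then show ?thesis by (simp add: diameter_le_def conn_def is_path_iff)
qed

text \<open>\<open>reach k x y\<close> expresses that there is a path of length \<open>k\<close>; the bound variable \<open>Suc (x + y)\<close> differs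
  from \<open>x\<close> and \<open>y\<close>. In contrast to \<open>eps k\<close> it can be used with any pair of variables.\<close>

primrec reach :: "nat \<Rightarrow> nat \<Rightarrow> nat \<Rightarrow> form" where
  "reach 0 x y = Eq x y"
| "reach (Suc k) x y = Ex (Suc (x + y)) (And (reach k x (Suc (x + y))) (phi_rs (Suc (x + y)) y))"

lemma fv_reach: "fv (reach k x y) \<subseteq> {x, y}"
proof (induction k arbitrary: y)
  case (Suc k)
  show ?case using Suc[of "Suc (x + y)"] by (auto simp: phi_rs_def)
qed auto

lemma sat_phi_rs: "is_struc A \<Longrightarrow> s x \<in> univ A \<Longrightarrow> sat A s (phi_rs x y) \<longleftrightarrow> (s x, s y) \<in> rel_rs A"
  by (auto simp: phi_rs_def rel_rs_def is_struc_def)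

lemma sat_reach:
  assumes A: "is_struc A"
  shows "s x \<in> univ A \<Longrightarrow> sat A s (reach k x y) \<longleftrightarrow> (s x, s y) \<in> rel_rs A ^^ k"
proof (induction k arbitrary: s y)
  case (Suc k)
  let ?z = "Suc (x + y)"
  have "sat A s (reach (Suc k) x y) \<longleftrightarrow>
      (\<exists>a\<in>univ A. sat A (s(?z := a)) (reach k x ?z) \<and> sat A (s(?z := a)) (phi_rs ?z y))" by simp
  also have "\<dots> \<longleftrightarrow> (\<exists>a\<in>univ A. (s x, a) \<in> rel_rs A ^^ k \<and> (a, s y) \<in> rel_rs A)"
  proof -
    have "sat A (s(?z := a)) (reach k x ?z) \<longleftrightarrow> (s x, a) \<in> rel_rs A ^^ k" for a
    proof -
      have IH: "sat A t (reach k x z) \<longleftrightarrow> (t x, t z) \<in> rel_rs A ^^ k" if "t x \<in> univ A" for t z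
        using that by (rule Suc.IH)
      show ?thesis using IH[of "s(?z := a)" ?z] Suc.prems by simp
    qed
    moreover have "sat A (s(?z := a)) (phi_rs ?z y) \<longleftrightarrow> (a, s y) \<in> rel_rs A" if "a \<in> univ A" for a
      using sat_phi_rs[OF A, of "s(?z := a)" ?z y] that by simp
    ultimately show ?thesis by blast
  qed
  also have "\<dots> \<longleftrightarrow> (s x, s y) \<in> rel_rs A ^^ Suc k"
    using pow_univ[OF A Suc.prems] by auto
  finally show ?case .
qed simp

lemma conn_iff_valid: "is_struc A \<Longrightarrow> conn A m \<longleftrightarrow> valid A (reach m 0 1)"
proof
  assume A: "is_struc A"
  show "conn A m \<Longrightarrow> valid A (reach m 0 1)" by (auto simp: valid_def sat_reach[OF A] conn_def)
  assume v: "valid A (reach m 0 1)"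
  show "conn A m"
    unfolding conn_def
  proof (intro ballI)
    fix x y assume "x \<in> univ A" "y \<in> univ A"
    moreover from this have "asg A (\<lambda>v. if v = 0 then x else y)" by (simp add: asg_def)
    ultimately show "(x, y) \<in> rel_rs A ^^ m"
      using v sat_reach[OF A, of "\<lambda>v. if v = 0 then x else y" 0 m 1] by (simp add: valid_def)
  qed
qed

definition conn_comps :: "nat \<Rightarrow> nat \<Rightarrow> (nat \<Rightarrow> 'a struc) \<Rightarrow> bool" where
  "conn_comps n m X \<longleftrightarrow> comps n X \<and> (\<forall>i<n. conn (X i) m)"

lemma conn_comps_cong:
  assumes "conn_comps n m X" "comps n Y" "\<And>i. i < n \<Longrightarrow> Th (Y i) = Th (X i)"
  shows "conn_comps n m Y"
  unfolding conn_comps_def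
proof (intro conjI allI impI)
  fix i assume i: "i < n"
  have "is_struc (X i)" "conn (X i) m" using assms(1) i by (auto simp: conn_comps_def comps_def)
  then have "valid (X i) (reach m 0 1)" using conn_iff_valid by blast
  then have "valid (Y i) (reach m 0 1)" using valid_cong_Th[OF assms(3)[OF i]] by blast
  then show "conn (Y i) m" using conn_iff_valid comps_struc[OF assms(2) i] by blast
qed fact

lemma rel_rs_dunion:
  assumes X: "comps n X" and i: "i < n" and a: "a \<in> univ (X i)"
  shows "(a, b) \<in> rel_rs (dunion n X) \<longleftrightarrow> (a, b) \<in> rel_rs (X i)"
  using rel_dunion_comp[OF X i a] i a by (auto simp: rel_rs_def univ_dunion)

lemma pow_dunion:
  assumes X: "comps n X" and i: "i < n" and a: "a \<in> univ (X i)"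
  shows "(a, b) \<in> rel_rs (dunion n X) ^^ k \<longleftrightarrow> (a, b) \<in> rel_rs (X i) ^^ k"
proof (induction k arbitrary: b)
  case (Suc k)
  have "z \<in> univ (X i)" if "(a, z) \<in> rel_rs (X i) ^^ k" for z
    by (rule pow_univ[OF comps_struc[OF X i] a that])
  then show ?case using Suc.IH rel_rs_dunion[OF X i] by (auto elim!: relpow_Suc_E intro: relpow_Suc_I)
qed auto

lemma same_component:
  assumes X: "conn_comps n m X" and i: "i < n" and a: "a \<in> univ (X i)"
  shows "(a, b) \<in> rel_rs (dunion n X) ^^ m \<longleftrightarrow> b \<in> univ (X i)"
proof -
  have C: "comps n X" using X by (simp add: conn_comps_def)
  show ?thesis unfolding pow_dunion[OF C i a]
    using pow_univ[OF comps_struc[OF C i] a] X a i by (auto simp: conn_comps_def conn_def)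
qed

lemma sat_reach_dunion:
  assumes X: "conn_comps n m X" and i: "i < n" "s x \<in> univ (X i)" and j: "j < n" "s y \<in> univ (X j)"
  shows "sat (dunion n X) s (reach m x y) \<longleftrightarrow> i = j"
proof -
  have C: "comps n X" using X by (simp add: conn_comps_def)
  have "is_struc (dunion n X)" using dunion_struc[OF C] i(1) by simp
  moreover have "s x \<in> univ (dunion n X)" using i by (auto simp: univ_dunion)
  ultimately have "sat (dunion n X) s (reach m x y) \<longleftrightarrow> s y \<in> univ (X i)"
    using sat_reach same_component[OF X i] by blast
  then show ?thesis using comps_disj[OF C i(1) j(1)] j(2) by blast
qed

text \<open>Relativization to the component of \<open>w\<close>, which paths of length \<open>m\<close> define if the components have
  diameter at most \<open>m\<close>. The variable \<open>w\<close> must not be bound in the formula.\<close>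

primrec rlv :: "nat \<Rightarrow> nat \<Rightarrow> form \<Rightarrow> form" where
  "rlv m w Fls = Fls"
| "rlv m w (Eq x y) = Eq x y"
| "rlv m w (Rel x y) = Rel x y"
| "rlv m w (Imp \<phi> \<psi>) = Imp (rlv m w \<phi>) (rlv m w \<psi>)"
| "rlv m w (All x \<phi>) = All x (Imp (reach m x w) (rlv m w \<phi>))"

primrec vars :: "form \<Rightarrow> nat set" where
  "vars Fls = {}"
| "vars (Eq x y) = {x, y}"
| "vars (Rel x y) = {x, y}"
| "vars (Imp \<phi> \<psi>) = vars \<phi> \<union> vars \<psi>"
| "vars (All x \<phi>) = insert x (vars \<phi>)"

lemma finite_vars [simp]: "finite (vars \<phi>)"
  by (induction \<phi>) auto

lemma fv_rlv: "fv (rlv m w \<phi>) \<subseteq> insert w (fv \<phi>)"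
proof (induction \<phi>)
  case (All x \<phi>)
  then show ?case using fv_reach[of m x w] by auto
qed auto

lemma sat_rlv:
  assumes X: "conn_comps n m X" and i: "i < n"
  shows "w \<notin> vars \<phi> \<Longrightarrow> s w \<in> univ (X i) \<Longrightarrow> (\<And>v. v \<in> fv \<phi> \<Longrightarrow> s v \<in> univ (X i)) \<Longrightarrow>
    sat (dunion n X) s (rlv m w \<phi>) \<longleftrightarrow> sat (X i) s \<phi>"
proof (induction \<phi> arbitrary: s)
  case (Rel x y)
  have C: "comps n X" using X by (simp add: conn_comps_def)
  show ?case using rel_dunion_comp(1)[OF C i] Rel.prems by simp
next
  case (Imp \<phi> \<psi>)
  have "sat (dunion n X) s (rlv m w \<phi>) \<longleftrightarrow> sat (X i) s \<phi>" by (rule Imp.IH(1)) (use Imp.prems in auto)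
  moreover have "sat (dunion n X) s (rlv m w \<psi>) \<longleftrightarrow> sat (X i) s \<psi>" by (rule Imp.IH(2)) (use Imp.prems in auto)
  ultimately show ?case by simp
next
  case (All x \<phi>)
  have wx: "w \<noteq> x" using All.prems(1) by auto
  have r: "sat (dunion n X) (s(x := a)) (reach m x w) \<longleftrightarrow> j = i" if "j < n" "a \<in> univ (X j)" for a j
    by (rule sat_reach_dunion[OF X that(1) _ i]) (use that wx All.prems(2) in auto)
  have IH: "sat (dunion n X) (s(x := a)) (rlv m w \<phi>) \<longleftrightarrow> sat (X i) (s(x := a)) \<phi>" if "a \<in> univ (X i)" for a
    by (rule All.IH) (use All.prems that wx in auto)
  have "sat (dunion n X) s (rlv m w (All x \<phi>)) \<longleftrightarrow>
      (\<forall>j<n. \<forall>a\<in>univ (X j). j = i \<longrightarrow> sat (dunion n X) (s(x := a)) (rlv m w \<phi>))"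
    using r by (auto simp: univ_dunion)
  also have "\<dots> \<longleftrightarrow> sat (X i) s (All x \<phi>)" using IH i by auto
  finally show "sat (dunion n X) s (rlv m w (All x \<phi>)) \<longleftrightarrow> sat (X i) s (All x \<phi>)" .
qed auto

text \<open>The components can be named by representatives \<open>w\<^sub>0, \<dots>, w\<^sub>n\<^sub>-\<^sub>1\<close>, but only up to a permutation:
  \<open>master\<close> says that, for some numbering of the components, the variable \<open>v\<^sub>j\<close> is in the
  component number \<open>c j\<close> and the component number \<open>i\<close> satisfies \<open>F i\<close>.\<close>

definition master :: "nat \<Rightarrow> nat \<Rightarrow> nat \<Rightarrow> (nat \<Rightarrow> nat) \<Rightarrow> (nat \<Rightarrow> form) \<Rightarrow> form" where
  "master n m l c F = (let N = Suc (Max (insert 0 ({..<l} \<union> (\<Union>i<n. vars (F i))))) in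
     Exs [N..<N + n] (Conj (
       map (\<lambda>(i, j). Neg (reach m (N + i) (N + j))) (filter (\<lambda>(i, j). i \<noteq> j) (List.product [0..<n] [0..<n])) @
       map (\<lambda>j. reach m j (N + c j)) [0..<l] @
       map (\<lambda>i. rlv m (N + i) (F i)) [0..<n])))"

lemma master_props:
  fixes n l :: nat and F :: "nat \<Rightarrow> form"
  defines "N \<equiv> Suc (Max (insert 0 ({..<l} \<union> (\<Union>i<n. vars (F i)))))"
  shows "j < l \<Longrightarrow> j < N" and "i < n \<Longrightarrow> v \<in> vars (F i) \<Longrightarrow> v < N"
  unfolding N_def by (rule fresh_Suc_Max; auto)+

lemma fv_master:
  assumes "\<And>j. j < l \<Longrightarrow> c j < n" "\<And>i. i < n \<Longrightarrow> fv (F i) \<subseteq> {..<l}"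
  shows "master n m l c F \<in> forms l"
proof -
  define N where "N = Suc (Max (insert 0 ({..<l} \<union> (\<Union>i<n. vars (F i)))))"
  have 1: "fv (reach m (N + i) (N + j)) \<subseteq> {..<l} \<union> {N..<N + n}" if "i < n" "j < n" for i j
    using fv_reach[of m "N + i" "N + j"] that by auto
  have 2: "fv (reach m j (N + c j)) \<subseteq> {..<l} \<union> {N..<N + n}" if "j < l" for j
    using fv_reach[of m j "N + c j"] assms(1)[OF that] that by auto
  have 3: "fv (rlv m (N + i) (F i)) \<subseteq> {..<l} \<union> {N..<N + n}" if "i < n" for i
    using fv_rlv[of m "N + i" "F i"] assms(2)[OF that] that by auto
  show ?thesis
    unfolding master_def Let_def N_def[symmetric] forms_def mem_Collect_eq fv_Exs fv_Conj
    using 1 2 3 by fastforce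
qed

lemma sat_master:
  assumes X: "conn_comps n m X" and c: "\<And>j. j < l \<Longrightarrow> c j < n"
    and F: "\<And>i. i < n \<Longrightarrow> fv (F i) \<subseteq> {j. j < l \<and> c j = i}"
    and s: "\<And>j. j < l \<Longrightarrow> s j \<in> univ (dunion n X)"
  shows "sat (dunion n X) s (master n m l c F) \<longleftrightarrow>
    (\<exists>\<sigma>. bij_betw \<sigma> {..<n} {..<n} \<and> (\<forall>j<l. s j \<in> univ (X (\<sigma> (c j)))) \<and> (\<forall>i<n. sat (X (\<sigma> i)) s (F i)))"
proof -
  define N where "N = Suc (Max (insert 0 ({..<l} \<union> (\<Union>i<n. vars (F i)))))"
  have Nl: "j < N" if "j < l" for j using master_props(1)[of j l F n] that by (simp add: N_def)
  have NF: "v < N" if "i < n" "v \<in> vars (F i)" for i v using master_props(2)[of i n v F l] that by (simp add: N_def)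
  have C: "comps n X" using X by (simp add: conn_comps_def)
  have body: "sat (dunion n X) s (master n m l c F) \<longleftrightarrow> (\<exists>t. (\<forall>v. v \<notin> {N..<N + n} \<longrightarrow> t v = s v) \<and>
      (\<forall>v\<in>{N..<N + n}. t v \<in> univ (dunion n X)) \<and>
      (\<forall>i<n. \<forall>j<n. i \<noteq> j \<longrightarrow> \<not> sat (dunion n X) t (reach m (N + i) (N + j))) \<and>
      (\<forall>j<l. sat (dunion n X) t (reach m j (N + c j))) \<and>
      (\<forall>i<n. sat (dunion n X) t (rlv m (N + i) (F i))))"
    unfolding master_def Let_def N_def[symmetric] sat_Exs sat_Conj by (auto simp: ball_Un)
  show ?thesis
  proof
    assume "sat (dunion n X) s (master n m l c F)"
    then obtain t where t: "\<And>v. v \<notin> {N..<N + n} \<Longrightarrow> t v = s v"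
      "\<And>v. v \<in> {N..<N + n} \<Longrightarrow> t v \<in> univ (dunion n X)"
      and t1: "\<And>i j. i < n \<Longrightarrow> j < n \<Longrightarrow> i \<noteq> j \<Longrightarrow> \<not> sat (dunion n X) t (reach m (N + i) (N + j))"
      and t2: "\<And>j. j < l \<Longrightarrow> sat (dunion n X) t (reach m j (N + c j))"
      and t3: "\<And>i. i < n \<Longrightarrow> sat (dunion n X) t (rlv m (N + i) (F i))"
      unfolding body by blast
    have "\<exists>k<n. t (N + i) \<in> univ (X k)" if "i < n" for i
      using t(2)[of "N + i"] that by (auto simp: univ_dunion)
    then obtain \<sigma> where \<sigma>: "\<And>i. i < n \<Longrightarrow> \<sigma> i < n \<and> t (N + i) \<in> univ (X (\<sigma> i))" by metis
    have "inj_on \<sigma> {..<n}"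
    proof (rule inj_onI, rule ccontr)
      fix i j assume ij: "i \<in> {..<n}" "j \<in> {..<n}" "\<sigma> i = \<sigma> j" "i \<noteq> j"
      then have "sat (dunion n X) t (reach m (N + i) (N + j))"
        using sat_reach_dunion[OF X, of "\<sigma> i" t "N + i" "\<sigma> j" "N + j"] \<sigma>[of i] \<sigma>[of j] by simp
      then show False using t1 ij by auto
    qed
    moreover have "\<sigma> ` {..<n} \<subseteq> {..<n}" using \<sigma> by auto
    ultimately have bij: "bij_betw \<sigma> {..<n} {..<n}"
      using endo_inj_surj[of "{..<n}" \<sigma>] by (auto simp: bij_betw_def)
    have tj: "t j = s j" if "j < l" for j using t(1)[of j] Nl[OF that] by simp
    have sj: "s j \<in> univ (X (\<sigma> (c j)))" if j: "j < l" for j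
    proof -
      obtain k where k: "k < n" "s j \<in> univ (X k)" using s[OF j] by (auto simp: univ_dunion)
      then have "k = \<sigma> (c j)"
        using sat_reach_dunion[OF X k(1), of t j "\<sigma> (c j)" "N + c j"] \<sigma>[OF c[OF j]] t2[OF j] tj[OF j] by simp
      with k show ?thesis by simp
    qed
    have "sat (X (\<sigma> i)) s (F i)" if i: "i < n" for i
    proof -
      have "t v \<in> univ (X (\<sigma> i))" if "v \<in> fv (F i)" for v
        using F[OF i] that sj tj by auto
      then have "sat (X (\<sigma> i)) t (F i)"
        using sat_rlv[OF X, of "\<sigma> i" "N + i" "F i" t] \<sigma>[OF i] t3[OF i] NF[OF i, of "N + i"] by auto
      moreover have "sat (X (\<sigma> i)) t (F i) \<longleftrightarrow> sat (X (\<sigma> i)) s (F i)"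
        by (rule sat_cong) (use F[OF i] tj in auto)
      ultimately show ?thesis by blast
    qed
    with bij sj show "\<exists>\<sigma>. bij_betw \<sigma> {..<n} {..<n} \<and> (\<forall>j<l. s j \<in> univ (X (\<sigma> (c j)))) \<and>
      (\<forall>i<n. sat (X (\<sigma> i)) s (F i))" by blast
  next
    assume "\<exists>\<sigma>. bij_betw \<sigma> {..<n} {..<n} \<and> (\<forall>j<l. s j \<in> univ (X (\<sigma> (c j)))) \<and>
      (\<forall>i<n. sat (X (\<sigma> i)) s (F i))"
    then obtain \<sigma> where bij: "bij_betw \<sigma> {..<n} {..<n}"
      and sj: "\<And>j. j < l \<Longrightarrow> s j \<in> univ (X (\<sigma> (c j)))" and sF: "\<And>i. i < n \<Longrightarrow> sat (X (\<sigma> i)) s (F i)"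
      by blast
    have \<sigma>: "\<sigma> i < n" if "i < n" for i using bij that by (auto simp: bij_betw_def)
    have \<sigma>inj: "i = j" if "i < n" "j < n" "\<sigma> i = \<sigma> j" for i j
      using bij that by (auto simp: bij_betw_def inj_on_def)
    have "\<exists>a. a \<in> univ (X i)" if "i < n" for i using comps_struc[OF C that] by (auto simp: is_struc_def)
    then obtain e where e: "\<And>i. i < n \<Longrightarrow> e i \<in> univ (X i)" by metis
    define t where "t v = (if v \<in> {N..<N + n} then e (\<sigma> (v - N)) else s v)" for v
    have tN: "t (N + i) \<in> univ (X (\<sigma> i))" if "i < n" for i using that e \<sigma> by (simp add: t_def)
    have tj: "t j = s j" if "j < l" for j using Nl[OF that] by (simp add: t_def)
    show "sat (dunion n X) s (master n m l c F)"
      unfolding body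
    proof (intro exI[of _ t] conjI allI impI ballI)
      fix v assume "v \<in> {N..<N + n}"
      then have "v - N < n" "N + (v - N) = v" by auto
      then show "t v \<in> univ (dunion n X)" using tN[of "v - N"] \<sigma>[of "v - N"] by (auto simp: univ_dunion)
    next
      fix i j assume "i < n" "j < n" "i \<noteq> j"
      then show "\<not> sat (dunion n X) t (reach m (N + i) (N + j))"
        using sat_reach_dunion[OF X, of "\<sigma> i" t "N + i" "\<sigma> j" "N + j"] \<sigma> tN \<sigma>inj by metis
    next
      fix j assume j: "j < l"
      show "sat (dunion n X) t (reach m j (N + c j))"
        using sat_reach_dunion[OF X, of "\<sigma> (c j)" t j "\<sigma> (c j)" "N + c j"]
          \<sigma>[OF c[OF j]] tN[OF c[OF j]] sj[OF j] tj[OF j] by simp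
    next
      fix i assume i: "i < n"
      have "t v \<in> univ (X (\<sigma> i))" if "v \<in> fv (F i)" for v
        using F[OF i] that sj tj by auto
      moreover have "sat (X (\<sigma> i)) t (F i) \<longleftrightarrow> sat (X (\<sigma> i)) s (F i)"
        by (rule sat_cong) (use F[OF i] tj in auto)
      ultimately show "sat (dunion n X) t (rlv m (N + i) (F i))"
        using sat_rlv[OF X \<sigma>[OF i], of "N + i" "F i" t] tN[OF i] sF[OF i] NF[OF i, of "N + i"] by auto
    qed (auto simp: t_def)
  qed
qed

section \<open>Components and models of the theory of the union\<close>

lemma comps_of_conn: "conn_comps n m X \<Longrightarrow> comps n X"
  by (simp add: conn_comps_def)

lemma rel_rst_dunion:
  assumes X: "conn_comps n m X" and n: "n \<ge> 1"
  shows "(x, y) \<in> rel_rst (dunion n X) \<longleftrightarrow> (\<exists>i<n. x \<in> univ (X i) \<and> y \<in> univ (X i))"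
proof
  note C = comps_of_conn[OF X]
  note S = dunion_struc[OF C n]
  assume xy: "(x, y) \<in> rel_rst (dunion n X)"
  then obtain z where "(x, z) \<in> rel_rs (dunion n X)" unfolding rel_rst_def by (meson tranclD)
  then have "x \<in> univ (dunion n X)" using rel_rs_univ[OF S] by blast
  then obtain i where i: "i < n" "x \<in> univ (X i)" by (auto simp: univ_dunion)
  obtain k where "(x, y) \<in> rel_rs (dunion n X) ^^ k"
    using xy unfolding rel_rst_def by (meson trancl_power)
  then have "y \<in> univ (X i)"
    unfolding pow_dunion[OF C i] by (rule pow_univ[OF comps_struc[OF C i(1)] i(2)])
  with i show "\<exists>i<n. x \<in> univ (X i) \<and> y \<in> univ (X i)" by blast
next
  assume "\<exists>i<n. x \<in> univ (X i) \<and> y \<in> univ (X i)"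
  then obtain i where i: "i < n" "x \<in> univ (X i)" "y \<in> univ (X i)" by blast
  then have "(x, y) \<in> rel_rs (dunion n X) ^^ m" using same_component[OF X i(1,2)] by blast
  then have "(x, y) \<in> (rel_rs (dunion n X))\<^sup>*" by (meson relpow_imp_rtrancl)
  moreover have "(x, x) \<in> rel_rs (dunion n X)" using i by (intro rel_rs_refl) (auto simp: univ_dunion)
  ultimately show "(x, y) \<in> rel_rst (dunion n X)" unfolding rel_rst_def by (meson rtrancl_into_trancl2)
qed

lemma quotient_rel_rst:
  assumes X: "conn_comps n m X" and n: "n \<ge> 1"
  shows "univ (dunion n X) // rel_rst (dunion n X) = {univ (X i) | i. i < n}"
proof -
  note C = comps_of_conn[OF X]
  have cl: "rel_rst (dunion n X) `` {x} = univ (X i)" if i: "i < n" "x \<in> univ (X i)" for i x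
    using rel_rst_dunion[OF X n] i comps_disj[OF C] by blast
  show ?thesis
  proof
    show "univ (dunion n X) // rel_rst (dunion n X) \<subseteq> {univ (X i) | i. i < n}"
      using cl by (auto simp: quotient_def univ_dunion)
    show "{univ (X i) | i. i < n} \<subseteq> univ (dunion n X) // rel_rst (dunion n X)"
    proof
      fix U assume "U \<in> {univ (X i) | i. i < n}"
      then obtain i where i: "i < n" "U = univ (X i)" by blast
      then obtain x where x: "x \<in> univ (X i)" using comps_struc[OF C] by (auto simp: is_struc_def)
      then have "x \<in> univ (dunion n X)" using i by (auto simp: univ_dunion)
      then show "U \<in> univ (dunion n X) // rel_rst (dunion n X)"
        using cl[OF i(1) x] i(2) by (auto simp: quotient_def)
    qed
  qed
qed

lemma sat_eps:
  assumes A: "is_struc A" and s: "s 0 \<in> univ A" "s 1 \<in> univ A"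
  shows "sat A s (eps k) \<longleftrightarrow> (s 0, s 1) \<in> rel_rs A ^^ k"
proof -
  have idx: "v \<in> set (map (\<lambda>i. i + 2) [0..<Suc k]) \<longleftrightarrow> 2 \<le> v \<and> v \<le> k + 2" for v
    by (auto simp: image_iff simp del: upt_Suc intro!: bexI[of _ "v - 2"])
  have "sat A s (eps k) \<longleftrightarrow> (\<exists>t. (\<forall>v. \<not> (2 \<le> v \<and> v \<le> k + 2) \<longrightarrow> t v = s v) \<and>
      (\<forall>v. 2 \<le> v \<and> v \<le> k + 2 \<longrightarrow> t v \<in> univ A) \<and> t 2 = t 0 \<and> t (k + 2) = t 1 \<and>
      (\<forall>i<k. sat A t (phi_rs (i + 2) (Suc i + 2))))"
  proof -
    have body: "sat A t (Conj ([Eq (0 + 2) 0, Eq (k + 2) 1] @ map (\<lambda>i. phi_rs (i + 2) (Suc i + 2)) [0..<k])) \<longleftrightarrow>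
        t 2 = t 0 \<and> t (k + 2) = t 1 \<and> (\<forall>i<k. sat A t (phi_rs (i + 2) (Suc i + 2)))" for t
      by (auto simp: sat_Conj numeral_2_eq_2)
    show ?thesis unfolding eps_def sat_Exs body Ball_def idx by (rule refl)
  qed
  also have "\<dots> \<longleftrightarrow> (s 0, s 1) \<in> rel_rs A ^^ k" (is "?L \<longleftrightarrow> ?R")
  proof
    assume ?L
    then obtain t where t: "\<And>v. \<not> (2 \<le> v \<and> v \<le> k + 2) \<Longrightarrow> t v = s v"
      "\<And>v. 2 \<le> v \<and> v \<le> k + 2 \<Longrightarrow> t v \<in> univ A" "t 2 = t 0" "t (k + 2) = t 1"
      "\<And>i. i < k \<Longrightarrow> sat A t (phi_rs (i + 2) (Suc i + 2))" by blast
    have "(t (i + 2), t (Suc i + 2)) \<in> rel_rs A" if "i < k" for i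
      using t(5)[OF that] sat_phi_rs[OF A, of t "i + 2" "Suc i + 2"] t(2)[of "i + 2"] that by simp
    moreover have "t 0 = s 0" "t 1 = s 1" using t(1) by auto
    ultimately show ?R
      unfolding relpow_fun_conv using t(3,4) by (intro exI[of _ "\<lambda>i. t (i + 2)"]) (auto simp: numeral_2_eq_2)
  next
    assume ?R
    then obtain f where f: "f 0 = s 0" "f k = s 1" "\<And>i. i < k \<Longrightarrow> (f i, f (Suc i)) \<in> rel_rs A"
      unfolding relpow_fun_conv by blast
    have fA: "f i \<in> univ A" if "i \<le> k" for i
      using that f(2) s(2) rel_rs_univ[OF A f(3)] by (cases "i = k") auto
    define t where "t v = (if 2 \<le> v \<and> v \<le> k + 2 then f (v - 2) else s v)" for v
    have "sat A t (phi_rs (i + 2) (Suc i + 2))" if "i < k" for i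
      using f(3)[OF that] fA[of i] that by (subst sat_phi_rs[OF A]) (auto simp: t_def)
    then show ?L using f fA by (intro exI[of _ t]) (auto simp: t_def)
  qed
  finally show ?thesis .
qed

lemma rel_rst_defset:
  assumes X: "conn_comps n m X" and n: "n \<ge> 1"
  shows "rel_rst (dunion n X) = {(x, y). [x, y] \<in> defset 2 (eps m) (dunion n X)}"
proof -
  note C = comps_of_conn[OF X]
  note S = dunion_struc[OF C n]
  have "(x, y) \<in> rel_rst (dunion n X) \<longleftrightarrow> [x, y] \<in> defset 2 (eps m) (dunion n X)" for x y
  proof (cases "x \<in> univ (dunion n X) \<and> y \<in> univ (dunion n X)")
    case True
    then obtain i where i: "i < n" "x \<in> univ (X i)" by (auto simp: univ_dunion)
    have "[x, y] \<in> defset 2 (eps m) (dunion n X) \<longleftrightarrow> (x, y) \<in> rel_rs (dunion n X) ^^ m"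
      using sat_eps[OF S, of "(!) [x, y]" m] True by (simp add: defset_def)
    also have "\<dots> \<longleftrightarrow> y \<in> univ (X i)" by (rule same_component[OF X i])
    also have "\<dots> \<longleftrightarrow> (x, y) \<in> rel_rst (dunion n X)"
      unfolding rel_rst_dunion[OF X n] using i comps_disj[OF C] by blast
    finally show ?thesis by simp
  next
    case False
    then show ?thesis unfolding rel_rst_dunion[OF X n] by (auto simp: defset_def univ_dunion)
  qed
  then show ?thesis by auto
qed

lemma conn_comps_permute:
  assumes \<sigma>: "bij_betw \<sigma> {..<n} {..<n}"
  shows "dunion n (\<lambda>i. X (\<sigma> i)) = dunion n X"
    and "conn_comps n m X \<Longrightarrow> conn_comps n m (\<lambda>i. X (\<sigma> i))"
    and "comps n X \<Longrightarrow> comps n (\<lambda>i. X (\<sigma> i))"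
proof -
  have im: "\<sigma> ` {..<n} = {..<n}" and inj: "inj_on \<sigma> {..<n}" using \<sigma> by (auto simp: bij_betw_def)
  have UN: "(\<Union>i<n. f (\<sigma> i)) = (\<Union>i<n. f i)" for f :: "nat \<Rightarrow> 'c set"
    using im by (metis image_image)
  show "dunion n (\<lambda>i. X (\<sigma> i)) = dunion n X"
    unfolding dunion_def UN[of "\<lambda>i. univ (X i)"] UN[of "\<lambda>i. rel (X i)"] by (rule refl)
  have \<sigma>n: "\<sigma> i < n" if "i < n" for i using im that by auto
  show c: "comps n (\<lambda>i. X (\<sigma> i))" if X: "comps n X"
    unfolding comps_def disjoint_strucs_def disjoint_family_on_def
  proof (intro conjI allI impI ballI)
    fix i assume "i < n" then show "is_struc (X (\<sigma> i))" using X \<sigma>n by (simp add: comps_def)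
  next
    fix i j assume ij: "i \<in> {..<n}" "j \<in> {..<n}" "i \<noteq> j"
    then have "\<sigma> i \<noteq> \<sigma> j" using inj by (auto simp: inj_on_def)
    then show "univ (X (\<sigma> i)) \<inter> univ (X (\<sigma> j)) = {}" using comps_disj[OF X] \<sigma>n ij by blast
  qed
  show "conn_comps n m X \<Longrightarrow> conn_comps n m (\<lambda>i. X (\<sigma> i))"
    using c \<sigma>n by (simp add: conn_comps_def)
qed

text \<open>Having exactly \<open>n\<close> components, all of diameter at most \<open>m\<close>, is elementary: paths of length
  \<open>m + 1\<close> can be replaced by paths of length \<open>m\<close>, and there are \<open>n\<close> representatives.\<close>

lemma split_components:
  fixes X :: "nat \<Rightarrow> 'a struc" and Y :: "'b struc"
  assumes X: "conn_comps n m X" and n: "n \<ge> 1" and Y: "is_struc Y" and Th: "Th Y = Th (dunion n X)"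
  shows "\<exists>Z. conn_comps n m Z \<and> Y = dunion n Z"
proof -
  note C = comps_of_conn[OF X]
  note S = dunion_struc[OF C n]
  let ?R = "rel_rs Y"
  have cl: "(x, y) \<in> ?R ^^ m" if xy: "x \<in> univ Y" "(x, y) \<in> ?R ^^ Suc m" for x y
  proof -
    have "valid (dunion n X) (Imp (reach (Suc m) 0 1) (reach m 0 1))"
      unfolding valid_def
    proof (intro allI impI)
      fix s assume s: "asg (dunion n X) s"
      then have "s 0 \<in> univ (dunion n X)" by simp
      then obtain i where i: "i < n" "s 0 \<in> univ (X i)" by (auto simp: univ_dunion)
      have "s 1 \<in> univ (X i)" if "(s 0, s 1) \<in> rel_rs (dunion n X) ^^ Suc m"
        using that unfolding pow_dunion[OF C i] by (rule pow_univ[OF comps_struc[OF C i(1)] i(2)])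
      then show "sat (dunion n X) s (Imp (reach (Suc m) 0 1) (reach m 0 1))"
        unfolding sat.simps sat_reach[OF S asgD[OF s]] same_component[OF X i] by blast
    qed
    then have v: "valid Y (Imp (reach (Suc m) 0 1) (reach m 0 1))" using valid_cong_Th[OF Th] by blast
    have "y \<in> univ Y" by (rule pow_univ[OF Y xy])
    then have as: "asg Y (\<lambda>v. if v = 0 then x else y)" using xy(1) by (simp add: asg_def)
    then have "sat Y (\<lambda>v. if v = 0 then x else y) (Imp (reach (Suc m) 0 1) (reach m 0 1))"
      using v unfolding valid_def by blast
    then show ?thesis
      using sat_reach[OF Y, of "\<lambda>v. if v = 0 then x else y" 0 _ 1] xy by (simp del: reach.simps)
  qed
  have big: "(x, y) \<in> ?R ^^ (m + k) \<Longrightarrow> x \<in> univ Y \<Longrightarrow> (x, y) \<in> ?R ^^ m" for k x y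
  proof (induction k arbitrary: y)
    case (Suc k)
    then obtain z where "(x, z) \<in> ?R ^^ (m + k)" "(z, y) \<in> ?R" by auto
    then have "(x, y) \<in> ?R ^^ Suc m" using Suc by (meson relpow_Suc_I)
    then show ?case using cl Suc.prems(2) by blast
  qed simp
  have tr: "(x, z) \<in> ?R ^^ m" if "x \<in> univ Y" "(x, y) \<in> ?R ^^ m" "(y, z) \<in> ?R ^^ m" for x y z
  proof -
    have "(x, z) \<in> ?R ^^ (m + m)" using that(2,3) by (auto simp: relpow_add)
    then show ?thesis using big that(1) by blast
  qed
  have ed: "(x, z) \<in> ?R ^^ m" if "x \<in> univ Y" "(x, y) \<in> ?R ^^ m" "(y, z) \<in> ?R" for x y z
    using cl[OF that(1)] relpow_Suc_I[OF that(2,3)] by blast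
  \<comment> \<open>"\<open>v\<^sub>0, \<dots>, v\<^sub>n\<^sub>-\<^sub>1\<close> represent all components, each one once"\<close>
  define \<Sigma> where "\<Sigma> = Conj (All n (Neg (Conj (map (\<lambda>i. Neg (reach m i n)) [0..<n]))) #
    map (\<lambda>(i, j). Neg (reach m i j)) (filter (\<lambda>(i, j). i \<noteq> j) (List.product [0..<n] [0..<n])))"
  have sat\<Sigma>: "sat A s \<Sigma> \<longleftrightarrow> (\<forall>a\<in>univ A. \<exists>i<n. (s i, a) \<in> rel_rs A ^^ m) \<and>
      (\<forall>i<n. \<forall>j<n. i \<noteq> j \<longrightarrow> (s i, s j) \<notin> rel_rs A ^^ m)"
    if A: "is_struc A" and s: "asg A s" for A :: "'c struc" and s
  proof -
    have "sat A (s(n := a)) (reach m i n) \<longleftrightarrow> (s i, a) \<in> rel_rs A ^^ m" if "i < n" for i a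
      using sat_reach[OF A, of "s(n := a)" i m n] asgD[OF s, of i] that by simp
    moreover have "sat A s (reach m i j) \<longleftrightarrow> (s i, s j) \<in> rel_rs A ^^ m" for i j
      by (rule sat_reach[OF A asgD[OF s]])
    ultimately show ?thesis unfolding \<Sigma>_def sat_Conj by (auto simp: sat_Conj Bex_def)
  qed
  have "\<exists>s. asg (dunion n X) s \<and> sat (dunion n X) s \<Sigma>"
  proof -
    have "\<exists>a. a \<in> univ (X i)" if "i < n" for i using comps_struc[OF C that] by (auto simp: is_struc_def)
    then obtain e where e: "\<And>i. i < n \<Longrightarrow> e i \<in> univ (X i)" by metis
    have "e i \<in> univ (dunion n X)" if "i < n" for i using e[OF that] that by (auto simp: univ_dunion)
    from asg_extend[of "dunion n X" n e, OF S this] obtain s where s: "asg (dunion n X) s" "\<forall>i<n. s i = e i" by blast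
    then have si: "s i \<in> univ (X i)" if "i < n" for i using e that by simp
    have "\<forall>a\<in>univ (dunion n X). \<exists>i<n. (s i, a) \<in> rel_rs (dunion n X) ^^ m"
      using same_component[OF X _ si] by (auto simp: univ_dunion)
    moreover have "(s i, s j) \<notin> rel_rs (dunion n X) ^^ m" if "i < n" "j < n" "i \<noteq> j" for i j
      using same_component[OF X that(1) si[OF that(1)]] comps_disj[OF C that(1,2) _ si[OF that(2)]] that(3)
      by blast
    ultimately have "sat (dunion n X) s \<Sigma>" unfolding sat\<Sigma>[OF S s(1)] by blast
    then show ?thesis using s(1) by blast
  qed
  then obtain t where t: "asg Y t" "sat Y t \<Sigma>" using satisfiable_cong_Th[OF Th] by blast
  have cover: "\<exists>i<n. (t i, a) \<in> ?R ^^ m" if "a \<in> univ Y" for a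
    using t(2) that unfolding sat\<Sigma>[OF Y t(1)] by blast
  have sep: "(t i, t j) \<notin> ?R ^^ m" if "i < n" "j < n" "i \<noteq> j" for i j
    using t(2) that unfolding sat\<Sigma>[OF Y t(1)] by blast
  define U where "U i = {y. (t i, y) \<in> ?R ^^ m}" for i
  define Z where "Z i = \<lparr>univ = U i, rel = rel Y \<inter> U i \<times> U i\<rparr>" for i
  have UY: "U i \<subseteq> univ Y" for i using pow_univ[OF Y asgD[OF t(1)]] by (auto simp: U_def)
  have Ued: "y \<in> U i" if "x \<in> U i" "(x, y) \<in> ?R" for x y i
    using ed[OF asgD[OF t(1)]] that by (auto simp: U_def)
  have tU: "t i \<in> U i" for i
    unfolding U_def using pow_mono[of "t i" Y 0 m] t(1) by simp
  have disj: "U i \<inter> U j = {}" if "i < n" "j < n" "i \<noteq> j" for i j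
  proof (rule ccontr)
    assume "U i \<inter> U j \<noteq> {}"
    then obtain y where "(t i, y) \<in> ?R ^^ m" "(t j, y) \<in> ?R ^^ m" by (auto simp: U_def)
    then have "(t i, t j) \<in> ?R ^^ m" using tr[OF asgD[OF t(1)]] pow_sym by metis
    then show False using sep that by blast
  qed
  have "comps n Z"
    unfolding comps_def disjoint_strucs_def disjoint_family_on_def
    using disj tU by (auto simp: is_struc_def Z_def)
  moreover have "conn (Z i) m" for i
    unfolding conn_def
  proof (intro ballI)
    fix x y assume x: "x \<in> univ (Z i)" and y: "y \<in> univ (Z i)"
    have "z \<in> U i \<and> (x, z) \<in> rel_rs (Z i) ^^ k" if "(x, z) \<in> ?R ^^ k" for z k
      using that
    proof (induction k arbitrary: z)
      case 0 then show ?case using x by (simp add: Z_def)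
    next
      case (Suc k)
      then obtain w where w: "(x, w) \<in> ?R ^^ k" "(w, z) \<in> ?R" by auto
      then have wz: "w \<in> U i" "(x, w) \<in> rel_rs (Z i) ^^ k" "z \<in> U i" using Suc.IH Ued by blast+
      then have "(w, z) \<in> rel_rs (Z i)" using w(2) by (auto simp: rel_rs_def Z_def)
      then show ?case using wz by (meson relpow_Suc_I)
    qed
    moreover have "(x, y) \<in> ?R ^^ m"
    proof -
      have "(t i, x) \<in> ?R ^^ m" "(t i, y) \<in> ?R ^^ m" "x \<in> univ Y" using x y UY by (auto simp: Z_def U_def)
      then show ?thesis using tr pow_sym by metis
    qed
    ultimately show "(x, y) \<in> rel_rs (Z i) ^^ m" by blast
  qed
  moreover have "Y = dunion n Z"
  proof -
    have "x \<in> (\<Union>i<n. U i)" if "x \<in> univ Y" for x using cover[OF that] by (auto simp: U_def)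
    then have "univ Y = (\<Union>i<n. U i)" using UY by blast
    moreover have "rel Y = (\<Union>i<n. rel Y \<inter> U i \<times> U i)"
    proof -
      have "\<exists>i<n. x \<in> U i \<and> y \<in> U i" if "(x, y) \<in> rel Y" for x y
      proof -
        have "x \<in> univ Y" "(x, y) \<in> ?R" using that Y by (auto simp: is_struc_def rel_rs_def)
        then show ?thesis using cover[of x] Ued by (auto simp: U_def)
      qed
      then show ?thesis by fast
    qed
    ultimately show ?thesis unfolding dunion_def Z_def by simp
  qed
  ultimately show ?thesis unfolding conn_comps_def by blast
qed

lemma Th_iff_any: "is_struc A \<Longrightarrow> \<phi> \<in> Th A \<longleftrightarrow> \<phi> \<in> forms 0 \<and> sat A s \<phi>"
proof -
  assume A: "is_struc A"
  obtain t where t: "asg A t" using is_struc_ex_asg[OF A] by blast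
  have "sat A s \<phi> \<longleftrightarrow> sat A t \<phi>" if "\<phi> \<in> forms 0" by (rule sentence_indep[OF that])
  then show ?thesis using Th_iff[OF A t] by blast
qed

text \<open>If every matching of the components failed at some sentence, then the finitely many sentences
  involved would make up a sentence that distinguishes the unions.\<close>

lemma match_components:
  fixes X :: "nat \<Rightarrow> 'a struc" and Z :: "nat \<Rightarrow> 'b struc"
  assumes X: "conn_comps n m X" and Z: "conn_comps n m Z" and n: "n \<ge> 1"
    and Th: "Th (dunion n Z) = Th (dunion n X)"
  shows "\<exists>\<sigma>. bij_betw \<sigma> {..<n} {..<n} \<and> (\<forall>i<n. Th (Z (\<sigma> i)) = Th (X i))"
proof (rule ccontr)
  assume no: "\<not> ?thesis"
  note CX = comps_of_conn[OF X] and CZ = comps_of_conn[OF Z]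
  note SX = dunion_struc[OF CX n] and SZ = dunion_struc[OF CZ n]
  define B where "B = {\<sigma> \<in> {..<n} \<rightarrow>\<^sub>E {..<n}. bij_betw \<sigma> {..<n} {..<n}}"
  have "finite ({..<n} \<rightarrow>\<^sub>E {..<n})" by (intro finite_PiE) auto
  then have "finite B" unfolding B_def by simp
  then obtain Bs where Bs: "set Bs = B" using finite_list by blast
  have "\<exists>i \<phi>. i < n \<and> \<phi> \<in> Th (X i) \<and> \<phi> \<notin> Th (Z (\<sigma> i))" if \<sigma>: "\<sigma> \<in> B" for \<sigma>
  proof -
    have b: "bij_betw \<sigma> {..<n} {..<n}" using \<sigma> by (simp add: B_def)
    then obtain i where i: "i < n" "Th (Z (\<sigma> i)) \<noteq> Th (X i)" using no by blast
    have "\<sigma> i < n" using b i by (auto simp: bij_betw_def)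
    then have "\<not> Th (X i) \<subseteq> Th (Z (\<sigma> i))"
      using Th_subset_eq[OF comps_struc[OF CX i(1)] comps_struc[OF CZ]] i(2) by metis
    then show ?thesis using i(1) by blast
  qed
  then obtain I \<Phi> where I: "\<And>\<sigma>. \<sigma> \<in> B \<Longrightarrow> I \<sigma> < n \<and> \<Phi> \<sigma> \<in> Th (X (I \<sigma>)) \<and> \<Phi> \<sigma> \<notin> Th (Z (\<sigma> (I \<sigma>)))"
    by metis
  define F where "F i = Conj (map \<Phi> (filter (\<lambda>\<sigma>. I \<sigma> = i) Bs))" for i
  have \<Phi>0: "\<Phi> \<sigma> \<in> forms 0" if "\<sigma> \<in> B" for \<sigma> using I[OF that] by (simp add: Th_def)
  have fvF: "fv (F i) = {}" for i using \<Phi>0 Bs by (auto simp: F_def fv_Conj forms_def)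
  let ?M = "master n m 0 (\<lambda>_. 0) F"
  have M0: "?M \<in> forms 0" by (rule fv_master) (simp_all add: fvF)
  fix s t
  have "sat (X i) s (F i)" if i: "i < n" for i
  proof -
    have "sat (X i) s (\<Phi> \<sigma>)" if "\<sigma> \<in> B" "I \<sigma> = i" for \<sigma>
      using I[OF that(1)] Th_iff_any[OF comps_struc[OF CX i]] that(2) by blast
    then show ?thesis using Bs by (auto simp: F_def sat_Conj)
  qed
  then have "sat (dunion n X) s ?M"
    by (subst sat_master[OF X]) (auto simp: fvF intro!: exI[of _ "\<lambda>i. i"] simp: bij_betw_def)
  then have "?M \<in> Th (dunion n Z)" using Th_iff_any[OF SX] M0 Th by blast
  then have "sat (dunion n Z) t ?M" using Th_iff_any[OF SZ] by blast
  then obtain \<sigma> where \<sigma>: "bij_betw \<sigma> {..<n} {..<n}" "\<And>i. i < n \<Longrightarrow> sat (Z (\<sigma> i)) t (F i)"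
    by (subst (asm) sat_master[OF Z]) (auto simp: fvF)
  define \<tau> where "\<tau> = restrict \<sigma> {..<n}"
  have "bij_betw \<tau> {..<n} {..<n}" using \<sigma>(1) unfolding \<tau>_def by (subst bij_betw_cong[of _ _ \<sigma>]) auto
  moreover from this have "\<tau> \<in> {..<n} \<rightarrow>\<^sub>E {..<n}" unfolding \<tau>_def
    by (auto simp: bij_betw_def PiE_iff)
  ultimately have \<tau>: "\<tau> \<in> B" by (simp add: B_def)
  have In: "I \<tau> < n" using I[OF \<tau>] by blast
  then have \<tau>n: "\<tau> (I \<tau>) < n" "\<tau> (I \<tau>) = \<sigma> (I \<tau>)" using \<sigma>(1) by (auto simp: \<tau>_def bij_betw_def)
  have "sat (Z (\<tau> (I \<tau>))) t (\<Phi> \<tau>)"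
    using \<sigma>(2)[OF In] \<tau> Bs \<tau>n(2) by (auto simp: F_def sat_Conj)
  then have "\<Phi> \<tau> \<in> Th (Z (\<tau> (I \<tau>)))" using Th_iff_any[OF comps_struc[OF CZ \<tau>n(1)]] \<Phi>0[OF \<tau>] by blast
  then show False using I[OF \<tau>] by blast
qed

text \<open>The components of a model of the theory of the union are found by definability, and their theories
  are the given ones after a permutation.\<close>

theorem models_of_union:
  fixes X :: "nat \<Rightarrow> 'a struc" and Y :: "'b struc"
  assumes X: "conn_comps n m X" and n: "n \<ge> 1" and Y: "is_struc Y"
  shows "Th Y = Th (dunion n X) \<longleftrightarrow>
    (\<exists>Z. conn_comps n m Z \<and> (\<forall>i<n. Th (Z i) = Th (X i)) \<and> Y = dunion n Z)"
proof
  assume Th: "Th Y = Th (dunion n X)"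
  then obtain Z where Z: "conn_comps n m Z" "Y = dunion n Z" using split_components[OF X n Y] by blast
  then obtain \<sigma> where \<sigma>: "bij_betw \<sigma> {..<n} {..<n}" "\<forall>i<n. Th (Z (\<sigma> i)) = Th (X i)"
    using match_components[OF X Z(1) n] Th by blast
  show "\<exists>Z. conn_comps n m Z \<and> (\<forall>i<n. Th (Z i) = Th (X i)) \<and> Y = dunion n Z"
    using \<sigma>(2) conn_comps_permute(1)[OF \<sigma>(1), of Z] conn_comps_permute(2)[OF \<sigma>(1) Z(1)] Z(2)
    by (intro exI[of _ "\<lambda>i. Z (\<sigma> i)"]) auto
next
  assume "\<exists>Z. conn_comps n m Z \<and> (\<forall>i<n. Th (Z i) = Th (X i)) \<and> Y = dunion n Z"
  then obtain Z where Z: "conn_comps n m Z" "\<And>i. i < n \<Longrightarrow> Th (Z i) = Th (X i)" "Y = dunion n Z" by blast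
  then show "Th Y = Th (dunion n X)"
    using Th_dunion_cong[OF n comps_of_conn comps_of_conn[OF X]] by blast
qed

section \<open>Elementary substructures of the union\<close>

lemma elem_substruc_sat:
  assumes E: "elem_substruc A B" and s: "\<And>v. v \<in> fv \<phi> \<Longrightarrow> s v \<in> univ A"
  shows "sat A s \<phi> \<longleftrightarrow> sat B s \<phi>"
proof -
  obtain a where a: "a \<in> univ A" using E by (auto simp: elem_substruc_def is_struc_def)
  define t where "t v = (if v \<in> fv \<phi> then s v else a)" for v
  have "range t \<subseteq> univ A" using s a by (auto simp: t_def)
  then have "sat A t \<phi> \<longleftrightarrow> sat B t \<phi>" using E by (simp add: elem_substruc_def)
  moreover have "sat A s \<phi> \<longleftrightarrow> sat A t \<phi>" "sat B s \<phi> \<longleftrightarrow> sat B t \<phi>"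
    by (rule sat_cong; simp add: t_def)+
  ultimately show ?thesis by simp
qed

text \<open>An elementary substructure has \<open>n\<close> components itself, and by elementarity of paths of length \<open>m\<close>
  they are its intersections with the components of the union. Relativization makes these
  elementary; the converse is the decomposition of formulas.\<close>

theorem elem_substruc_of_union:
  fixes X :: "nat \<Rightarrow> 'a struc"
  assumes X: "conn_comps n m X" and n: "n \<ge> 1" and E: "is_struc E"
  shows "elem_substruc E (dunion n X) \<longleftrightarrow> (\<exists>Z. (\<forall>i<n. elem_substruc (Z i) (X i)) \<and> E = dunion n Z)"
proof
  note C = comps_of_conn[OF X]
  note S = dunion_struc[OF C n]
  assume sub: "elem_substruc E (dunion n X)"
  then have EX: "univ E \<subseteq> univ (dunion n X)" "rel E = rel (dunion n X) \<inter> univ E \<times> univ E"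
    by (auto simp: elem_substruc_def)
  have pow: "(x, y) \<in> rel_rs E ^^ m \<longleftrightarrow> (x, y) \<in> rel_rs (dunion n X) ^^ m"
    if xy: "x \<in> univ E" "y \<in> univ E" for x y
  proof -
    let ?s = "\<lambda>v. if v = (0::nat) then x else y"
    have "sat E ?s (reach m 0 1) \<longleftrightarrow> sat (dunion n X) ?s (reach m 0 1)"
      by (rule elem_substruc_sat[OF sub]) (use xy in simp)
    moreover have "x \<in> univ (dunion n X)" using xy EX by blast
    ultimately show ?thesis
      using sat_reach[OF E, of ?s 0 m 1] sat_reach[OF S, of ?s 0 m 1] xy by simp
  qed
  obtain s where "asg E s" using is_struc_ex_asg[OF E] by blast
  have "Th E \<subseteq> Th (dunion n X)"
  proof
    fix \<phi> assume "\<phi> \<in> Th E"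
    then have \<phi>: "\<phi> \<in> forms 0" "sat E s \<phi>" using Th_iff_any[OF E] by blast+
    have "sat E s \<phi> \<longleftrightarrow> sat (dunion n X) s \<phi>"
      by (rule elem_substruc_sat[OF sub]) (use \<open>asg E s\<close> in simp)
    then show "\<phi> \<in> Th (dunion n X)" using Th_iff_any[OF S] \<phi> by blast
  qed
  then have "Th E = Th (dunion n X)" by (rule Th_subset_eq[OF E S])
  then obtain W where W: "conn_comps n m W" "E = dunion n W" using split_components[OF X n E] by blast
  note CW = comps_of_conn[OF W(1)]
  have WE: "univ (W k) \<subseteq> univ E" if "k < n" for k using that by (auto simp: W(2) univ_dunion)
  have "\<exists>i<n. univ (W k) = univ E \<inter> univ (X i)" if k: "k < n" for k
  proof -
    obtain w where w: "w \<in> univ (W k)" using comps_struc[OF CW k] by (auto simp: is_struc_def)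
    then have wE: "w \<in> univ E" using WE[OF k] by blast
    then obtain i where i: "i < n" "w \<in> univ (X i)" using EX(1) by (auto simp: univ_dunion)
    have "y \<in> univ (W k) \<longleftrightarrow> y \<in> univ (X i)" if y: "y \<in> univ E" for y
      using same_component[OF W(1) k w, of y] same_component[OF X i, of y] pow[OF wE y]
      unfolding W(2)[symmetric] by blast
    then show ?thesis using WE[OF k] i(1) by blast
  qed
  then obtain \<tau> where \<tau>: "\<And>k. k < n \<Longrightarrow> \<tau> k < n \<and> univ (W k) = univ E \<inter> univ (X (\<tau> k))" by metis
  have "inj_on \<tau> {..<n}"
  proof (rule inj_onI)
    fix i j assume ij: "i \<in> {..<n}" "j \<in> {..<n}" "\<tau> i = \<tau> j"
    then obtain w where "w \<in> univ (W i)" using comps_struc[OF CW, of i] by (auto simp: is_struc_def)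
    then show "i = j" using \<tau>[of i] \<tau>[of j] ij comps_disj[OF CW, of i j w] by auto
  qed
  moreover have "\<tau> ` {..<n} \<subseteq> {..<n}" using \<tau> by auto
  ultimately have bij: "bij_betw \<tau> {..<n} {..<n}"
    using endo_inj_surj[of "{..<n}" \<tau>] by (auto simp: bij_betw_def)
  let ?\<sigma> = "inv_into {..<n} \<tau>"
  have bij': "bij_betw ?\<sigma> {..<n} {..<n}" by (rule bij_betw_inv_into[OF bij])
  define Z where "Z i = W (?\<sigma> i)" for i
  have Z: "conn_comps n m Z" and EZ: "E = dunion n Z"
    using conn_comps_permute(1)[OF bij', of W] conn_comps_permute(2)[OF bij' W(1)] W(2)
    unfolding Z_def by simp_all
  note CZ = comps_of_conn[OF Z]
  have uZ: "univ (Z i) = univ E \<inter> univ (X i)" if i: "i < n" for i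
  proof -
    have "?\<sigma> i < n" using bij' i by (auto simp: bij_betw_def)
    moreover have "\<tau> (?\<sigma> i) = i" using bij_betw_inv_into_right[OF bij] i by simp
    ultimately show ?thesis using \<tau>[of "?\<sigma> i"] by (simp add: Z_def)
  qed
  have "elem_substruc (Z i) (X i)" if i: "i < n" for i
    unfolding elem_substruc_def
  proof (intro conjI allI impI)
    show "is_struc (Z i)" "is_struc (X i)" using comps_struc CZ C i by blast+
    show "univ (Z i) \<subseteq> univ (X i)" using uZ[OF i] by blast
    have "(a, b) \<in> rel (Z i) \<longleftrightarrow> (a, b) \<in> rel (X i)" if ab: "a \<in> univ (Z i)" "b \<in> univ (Z i)" for a b
    proof -
      have "a \<in> univ (X i)" "a \<in> univ E" "b \<in> univ E" using ab uZ[OF i] by auto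
      then show ?thesis
        using rel_dunion_comp(1)[OF CZ i ab(1), of b] rel_dunion_comp(1)[OF C i, of a b] EX(2)
        unfolding EZ[symmetric] by auto
    qed
    then show "rel (Z i) = rel (X i) \<inter> univ (Z i) \<times> univ (Z i)"
      using comps_struc[OF CZ i] unfolding is_struc_def by fast
    fix \<phi> and s :: "nat \<Rightarrow> 'a" assume s: "range s \<subseteq> univ (Z i)"
    define w where "w = Suc (Max (insert 0 (vars \<phi>)))"
    have w: "w \<notin> vars \<phi>" using fresh_Suc_Max[OF finite_vars, of w \<phi>] by (auto simp: w_def)
    have sZ: "s v \<in> univ (Z i)" "s v \<in> univ (X i)" "s v \<in> univ E" for v using s uZ[OF i] by auto
    have "sat (Z i) s \<phi> \<longleftrightarrow> sat E s (rlv m w \<phi>)"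
      unfolding EZ by (rule sat_rlv[OF Z i w, symmetric]) (use sZ in auto)
    also have "\<dots> \<longleftrightarrow> sat (dunion n X) s (rlv m w \<phi>)"
      by (rule elem_substruc_sat[OF sub]) (use sZ in auto)
    also have "\<dots> \<longleftrightarrow> sat (X i) s \<phi>" by (rule sat_rlv[OF X i w]) (use sZ in auto)
    finally show "sat (Z i) s \<phi> \<longleftrightarrow> sat (X i) s \<phi>" .
  qed
  with EZ show "\<exists>Z. (\<forall>i<n. elem_substruc (Z i) (X i)) \<and> E = dunion n Z" by blast
next
  note C = comps_of_conn[OF X]
  note S = dunion_struc[OF C n]
  assume "\<exists>Z. (\<forall>i<n. elem_substruc (Z i) (X i)) \<and> E = dunion n Z"
  then obtain Z where Z: "\<And>i. i < n \<Longrightarrow> elem_substruc (Z i) (X i)" and EZ: "E = dunion n Z" by blast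
  have sub: "univ (Z i) \<subseteq> univ (X i)" "rel (Z i) = rel (X i) \<inter> univ (Z i) \<times> univ (Z i)" "is_struc (Z i)"
    if "i < n" for i using Z[OF that] by (auto simp: elem_substruc_def)
  have CZ: "comps n Z"
    unfolding comps_def disjoint_strucs_def disjoint_family_on_def
    using sub comps_disj[OF C] by blast
  show "elem_substruc E (dunion n X)"
    unfolding elem_substruc_def
  proof (intro conjI allI impI)
    show "univ E \<subseteq> univ (dunion n X)" using sub(1) by (auto simp: EZ univ_dunion)
    have "(a, b) \<in> rel E \<longleftrightarrow> (a, b) \<in> rel (dunion n X)" if ab: "a \<in> univ E" "b \<in> univ E" for a b
    proof -
      obtain i where i: "i < n" "a \<in> univ (Z i)" using ab(1) by (auto simp: EZ univ_dunion)
      obtain j where j: "j < n" "b \<in> univ (Z j)" using ab(2) by (auto simp: EZ univ_dunion)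
      have "(a, b) \<in> rel E \<longleftrightarrow> (a, b) \<in> rel (Z i)" unfolding EZ by (rule rel_dunion_comp(1)[OF CZ i])
      also have "\<dots> \<longleftrightarrow> (a, b) \<in> rel (X i)"
      proof
        assume r: "(a, b) \<in> rel (X i)"
        then have "b \<in> univ (X i)" using comps_struc[OF C i(1)] by (auto simp: is_struc_def)
        then have "j = i" using comps_disj[OF C j(1) i(1)] sub(1)[OF j(1)] j(2) by blast
        then show "(a, b) \<in> rel (Z i)" using sub(2)[OF i(1)] i(2) j(2) r by blast
      qed (use sub(2)[OF i(1)] in blast)
      also have "\<dots> \<longleftrightarrow> (a, b) \<in> rel (dunion n X)"
        by (rule rel_dunion_comp(1)[OF C i(1), symmetric]) (use sub(1)[OF i(1)] i(2) in blast)
      finally show ?thesis .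
    qed
    then show "rel E = rel (dunion n X) \<inter> univ E \<times> univ E"
      using E unfolding is_struc_def by fast
    fix \<phi> and s :: "nat \<Rightarrow> 'a" assume "range s \<subseteq> univ E"
    then have "\<exists>i<n. s v \<in> univ (Z i)" for v by (auto simp: EZ univ_dunion image_subset_iff)
    then obtain c where c: "\<And>v. c v < n \<and> s v \<in> univ (Z (c v))" by metis
    show "sat E s \<phi> \<longleftrightarrow> sat (dunion n X) s \<phi>"
      unfolding EZ
    proof (rule sat_dunion_cong[OF CZ C, of \<phi> c])
      fix v show "c v < n \<and> s v \<in> univ (Z (c v)) \<and> s v \<in> univ (X (c v))" using c sub(1) by blast
    next
      fix i \<psi> assume i: "i < n" and \<psi>: "fv \<psi> \<subseteq> {v \<in> fv \<phi>. c v = i}"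
      show "sat (Z i) s \<psi> \<longleftrightarrow> sat (X i) s \<psi>"
        by (rule elem_substruc_sat[OF Z[OF i]]) (use \<psi> c in auto)
    qed
  qed (rule E S)+
qed

section \<open>Counting the countable models of the union\<close>

text \<open>Components are named by different tags, so that countable models of the theories of the
  components can be put side by side in one structure on natural numbers.\<close>

definition tag :: "nat \<Rightarrow> nat struc \<Rightarrow> nat struc" where
  "tag j A = \<lparr>univ = (\<lambda>x. prod_encode (j, x)) ` univ A,
              rel = (\<lambda>(x, y). (prod_encode (j, x), prod_encode (j, y))) ` rel A\<rparr>"

lemma tag_struc: "is_struc A \<Longrightarrow> is_struc (tag j A)"
  by (auto simp: is_struc_def tag_def)

lemma tag_iso: "iso_struc A (tag j A)"
proof -
  let ?f = "\<lambda>x. prod_encode (j, x)"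
  have "inj ?f" by (auto simp: inj_def)
  then have "bij_betw ?f (univ A) (univ (tag j A))"
    unfolding tag_def by (auto simp: bij_betw_def inj_on_def)
  moreover have "(x, y) \<in> rel A \<longleftrightarrow> (?f x, ?f y) \<in> rel (tag j A)" for x y
    by (auto simp: tag_def image_iff intro: bexI[of _ "(x, y)"])
  ultimately show ?thesis unfolding iso_struc_def by blast
qed

lemma tag_comps: "(\<And>j. j < n \<Longrightarrow> is_struc (A j)) \<Longrightarrow> comps n (\<lambda>j. tag j (A j))"
  using tag_struc by (auto simp: comps_def disjoint_strucs_def disjoint_family_on_def tag_def)

lemma tag_Mods: "A \<in> Mods X \<Longrightarrow> tag j A \<in> Mods X"
  using tag_struc iso_struc_Th[OF _ tag_iso[of A j]] by (auto simp: Mods_def)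

lemma dunion_tag_Mods:
  assumes X: "conn_comps n m X" and n: "n \<ge> 1" and A: "\<And>j. j < n \<Longrightarrow> A j \<in> Mods (X j)"
  shows "conn_comps n m (\<lambda>j. tag j (A j))" "dunion n (\<lambda>j. tag j (A j)) \<in> Mods (dunion n X)"
proof -
  have C: "comps n (\<lambda>j. tag j (A j))" using A by (intro tag_comps) (simp add: Mods_def)
  have Th: "Th (tag j (A j)) = Th (X j)" if "j < n" for j using tag_Mods[OF A[OF that]] by (simp add: Mods_def)
  show "conn_comps n m (\<lambda>j. tag j (A j))" using conn_comps_cong[OF X C Th] .
  show "dunion n (\<lambda>j. tag j (A j)) \<in> Mods (dunion n X)"
    using Th_dunion_cong[OF n C comps_of_conn[OF X] Th] dunion_struc[OF C n] by (simp add: Mods_def)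
qed

lemma dunion_iso:
  assumes X: "comps n X" and Y: "comps n Y" and iso: "\<And>i. i < n \<Longrightarrow> iso_struc (X i) (Y i)"
  shows "iso_struc (dunion n X) (dunion n Y)"
proof -
  have "\<exists>f. bij_betw f (univ (X i)) (univ (Y i)) \<and>
      (\<forall>x\<in>univ (X i). \<forall>y\<in>univ (X i). (x, y) \<in> rel (X i) \<longleftrightarrow> (f x, f y) \<in> rel (Y i))" if "i < n" for i
    using iso[OF that] by (simp add: iso_struc_def)
  then obtain f where f: "\<And>i. i < n \<Longrightarrow> bij_betw (f i) (univ (X i)) (univ (Y i))"
    and r: "\<And>i x y. i < n \<Longrightarrow> x \<in> univ (X i) \<Longrightarrow> y \<in> univ (X i) \<Longrightarrow>
      (x, y) \<in> rel (X i) \<longleftrightarrow> (f i x, f i y) \<in> rel (Y i)" by metis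
  have fY: "f i x \<in> univ (Y i)" if "i < n" "x \<in> univ (X i)" for i x
    using bij_betw_apply[OF f[OF that(1)] that(2)] .
  define k where "k x = (THE i. i < n \<and> x \<in> univ (X i))" for x
  have k: "k x = i" if "i < n" "x \<in> univ (X i)" for i x
    unfolding k_def using that comps_disj[OF X] by (intro the_equality) auto
  define h where "h x = f (k x) x" for x
  have h: "h x = f i x" if "i < n" "x \<in> univ (X i)" for i x using k[OF that] by (simp add: h_def)
  have "bij_betw h (univ (dunion n X)) (univ (dunion n Y))"
    unfolding bij_betw_def
  proof
    show "inj_on h (univ (dunion n X))"
    proof (rule inj_onI)
      fix x y assume "x \<in> univ (dunion n X)" "y \<in> univ (dunion n X)" and e: "h x = h y"
      then obtain i j where i: "i < n" "x \<in> univ (X i)" and j: "j < n" "y \<in> univ (X j)"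
        unfolding univ_dunion by blast
      then have e': "f i x = f j y" using e h by simp
      have "i = j" using comps_disj[OF Y i(1) j(1) fY[OF i]] fY[OF j] e' by simp
      then show "x = y" using e' i j bij_betw_imp_inj_on[OF f[OF i(1)]] by (auto simp: inj_on_def)
    qed
    have "h ` univ (X i) = univ (Y i)" if "i < n" for i
      using f[OF that] h[OF that] by (auto simp: bij_betw_def image_iff)
    then show "h ` univ (dunion n X) = univ (dunion n Y)" by (simp add: univ_dunion image_UN)
  qed
  moreover have "(x, y) \<in> rel (dunion n X) \<longleftrightarrow> (h x, h y) \<in> rel (dunion n Y)"
    if xy: "x \<in> univ (dunion n X)" "y \<in> univ (dunion n X)" for x y
  proof -
    obtain i j where i: "i < n" "x \<in> univ (X i)" and j: "j < n" "y \<in> univ (X j)"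
      using xy unfolding univ_dunion by blast
    have "(h x, h y) \<in> rel (dunion n Y) \<longleftrightarrow> (h x, h y) \<in> rel (Y i)"
      using rel_dunion_comp(1)[OF Y i(1) fY[OF i]] h[OF i] by simp
    moreover have "(x, y) \<in> rel (dunion n X) \<longleftrightarrow> (x, y) \<in> rel (X i)" by (rule rel_dunion_comp(1)[OF X i])
    moreover have "(x, y) \<in> rel (X i) \<longleftrightarrow> (h x, h y) \<in> rel (Y i)"
    proof (cases "i = j")
      case True
      then show ?thesis using r[OF i(1), of x y] h i j by simp
    next
      case False
      have "(x, y) \<notin> rel (X i)"
        using comps_struc[OF X i(1)] comps_disj[OF X i(1) j(1) _ j(2)] False by (auto simp: is_struc_def)
      moreover have "(h x, h y) \<notin> rel (Y i)"
        using comps_struc[OF Y i(1)] comps_disj[OF Y i(1) j(1) _ fY[OF j]] False h[OF j]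
        by (auto simp: is_struc_def)
      ultimately show ?thesis by blast
    qed
    ultimately show ?thesis by blast
  qed
  ultimately show ?thesis unfolding iso_struc_def by blast
qed

text \<open>Isomorphisms preserve paths, so they permute the components.\<close>

lemma dunion_iso_components:
  fixes Z :: "nat \<Rightarrow> 'a struc" and Z' :: "nat \<Rightarrow> 'b struc"
  assumes Z: "conn_comps n m Z" and Z': "conn_comps n m Z'" and n: "n \<ge> 1"
    and iso: "iso_struc (dunion n Z) (dunion n Z')"
  shows "\<exists>\<sigma>. bij_betw \<sigma> {..<n} {..<n} \<and> (\<forall>j<n. iso_struc (Z j) (Z' (\<sigma> j)))"
proof -
  note C = comps_of_conn[OF Z] and C' = comps_of_conn[OF Z']
  note S = dunion_struc[OF C n] and S' = dunion_struc[OF C' n]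
  obtain f where f: "bij_betw f (univ (dunion n Z)) (univ (dunion n Z'))"
    "\<And>x y. x \<in> univ (dunion n Z) \<Longrightarrow> y \<in> univ (dunion n Z) \<Longrightarrow>
      (x, y) \<in> rel (dunion n Z) \<longleftrightarrow> (f x, f y) \<in> rel (dunion n Z')"
    using iso by (auto simp: iso_struc_def)
  have inZ: "x \<in> univ (dunion n Z)" if "j < n" "x \<in> univ (Z j)" for x j using that by (auto simp: univ_dunion)
  have pow: "(x, y) \<in> rel_rs (dunion n Z) ^^ m \<longleftrightarrow> (f x, f y) \<in> rel_rs (dunion n Z') ^^ m"
    if xy: "x \<in> univ (dunion n Z)" "y \<in> univ (dunion n Z)" for x y
  proof -
    let ?s = "\<lambda>v. if v = (0::nat) then x else y"
    have s: "asg (dunion n Z) ?s" using xy by (simp add: asg_def)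
    have "sat (dunion n Z) ?s (reach m 0 1) \<longleftrightarrow> sat (dunion n Z') (f \<circ> ?s) (reach m 0 1)"
      by (rule sat_iso[OF f s])
    moreover have "f x \<in> univ (dunion n Z')" using bij_betw_apply[OF f(1) xy(1)] .
    ultimately show ?thesis
      using sat_reach[OF S, of ?s 0 m 1] sat_reach[OF S', of "f \<circ> ?s" 0 m 1] xy by simp
  qed
  have "\<exists>k<n. \<forall>y\<in>univ (dunion n Z). y \<in> univ (Z j) \<longleftrightarrow> f y \<in> univ (Z' k)" if j: "j < n" for j
  proof -
    obtain z where z: "z \<in> univ (Z j)" using comps_struc[OF C j] by (auto simp: is_struc_def)
    have "f z \<in> univ (dunion n Z')" using bij_betw_apply[OF f(1) inZ[OF j z]] .
    then obtain k where k: "k < n" "f z \<in> univ (Z' k)" by (auto simp: univ_dunion)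
    have "y \<in> univ (Z j) \<longleftrightarrow> f y \<in> univ (Z' k)" if "y \<in> univ (dunion n Z)" for y
      using same_component[OF Z j z, of y] same_component[OF Z' k, of "f y"] pow[OF inZ[OF j z] that] by blast
    then show ?thesis using k(1) by blast
  qed
  then obtain \<sigma> where \<sigma>: "\<And>j. j < n \<Longrightarrow> \<sigma> j < n"
    and \<sigma>f: "\<And>j y. j < n \<Longrightarrow> y \<in> univ (dunion n Z) \<Longrightarrow> y \<in> univ (Z j) \<longleftrightarrow> f y \<in> univ (Z' (\<sigma> j))" by metis
  have "inj_on \<sigma> {..<n}"
  proof (rule inj_onI)
    fix i j assume ij: "i \<in> {..<n}" "j \<in> {..<n}" "\<sigma> i = \<sigma> j"
    then obtain z where z: "z \<in> univ (Z i)" using comps_struc[OF C, of i] by (auto simp: is_struc_def)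
    then have "z \<in> univ (Z j)" using \<sigma>f[of i z] \<sigma>f[of j z] ij inZ[of i z] by auto
    then show "i = j" using comps_disj[OF C] z ij by auto
  qed
  moreover have "\<sigma> ` {..<n} \<subseteq> {..<n}" using \<sigma> by auto
  ultimately have bij: "bij_betw \<sigma> {..<n} {..<n}"
    using endo_inj_surj[of "{..<n}" \<sigma>] by (auto simp: bij_betw_def)
  have "iso_struc (Z j) (Z' (\<sigma> j))" if j: "j < n" for j
    unfolding iso_struc_def
  proof (intro exI[of _ f] conjI ballI)
    have "f ` univ (Z j) = univ (Z' (\<sigma> j))"
    proof
      show "f ` univ (Z j) \<subseteq> univ (Z' (\<sigma> j))" using \<sigma>f[OF j] inZ[OF j] by blast
      show "univ (Z' (\<sigma> j)) \<subseteq> f ` univ (Z j)"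
      proof
        fix b assume b: "b \<in> univ (Z' (\<sigma> j))"
        then have "b \<in> f ` univ (dunion n Z)" using f(1) \<sigma>[OF j] by (auto simp: bij_betw_def univ_dunion)
        then show "b \<in> f ` univ (Z j)" using \<sigma>f[OF j] b by blast
      qed
    qed
    moreover have "inj_on f (univ (Z j))"
      by (rule inj_on_subset[OF bij_betw_imp_inj_on[OF f(1)]]) (use inZ[OF j] in blast)
    ultimately show "bij_betw f (univ (Z j)) (univ (Z' (\<sigma> j)))" by (simp add: bij_betw_def)
    fix x y assume xy: "x \<in> univ (Z j)" "y \<in> univ (Z j)"
    have "f x \<in> univ (Z' (\<sigma> j))" using \<sigma>f[OF j] inZ[OF j] xy by blast
    then show "(x, y) \<in> rel (Z j) \<longleftrightarrow> (f x, f y) \<in> rel (Z' (\<sigma> j))"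
      using rel_dunion_comp(1)[OF C j xy(1), of y] rel_dunion_comp(1)[OF C' \<sigma>[OF j], of "f x" "f y"]
        f(2)[OF inZ[OF j xy(1)] inZ[OF j xy(2)]] by simp
  qed
  with bij show ?thesis by blast
qed

text \<open>Unions with all but one component in common are isomorphic only if the remaining components
  are. The permutation need not fix that component, but it preserves the number of components
  of each isomorphism type.\<close>

lemma dunion_cancel:
  fixes Z Z' :: "nat \<Rightarrow> 'a struc"
  assumes Z: "conn_comps n m Z" and Z': "conn_comps n m Z'" and n: "n \<ge> 1" and i: "i < n"
    and eq: "\<And>j. j < n \<Longrightarrow> j \<noteq> i \<Longrightarrow> Z j = Z' j"
    and iso: "iso_struc (dunion n Z) (dunion n Z')"
  shows "iso_struc (Z i) (Z' i)"
proof (rule ccontr)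
  assume no: "\<not> ?thesis"
  obtain \<sigma> where bij: "bij_betw \<sigma> {..<n} {..<n}" and \<sigma>: "\<And>j. j < n \<Longrightarrow> iso_struc (Z j) (Z' (\<sigma> j))"
    using dunion_iso_components[OF Z Z' n iso] by blast
  let ?S = "{j. j < n \<and> iso_struc (Z j) (Z i)}" and ?S' = "{j. j < n \<and> iso_struc (Z' j) (Z i)}"
  have \<sigma>n: "\<sigma> j < n" if "j < n" for j using bij that by (auto simp: bij_betw_def)
  have "\<sigma> ` ?S \<subseteq> ?S'"
    using \<sigma>n \<sigma> iso_sym iso_trans by blast
  moreover have "inj_on \<sigma> ?S" by (rule inj_on_subset[OF bij_betw_imp_inj_on[OF bij]]) auto
  ultimately have "card ?S \<le> card ?S'" by (intro card_inj_on_le[of \<sigma>]) auto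
  moreover have "?S' = ?S - {i}"
  proof -
    have "i \<notin> ?S'" using no iso_sym by blast
    moreover have "iso_struc (Z' j) (Z i) \<longleftrightarrow> iso_struc (Z j) (Z i)" if "j < n" "j \<noteq> i" for j
      using eq[OF that] by simp
    ultimately show ?thesis by blast
  qed
  moreover have "i \<in> ?S" using i iso_refl by blast
  ultimately show False using card_Diff1_less[of ?S i] by auto
qed

text \<open>All components except one are kept fixed; by cancellation, nonisomorphic choices of the remaining
  component give nonisomorphic unions.\<close>

lemma num_models_lower:
  fixes X :: "nat \<Rightarrow> 'a struc"
  assumes X: "conn_comps n m X" and n: "n \<ge> 1" and i: "i < n"
  shows "|Mods (X i) // iso_rel| \<le>o |Mods (dunion n X) // iso_rel|"
proof -
  note C = comps_of_conn[OF X]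
  have "\<exists>B. B \<in> Mods (X j)" if "j < n" for j
    using Lowenheim_Skolem[OF comps_struc[OF C that]] unfolding Mods_def by blast
  then obtain W where W: "\<And>j. j < n \<Longrightarrow> W j \<in> Mods (X j)" by metis
  define V where "V A j = tag j (if j = i then A else W j)" for A j
  have V: "conn_comps n m (V A)" "dunion n (V A) \<in> Mods (dunion n X)" if "A \<in> Mods (X i)" for A
    using dunion_tag_Mods[OF X n, of "\<lambda>j. if j = i then A else W j"] W that unfolding V_def by auto
  define rep where "rep K = (SOME A. A \<in> K)" for K :: "nat struc set"
  have rep: "rep K \<in> Mods (X i) \<and> iso_rel `` {rep K} = K" if "K \<in> Mods (X i) // iso_rel" for K
  proof -
    obtain A where A: "A \<in> Mods (X i)" "K = iso_rel `` {A}" using \<open>K \<in> _\<close> by (auto simp: quotient_def)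
    have "A \<in> K" using A iso_refl by (auto simp: iso_rel_def Mods_def)
    then have "rep K \<in> K" unfolding rep_def by (rule someI)
    then have "(A, rep K) \<in> iso_rel" using A(2) by blast
    then have *: "is_struc (rep K)" "iso_struc A (rep K)" by (auto simp: iso_rel_def)
    have "Th A = Th (rep K)" using A(1) *(2) iso_struc_Th by (auto simp: Mods_def)
    then show ?thesis using A * iso_class_eq_iff[of "rep K" A] iso_sym by (auto simp: Mods_def)
  qed
  define h where "h K = iso_rel `` {dunion n (V (rep K))}" for K
  have "inj_on h (Mods (X i) // iso_rel)"
  proof (rule inj_onI)
    fix K L assume K: "K \<in> Mods (X i) // iso_rel" and L: "L \<in> Mods (X i) // iso_rel" and e: "h K = h L"
    note rK = conjunct1[OF rep[OF K]] and rL = conjunct1[OF rep[OF L]]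
    have "iso_struc (dunion n (V (rep K))) (dunion n (V (rep L)))"
      using e V(2)[OF rK] V(2)[OF rL] iso_class_eq_iff[of "dunion n (V (rep K))" "dunion n (V (rep L))"]
      unfolding h_def Mods_def by blast
    then have "iso_struc (V (rep K) i) (V (rep L) i)"
      by (rule dunion_cancel[OF V(1)[OF rK] V(1)[OF rL] n i, rotated]) (simp add: V_def)
    then have "iso_struc (tag i (rep K)) (tag i (rep L))" by (simp add: V_def)
    then have "iso_struc (rep K) (rep L)"
      using iso_trans[OF tag_iso[of "rep K" i]] iso_trans iso_sym[OF tag_iso[of "rep L" i]] by metis
    then have "iso_rel `` {rep K} = iso_rel `` {rep L}"
      using rep[OF K] rep[OF L] iso_class_eq_iff[of "rep K" "rep L"] unfolding Mods_def by blast
    then show "K = L" using rep[OF K] rep[OF L] by simp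
  qed
  moreover have "h ` (Mods (X i) // iso_rel) \<subseteq> Mods (dunion n X) // iso_rel"
    using rep V(2) by (auto simp: h_def intro: quotientI)
  ultimately show ?thesis unfolding card_of_ordLeq[symmetric] by blast
qed

text \<open>The isomorphism types of its components determine the isomorphism type of a model.\<close>

lemma num_models_upper:
  fixes X :: "nat \<Rightarrow> 'a struc"
  assumes X: "conn_comps n m X" and n: "n \<ge> 1"
  shows "|Mods (dunion n X) // iso_rel| \<le>o |\<Pi>\<^sub>E i\<in>{..<n}. Mods (X i) // iso_rel|"
proof -
  have "\<exists>Z. conn_comps n m Z \<and> (\<forall>i<n. Th (Z i) = Th (X i)) \<and> B = dunion n Z" if "B \<in> Mods (dunion n X)" for B
    using models_of_union[OF X n, of B] that by (simp add: Mods_def)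
  then obtain Z where Z: "\<And>B. B \<in> Mods (dunion n X) \<Longrightarrow>
    conn_comps n m (Z B) \<and> (\<forall>i<n. Th (Z B i) = Th (X i)) \<and> B = dunion n (Z B)" by metis
  have ZM: "Z B i \<in> Mods (X i)" if "B \<in> Mods (dunion n X)" "i < n" for B i
    using Z[OF that(1)] that(2) by (simp add: Mods_def conn_comps_def comps_def)
  define rep where "rep K = (SOME B. B \<in> Mods (dunion n X) \<and> K = iso_rel `` {B})" for K
  have rep: "rep K \<in> Mods (dunion n X) \<and> K = iso_rel `` {rep K}" if "K \<in> Mods (dunion n X) // iso_rel" for K
    unfolding rep_def by (rule someI_ex) (use that in \<open>auto simp: quotient_def\<close>)
  define h where "h K = (\<lambda>i\<in>{..<n}. iso_rel `` {Z (rep K) i})" for K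
  have "inj_on h (Mods (dunion n X) // iso_rel)"
  proof (rule inj_onI)
    fix K L assume K: "K \<in> Mods (dunion n X) // iso_rel" and L: "L \<in> Mods (dunion n X) // iso_rel" and e: "h K = h L"
    note rK = conjunct1[OF rep[OF K]] and rL = conjunct1[OF rep[OF L]]
    have "iso_struc (Z (rep K) i) (Z (rep L) i)" if i: "i < n" for i
    proof -
      have "iso_rel `` {Z (rep K) i} = iso_rel `` {Z (rep L) i}"
        using fun_cong[OF e, of i] i by (simp add: h_def)
      moreover have "is_struc (Z (rep K) i)" "is_struc (Z (rep L) i)"
        using ZM[OF rK i] ZM[OF rL i] by (simp_all add: Mods_def)
      ultimately show ?thesis using iso_class_eq_iff[of "Z (rep K) i" "Z (rep L) i"] by blast
    qed
    moreover have "comps n (Z (rep K))" "comps n (Z (rep L))"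
      using Z[OF rK] Z[OF rL] by (simp_all add: conn_comps_def)
    ultimately have "iso_struc (dunion n (Z (rep K))) (dunion n (Z (rep L)))" by (intro dunion_iso)
    then have "iso_struc (rep K) (rep L)" using Z[OF rK] Z[OF rL] by metis
    then have "iso_rel `` {rep K} = iso_rel `` {rep L}"
      using rep[OF K] rep[OF L] iso_class_eq_iff[of "rep K" "rep L"] unfolding Mods_def by blast
    then show "K = L" using rep[OF K] rep[OF L] by metis
  qed
  moreover have "h ` (Mods (dunion n X) // iso_rel) \<subseteq> (\<Pi>\<^sub>E i\<in>{..<n}. Mods (X i) // iso_rel)"
  proof (rule image_subsetI)
    fix K assume "K \<in> Mods (dunion n X) // iso_rel"
    from ZM[OF conjunct1[OF rep[OF this]]]
    show "h K \<in> (\<Pi>\<^sub>E i\<in>{..<n}. Mods (X i) // iso_rel)" by (auto simp: h_def intro: quotientI)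
  qed
  ultimately show ?thesis unfolding card_of_ordLeq[symmetric] by blast
qed

section \<open>Cardinal arithmetic\<close>

lemma countable_iff_ordLeq: "countable A \<longleftrightarrow> |A| \<le>o natLeq"
proof -
  have "countable A \<longleftrightarrow> |A| \<le>o |UNIV :: nat set|"
    unfolding countable_def card_of_ordLeq[symmetric] by simp
  then show ?thesis
    using card_of_nat ordLeq_ordIso_trans ordIso_symmetric by blast
qed

lemma continuum_eq: "continuum = |UNIV :: (nat \<Rightarrow> bool) set|"
  by (simp add: continuum_def cexp_def ctwo_def Func_def Field_natLeq Field_card_of)

lemma infinite_continuum: "infinite (UNIV :: (nat \<Rightarrow> bool) set)"
proof -
  have "inj (\<lambda>n::nat. (\<lambda>k. k = n))" by (auto simp: inj_def fun_eq_iff)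
  then have "infinite (range (\<lambda>n::nat. (\<lambda>k. k = n)))" by (simp add: finite_image_iff)
  then show ?thesis by (rule infinite_super[OF subset_UNIV])
qed

lemma PiE_card_mono:
  assumes "\<And>i. i \<in> I \<Longrightarrow> |A i| \<le>o |B i|"
  shows "|\<Pi>\<^sub>E i\<in>I. A i| \<le>o |\<Pi>\<^sub>E i\<in>I. B i|"
proof -
  have "\<exists>f. inj_on f (A i) \<and> f ` A i \<subseteq> B i" if "i \<in> I" for i
    using assms[OF that] unfolding card_of_ordLeq[symmetric] by blast
  then obtain f where f: "\<And>i. i \<in> I \<Longrightarrow> inj_on (f i) (A i) \<and> f i ` A i \<subseteq> B i" by metis
  let ?h = "\<lambda>g. \<lambda>i\<in>I. f i (g i)"
  have "inj_on ?h (\<Pi>\<^sub>E i\<in>I. A i)"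
  proof (rule inj_onI)
    fix g g' assume g: "g \<in> (\<Pi>\<^sub>E i\<in>I. A i)" "g' \<in> (\<Pi>\<^sub>E i\<in>I. A i)" and e: "?h g = ?h g'"
    have "g i = g' i" if "i \<in> I" for i
    proof -
      have "f i (g i) = f i (g' i)" using fun_cong[OF e, of i] that by simp
      moreover have "g i \<in> A i" "g' i \<in> A i" using g that by auto
      ultimately show ?thesis using f[OF that] by (auto simp: inj_on_def)
    qed
    then show "g = g'" using g by (intro PiE_ext) auto
  qed
  moreover have "?h ` (\<Pi>\<^sub>E i\<in>I. A i) \<subseteq> (\<Pi>\<^sub>E i\<in>I. B i)"
    using f by (fastforce simp: PiE_iff)
  ultimately show ?thesis unfolding card_of_ordLeq[symmetric] by blast
qed

lemma PiE_ordLeq_continuum: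
  fixes A :: "nat \<Rightarrow> 'c set"
  assumes "\<And>i. i \<in> I \<Longrightarrow> |A i| \<le>o continuum"
  shows "|\<Pi>\<^sub>E i\<in>I. A i| \<le>o continuum"
proof -
  have "\<exists>f :: 'c \<Rightarrow> nat \<Rightarrow> bool. inj_on f (A i)" if "i \<in> I" for i
    using assms[OF that] unfolding continuum_eq card_of_ordLeq[symmetric] by blast
  then obtain f :: "nat \<Rightarrow> 'c \<Rightarrow> nat \<Rightarrow> bool" where f: "\<And>i. i \<in> I \<Longrightarrow> inj_on (f i) (A i)" by metis
  \<comment> \<open>a sequence of subsets of \<open>\<nat>\<close> is coded by a subset of \<open>\<nat> \<times> \<nat>\<close>\<close>
  let ?h = "\<lambda>g k. f (fst (prod_decode k)) (g (fst (prod_decode k))) (snd (prod_decode k))"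
  have "inj_on ?h (\<Pi>\<^sub>E i\<in>I. A i)"
  proof (rule inj_onI)
    fix g g' assume g: "g \<in> (\<Pi>\<^sub>E i\<in>I. A i)" "g' \<in> (\<Pi>\<^sub>E i\<in>I. A i)" and e: "?h g = ?h g'"
    have "g i = g' i" if "i \<in> I" for i
    proof -
      have "f i (g i) j = f i (g' i) j" for j using fun_cong[OF e, of "prod_encode (i, j)"] by simp
      then have "f i (g i) = f i (g' i)" by blast
      moreover have "g i \<in> A i" "g' i \<in> A i" using g that by auto
      ultimately show ?thesis using f[OF that] by (auto simp: inj_on_def)
    qed
    then show "g = g'" using g by (intro PiE_ext) auto
  qed
  then show ?thesis unfolding continuum_eq card_of_ordLeq[symmetric] by blast
qed

lemma countable_finite_PiE:
  fixes n :: nat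
  assumes "\<And>i. i < n \<Longrightarrow> countable (F i)"
  shows "countable (\<Pi>\<^sub>E i\<in>{..<n}. F i)"
proof (rule countable_image_inj_on)
  show "inj_on (\<lambda>g. map g [0..<n]) (\<Pi>\<^sub>E i\<in>{..<n}. F i)"
  proof (rule inj_onI)
    fix g h assume gh: "g \<in> (\<Pi>\<^sub>E i\<in>{..<n}. F i)" "h \<in> (\<Pi>\<^sub>E i\<in>{..<n}. F i)" and e: "map g [0..<n] = map h [0..<n]"
    have "g i = h i" if "i < n" for i using arg_cong[OF e, of "\<lambda>xs. xs ! i"] that by simp
    then show "g = h" using gh by (intro PiE_ext) auto
  qed
  have "(\<lambda>g. map g [0..<n]) ` (\<Pi>\<^sub>E i\<in>{..<n}. F i) \<subseteq> lists (\<Union>i<n. F i)" by (fastforce simp: PiE_iff)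
  moreover have "countable (lists (\<Union>i<n. F i))" using assms by (intro countable_lists countable_UN) auto
  ultimately show "countable ((\<lambda>g. map g [0..<n]) ` (\<Pi>\<^sub>E i\<in>{..<n}. F i))" by (rule countable_subset)
qed

lemma card_cone_iff: "|S| =o cone \<longleftrightarrow> (\<exists>x. S = {x})"
proof
  assume "|S| =o cone"
  then obtain f where "bij_betw f S {()}" unfolding cone_def using card_of_ordIso by blast
  then have "card S = 1" using bij_betw_same_card by fastforce
  then show "\<exists>x. S = {x}" by (simp add: card_1_singleton_iff)
next
  assume "\<exists>x. S = {x}"
  then obtain x where S: "S = {x}" by blast
  have "bij_betw (\<lambda>_. ()) S {()}" by (simp add: S bij_betw_def)
  then show "|S| =o cone" unfolding cone_def using card_of_ordIso by blast
qed

lemma card_Max_mem: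
  assumes "finite K" "K \<noteq> {}" "\<And>r. r \<in> K \<Longrightarrow> Well_order r"
  shows "card_Max K \<in> K"
proof -
  have "\<exists>r\<in>K. \<forall>s\<in>K. s \<le>o r"
    using assms
  proof (induction K rule: finite_ne_induct)
    case (singleton r)
    then show ?case using ordLeq_reflexive by blast
  next
    case (insert r K)
    then obtain r' where r': "r' \<in> K" "\<forall>s\<in>K. s \<le>o r'" by auto
    have w: "Well_order r" "Well_order r'" using insert.prems r'(1) by auto
    consider "r \<le>o r'" | "r' \<le>o r" using ordLeq_total[OF w] by blast
    then show ?case
    proof cases
      case 1 then show ?thesis using r' by auto
    next
      case 2
      then have "\<forall>s\<in>K. s \<le>o r" using r'(2) ordLeq_transitive by blast
      then show ?thesis using ordLeq_reflexive[OF w(1)] by auto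
    qed
  qed
  then have "\<exists>r. r \<in> K \<and> (\<forall>s\<in>K. s \<le>o r)" by blast
  then show ?thesis unfolding card_Max_def by (rule someI2_ex) blast
qed

text \<open>The cardinal part of the theorem: \<open>M\<close> is squeezed between the factors \<open>Q i\<close> and their product.
  If one factor has size continuum, so has the product. If all are countable, an infinite
  product needs an infinite factor, and a finite product other than 1 needs a factor other
  than 1, which then has at least three elements.\<close>

lemma between_factors_and_product:
  fixes Q :: "nat \<Rightarrow> 'c set" and M :: "'d set" and \<kappa> :: "'e rel"
  assumes ne: "\<And>i. i < n \<Longrightarrow> Q i \<noteq> {}" and Mne: "M \<noteq> {}"
    and low: "\<And>i. i < n \<Longrightarrow> |Q i| \<le>o |M|"
    and up: "|M| \<le>o |\<Pi>\<^sub>E i\<in>{..<n}. Q i|" and \<kappa>: "\<kappa> =o |\<Pi>\<^sub>E i\<in>{..<n}. Q i|"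
    and three: "\<And>i. i < n \<Longrightarrow> countable (Q i) \<Longrightarrow> \<not> |Q i| =o cone \<Longrightarrow> |{..<3 :: nat}| \<le>o |Q i|"
    and V: "\<And>i. i < n \<Longrightarrow> |Q i| \<le>o natLeq \<or> |Q i| =o continuum"
  shows "( |M| \<le>o natLeq \<or> |M| =o continuum) \<and>
    (if \<kappa> =o cone \<or> \<kappa> =o natLeq \<or> \<kappa> =o continuum then |M| =o \<kappa>
     else |{..<3 :: nat}| \<le>o |M| \<and> |M| <o natLeq)"
proof -
  let ?P = "\<Pi>\<^sub>E i\<in>{..<n}. Q i"
  have \<kappa>': "|?P| =o \<kappa>" using \<kappa> ordIso_symmetric by blast
  have M\<kappa>: "|M| =o \<kappa>" if "|?P| \<le>o |M|"
    using up that \<kappa>' ordIso_iff_ordLeq ordIso_transitive by blast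
  have \<kappa>iff: "\<kappa> =o cone \<longleftrightarrow> |?P| =o cone" "\<kappa> =o natLeq \<longleftrightarrow> |?P| =o natLeq"
    "\<kappa> =o continuum \<longleftrightarrow> |?P| =o continuum"
    by (rule iffI, erule ordIso_transitive[OF \<kappa>'], erule ordIso_transitive[OF \<kappa>])+
  show ?thesis
  proof (cases "\<exists>i<n. |Q i| =o continuum")
    case True
    then obtain i where i: "i < n" "|Q i| =o continuum" by blast
    have "|Q j| \<le>o continuum" if "j < n" for j
    proof (cases "|Q j| =o continuum")
      case True then show ?thesis by (rule ordIso_imp_ordLeq)
    next
      case False
      then have "|Q j| \<le>o natLeq" using V that by blast
      moreover have "natLeq \<le>o continuum"
        using infinite_continuum infinite_iff_natLeq_ordLeq unfolding continuum_eq by blast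
      ultimately show ?thesis by (rule ordLeq_transitive)
    qed
    then have P: "|?P| \<le>o continuum" by (intro PiE_ordLeq_continuum) simp
    have cM: "continuum \<le>o |M|" using i low[OF i(1)] ordIso_ordLeq_trans ordIso_symmetric by blast
    have "|?P| \<le>o |M|" using P cM ordLeq_transitive by blast
    moreover have "|M| =o continuum"
      using cM up P ordLeq_transitive ordIso_iff_ordLeq by blast
    ultimately show ?thesis using M\<kappa> ordIso_symmetric ordIso_transitive by meson
  next
    case False
    then have c: "countable (Q i)" if "i < n" for i using V[OF that] that countable_iff_ordLeq by blast
    have cP: "countable ?P" using c by (rule countable_finite_PiE)
    have cM: "|M| \<le>o natLeq" using up cP unfolding countable_iff_ordLeq by (rule ordLeq_transitive)
    show ?thesis
    proof (cases "finite ?P")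
      case False
      then obtain i where i: "i < n" "infinite (Q i)" using finite_PiE[of "{..<n}" Q] by auto
      then have "natLeq \<le>o |M|" using low[OF i(1)] infinite_iff_natLeq_ordLeq ordLeq_transitive by blast
      then have "|?P| \<le>o |M|" using cP unfolding countable_iff_ordLeq using ordLeq_transitive by blast
      moreover from this have "\<kappa> =o natLeq"
        using \<kappa>iff cP False infinite_iff_natLeq_ordLeq ordIso_iff_ordLeq unfolding countable_iff_ordLeq by blast
      ultimately show ?thesis using M\<kappa> cM by simp
    next
      case True
      have "finite M" using card_of_ordLeq_finite[OF up True] .
      then have ltM: "|M| <o natLeq" using finite_iff_ordLess_natLeq by blast
      have ninf: "\<not> |?P| =o natLeq" "\<not> |?P| =o continuum"
      proof -
        show "\<not> |?P| =o natLeq"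
        proof
          assume "|?P| =o natLeq"
          then have "natLeq \<le>o |?P|" by (rule ordIso_imp_ordLeq[OF ordIso_symmetric])
          then show False using True infinite_iff_natLeq_ordLeq[of ?P] by blast
        qed
        show "\<not> |?P| =o continuum"
        proof
          assume "|?P| =o continuum"
          then have "finite ?P \<longleftrightarrow> finite (UNIV :: (nat \<Rightarrow> bool) set)"
            unfolding continuum_eq by (rule card_of_ordIso_finite)
          then show False using True infinite_continuum by blast
        qed
      qed
      show ?thesis
      proof (cases "|?P| =o cone")
        case one: True
        from one[unfolded card_cone_iff] obtain x where x: "?P = {x}" by (rule exE)
        have "|?P| \<le>o |M|" unfolding x by (rule card_of_singl_ordLeq[OF Mne])
        then have "|M| =o \<kappa>" by (rule M\<kappa>)
        then show ?thesis using cM one \<kappa>iff(1) by simp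
      next
        case notone: False
        have "\<exists>i<n. \<not> |Q i| =o cone"
        proof (rule ccontr)
          assume "\<not> ?thesis"
          then have "\<forall>i<n. |Q i| =o cone" by blast
          then have "\<forall>i<n. \<exists>x. Q i = {x}" unfolding card_cone_iff .
          then obtain x where x: "\<And>i. i < n \<Longrightarrow> Q i = {x i}" by metis
          have "?P = (\<Pi>\<^sub>E i\<in>{..<n}. {restrict x {..<n} i})" by (intro PiE_cong) (simp add: x)
          then have "?P = {restrict x {..<n}}" using PiE_singleton[OF restrict_extensional] by metis
          then have "\<exists>x. ?P = {x}" by (rule exI[of _ "restrict x {..<n}"])
          then show False using notone unfolding card_cone_iff by (rule notE[rotated])
        qed
        then obtain i where "i < n" "\<not> |Q i| =o cone" by blast
        then have "|{..<3 :: nat}| \<le>o |M|" using three c low ordLeq_transitive by blast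
        then show ?thesis using notone ninf \<kappa>iff cM ltM by simp
      qed
    qed
  qed
qed

section \<open>Atomic theories\<close>

lemma valid_sat:
  assumes A: "is_struc A" and v: "valid A \<phi>" and s: "\<And>v. v \<in> fv \<phi> \<Longrightarrow> s v \<in> univ A"
  shows "sat A s \<phi>"
proof -
  obtain a where a: "a \<in> univ A" using A by (auto simp: is_struc_def)
  let ?t = "\<lambda>v. if v \<in> fv \<phi> then s v else a"
  have "asg A ?t" using s a by (simp add: asg_def)
  then have "sat A ?t \<phi>" using v by (simp add: valid_def)
  moreover have "sat A s \<phi> \<longleftrightarrow> sat A ?t \<phi>" by (rule sat_cong) simp
  ultimately show ?thesis by simp
qed

text \<open>Complete formulas for tuples indexed by any set of variables: the part of a tuple that lies in
  one component is indexed by the variables of that component, not by an initial segment.\<close>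

definition isolates :: "'a struc \<Rightarrow> nat set \<Rightarrow> form \<Rightarrow> bool" where
  "isolates A V \<chi> \<longleftrightarrow> fv \<chi> \<subseteq> V \<and>
     (\<forall>\<psi>. fv \<psi> \<subseteq> V \<longrightarrow> valid A (Imp \<chi> \<psi>) \<or> valid A (Imp \<chi> (Neg \<psi>)))"

text \<open>The complete formula of a tuple, with the other variables quantified existentially, is complete for a
  part of the tuple.\<close>

lemma isolates_subtuple:
  assumes A: "is_struc A" and \<chi>: "complete_form (Th A) l \<chi>" and V: "V \<subseteq> {..<l}"
    and t: "\<And>j. j < l \<Longrightarrow> t j \<in> univ A" "sat A t \<chi>"
  shows "\<exists>\<chi>'. isolates A V \<chi>' \<and> (\<forall>s. (\<forall>j\<in>V. s j = t j) \<longrightarrow> sat A s \<chi>')"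
proof -
  have "finite ({..<l} - V)" by simp
  then obtain xs where xs: "set xs = {..<l} - V" using finite_list by blast
  have \<chi>l: "fv \<chi> \<subseteq> {..<l}" using \<chi> by (simp add: complete_form_def forms_def)
  define \<chi>' where "\<chi>' = Exs xs \<chi>"
  have fv': "fv \<chi>' \<subseteq> V" using \<chi>l xs by (auto simp: \<chi>'_def fv_Exs)
  have lift: "valid A (Imp \<chi>' \<psi>)" if \<psi>: "fv \<psi> \<subseteq> V" "valid A (Imp \<chi> \<psi>)" for \<psi>
    unfolding valid_def
  proof (intro allI impI)
    fix u assume u: "asg A u"
    have "sat A u \<psi>" if "sat A u \<chi>'"
    proof -
      obtain w where w: "\<forall>v. v \<notin> set xs \<longrightarrow> w v = u v" "\<forall>v\<in>set xs. w v \<in> univ A" "sat A w \<chi>"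
        using \<open>sat A u \<chi>'\<close> unfolding \<chi>'_def sat_Exs by blast
      have "w v \<in> univ A" for v using w(1,2) u by (cases "v \<in> set xs") auto
      then have "sat A w \<psi>" using \<psi>(2) w(3) by (simp add: valid_def asg_def)
      moreover have "sat A w \<psi> \<longleftrightarrow> sat A u \<psi>" by (rule sat_cong) (use \<psi>(1) w(1) xs in auto)
      ultimately show ?thesis by simp
    qed
    then show "sat A u (Imp \<chi>' \<psi>)" by simp
  qed
  have "isolates A V \<chi>'"
    unfolding isolates_def
  proof (intro conjI allI impI)
    fix \<psi> assume \<psi>: "fv \<psi> \<subseteq> V"
    then have "\<psi> \<in> forms l" using V by (auto simp: forms_def)
    then have "valid A (Imp \<chi> \<psi>) \<or> valid A (Imp \<chi> (Neg \<psi>))" using \<chi> by (simp add: complete_form_Th_iff)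
    then show "valid A (Imp \<chi>' \<psi>) \<or> valid A (Imp \<chi>' (Neg \<psi>))" using lift[OF \<psi>] lift[of "Neg \<psi>"] \<psi> by auto
  qed (fact fv')
  moreover have "sat A s \<chi>'" if s: "\<And>j. j \<in> V \<Longrightarrow> s j = t j" for s
  proof -
    let ?w = "\<lambda>v. if v \<in> set xs then t v else s v"
    have "sat A ?w \<chi> \<longleftrightarrow> sat A t \<chi>" by (rule sat_cong) (use \<chi>l xs s in auto)
    moreover have "\<forall>v\<in>set xs. ?w v \<in> univ A" using t(1) xs by auto
    ultimately show ?thesis unfolding \<chi>'_def sat_Exs using t(2) by (intro exI[of _ ?w]) auto
  qed
  ultimately show ?thesis by blast
qed

text \<open>Only finitely many theories have to be distinguished.\<close>

lemma separating_sentence: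
  fixes X :: "nat \<Rightarrow> 'a struc"
  assumes X: "comps n X" and i: "i < n"
  obtains \<delta> where "\<delta> \<in> Th (X i)" "\<And>j. j < n \<Longrightarrow> \<delta> \<in> Th (X j) \<Longrightarrow> Th (X j) = Th (X i)"
proof -
  have "\<exists>\<phi>. \<phi> \<in> Th (X i) \<and> (Th (X j) \<noteq> Th (X i) \<longrightarrow> \<phi> \<notin> Th (X j))" if "j < n" for j
  proof (cases "Th (X j) = Th (X i)")
    case True
    have "All 0 (Eq 0 0) \<in> Th (X i)" by (auto simp: Th_def forms_def)
    then show ?thesis using True by blast
  next
    case False
    then have "\<not> Th (X i) \<subseteq> Th (X j)"
      using Th_subset_eq[OF comps_struc[OF X i] comps_struc[OF X that]] by metis
    then show ?thesis by blast
  qed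
  then obtain f where f: "\<And>j. j < n \<Longrightarrow> f j \<in> Th (X i) \<and> (Th (X j) \<noteq> Th (X i) \<longrightarrow> f j \<notin> Th (X j))" by metis
  let ?\<delta> = "Conj (map f [0..<n])"
  have f0: "f j \<in> forms 0" if "j < n" for j using f[OF that] by (simp add: Th_def)
  then have \<delta>0: "?\<delta> \<in> forms 0" by (auto simp: forms_def fv_Conj)
  have iff: "?\<delta> \<in> Th (X k) \<longleftrightarrow> (\<forall>j<n. f j \<in> Th (X k))" if k: "k < n" for k
  proof -
    fix s
    have "?\<delta> \<in> Th (X k) \<longleftrightarrow> sat (X k) s ?\<delta>" using Th_iff_any[OF comps_struc[OF X k]] \<delta>0 by blast
    also have "\<dots> \<longleftrightarrow> (\<forall>j<n. sat (X k) s (f j))" by (auto simp: sat_Conj)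
    also have "\<dots> \<longleftrightarrow> (\<forall>j<n. f j \<in> Th (X k))" using Th_iff_any[OF comps_struc[OF X k]] f0 by blast
    finally show ?thesis .
  qed
  show ?thesis
  proof (rule that)
    show "?\<delta> \<in> Th (X i)" using iff[OF i] f by blast
    fix j assume "j < n" "?\<delta> \<in> Th (X j)"
    then show "Th (X j) = Th (X i)" using iff f by blast
  qed
qed

text \<open>If the parts of a tuple are isolated in the components, the tuple is isolated in the union. The
  isolating formula also lists sentences separating the theories of the components, because
  the components of another realization come in an unknown order.\<close>

lemma union_isolated:
  fixes X :: "nat \<Rightarrow> 'a struc"
  assumes X: "conn_comps n m X" and n: "n \<ge> 1"
    and c: "\<And>j. j < l \<Longrightarrow> c j < n \<and> s j \<in> univ (X (c j))"
    and iso: "\<And>i. i < n \<Longrightarrow> isolates (X i) {j. j < l \<and> c j = i} (\<chi> i) \<and> sat (X i) s (\<chi> i)"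
  obtains \<theta> where "complete_form (Th (dunion n X)) l \<theta>" "sat (dunion n X) s \<theta>"
proof -
  note C = comps_of_conn[OF X]
  note S = dunion_struc[OF C n]
  have "\<exists>\<delta>. \<delta> \<in> Th (X i) \<and> (\<forall>j<n. \<delta> \<in> Th (X j) \<longrightarrow> Th (X j) = Th (X i))" if "i < n" for i
    using separating_sentence[OF C that] by metis
  then obtain \<delta> where \<delta>: "\<And>i. i < n \<Longrightarrow> \<delta> i \<in> Th (X i)"
    and \<delta>sep: "\<And>i j. i < n \<Longrightarrow> j < n \<Longrightarrow> \<delta> i \<in> Th (X j) \<Longrightarrow> Th (X j) = Th (X i)" by metis
  define F where "F i = And (\<chi> i) (\<delta> i)" for i
  have \<delta>0: "fv (\<delta> i) = {}" if "i < n" for i using \<delta>[OF that] by (simp add: Th_def forms_def)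
  have fvF: "fv (F i) \<subseteq> {j. j < l \<and> c j = i}" if "i < n" for i
    using iso[OF that] \<delta>0[OF that] by (auto simp: F_def isolates_def)
  have cn: "c j < n" if "j < l" for j using c[OF that] by blast
  let ?\<theta> = "master n m l c F"
  have \<theta>l: "?\<theta> \<in> forms l" by (rule fv_master) (use cn fvF in auto)
  have sU: "s j \<in> univ (dunion n X)" if "j < l" for j using c[OF that] by (auto simp: univ_dunion)
  have "sat (X i) s (F i)" if "i < n" for i
    using iso[OF that] \<delta>[OF that] Th_iff_any[OF comps_struc[OF C that]] by (auto simp: F_def)
  then have s\<theta>: "sat (dunion n X) s ?\<theta>"
    using c by (subst sat_master[where s = s, OF X cn fvF sU]) (auto intro!: exI[of _ "\<lambda>i. i"] simp: bij_betw_def)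
  obtain s' where s': "asg (dunion n X) s'" "\<forall>j<l. s' j = s j"
    using asg_extend[of "dunion n X" l s, OF S sU] by blast
  have ss': "sat (dunion n X) s' \<psi> \<longleftrightarrow> sat (dunion n X) s \<psi>" if "\<psi> \<in> forms l" for \<psi>
    by (rule sat_cong_forms[OF that]) (simp add: s'(2))
  have "complete_form (Th (dunion n X)) l ?\<theta>"
  proof (rule complete_formI[OF \<theta>l s'(1)])
    show "sat (dunion n X) s' ?\<theta>" using s\<theta> ss'[OF \<theta>l] by blast
    fix t \<psi> assume t: "asg (dunion n X) t" "sat (dunion n X) t ?\<theta>"
      and \<psi>: "\<psi> \<in> forms l" "sat (dunion n X) s' \<psi>"
    have tU: "t j \<in> univ (dunion n X)" for j using t(1) by simp
    obtain \<sigma> where \<sigma>: "bij_betw \<sigma> {..<n} {..<n}" "\<And>j. j < l \<Longrightarrow> t j \<in> univ (X (\<sigma> (c j)))"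
      "\<And>i. i < n \<Longrightarrow> sat (X (\<sigma> i)) t (F i)"
      using t(2) sat_master[where s = t, OF X cn fvF tU] by blast
    have \<sigma>n: "\<sigma> i < n" if "i < n" for i using \<sigma>(1) that by (auto simp: bij_betw_def)
    have Th: "Th (X (\<sigma> i)) = Th (X i)" if i: "i < n" for i
    proof -
      have "sat (X (\<sigma> i)) t (\<delta> i)" using \<sigma>(3)[OF i] by (simp add: F_def)
      then have "\<delta> i \<in> Th (X (\<sigma> i))"
        using Th_iff_any[OF comps_struc[OF C \<sigma>n[OF i]], of "\<delta> i" t] \<delta>0[OF i] by (simp add: forms_def)
      then show ?thesis by (rule \<delta>sep[OF i \<sigma>n[OF i]])
    qed
    have "sat (dunion n X) s \<psi> \<longleftrightarrow> sat (dunion n (\<lambda>i. X (\<sigma> i))) t \<psi>"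
    proof (rule sat_dunion_cong[OF C conn_comps_permute(3)[OF \<sigma>(1) C]])
      fix v assume "v \<in> fv \<psi>"
      then have "v < l" using \<psi>(1) by (auto simp: forms_def)
      then show "c v < n \<and> s v \<in> univ (X (c v)) \<and> t v \<in> univ (X (\<sigma> (c v)))" using c \<sigma>(2) by blast
    next
      fix i \<phi> assume i: "i < n" and fv: "fv \<phi> \<subseteq> {v \<in> fv \<psi>. c v = i}"
      then have fv': "fv \<phi> \<subseteq> {j. j < l \<and> c j = i}" using \<psi>(1) by (auto simp: forms_def)
      have fv\<chi>: "fv (\<chi> i) \<subseteq> {j. j < l \<and> c j = i}" using iso[OF i] by (simp add: isolates_def)
      have s\<chi>: "sat (X i) s (\<chi> i)" and t\<chi>: "sat (X (\<sigma> i)) t (\<chi> i)"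
        using iso[OF i] \<sigma>(3)[OF i] by (simp_all add: F_def)
      have both: "(sat (X i) s \<phi>') \<and> (sat (X (\<sigma> i)) t \<phi>')"
        if v: "valid (X i) (Imp (\<chi> i) \<phi>')" "fv \<phi>' \<subseteq> {j. j < l \<and> c j = i}" for \<phi>'
      proof -
        have "sat (X i) s (Imp (\<chi> i) \<phi>')"
          by (rule valid_sat[OF comps_struc[OF C i] v(1)]) (use v(2) fv\<chi> c in auto)
        moreover have "sat (X (\<sigma> i)) t (Imp (\<chi> i) \<phi>')"
        proof (rule valid_sat[OF comps_struc[OF C \<sigma>n[OF i]]])
          show "valid (X (\<sigma> i)) (Imp (\<chi> i) \<phi>')" using v(1) valid_cong_Th[OF Th[OF i]] by blast
        qed (use v(2) fv\<chi> \<sigma>(2) in auto)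
        ultimately show ?thesis using s\<chi> t\<chi> by simp
      qed
      have "valid (X i) (Imp (\<chi> i) \<phi>) \<or> valid (X i) (Imp (\<chi> i) (Neg \<phi>))"
        using iso[OF i] fv' by (simp add: isolates_def)
      then show "sat (X i) s \<phi> \<longleftrightarrow> sat (X (\<sigma> i)) t \<phi>"
        using both[of \<phi>] both[of "Neg \<phi>"] fv' by auto
    qed
    then show "sat (dunion n X) t \<psi>"
      using \<psi> ss' unfolding conn_comps_permute(1)[OF \<sigma>(1)] by blast
  qed
  then show ?thesis using that s\<theta> by blast
qed

text \<open>Decompose a satisfied formula, complete the resulting formulas in the components, and put
  realizations of the completions together.\<close>

lemma union_atomic_theory:
  fixes X :: "nat \<Rightarrow> 'a struc"
  assumes X: "conn_comps n m X" and n: "n \<ge> 1" and at: "\<And>i. i < n \<Longrightarrow> atomic_theory (Th (X i))"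
  shows "atomic_theory (Th (dunion n X))"
  unfolding atomic_theory_def
proof (intro allI ballI impI)
  note C = comps_of_conn[OF X]
  fix l \<phi> assume \<phi>l: "\<phi> \<in> forms l" and "consistent_with (Th (dunion n X)) \<phi>"
  then obtain s where s: "asg (dunion n X) s" "sat (dunion n X) s \<phi>" by (auto simp: consistent_Th_iff)
  have "\<exists>i<n. s v \<in> univ (X i)" for v using asgD[OF s(1), of v] unfolding univ_dunion by blast
  then obtain c where c: "\<And>v. c v < n \<and> s v \<in> univ (X (c v))" by metis
  have "dnf_holds n (dnf \<phi> n c) X s" using s(2) sat_dunion_dnf[OF C, of \<phi> c s] c by blast
  then obtain g where g: "g \<in> set (dnf \<phi> n c)" "\<And>i. i < n \<Longrightarrow> sat (X i) s (g i)"
    unfolding dnf_holds_def by blast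
  have fvg: "fv (g i) \<subseteq> {j. j < l \<and> c j = i}" for i
    using fv_dnf[OF g(1), of i] \<phi>l by (auto simp: forms_def)
  have "\<exists>\<chi> t. complete_form (Th (X i)) l \<chi> \<and> asg (X i) t \<and> sat (X i) t \<chi> \<and> sat (X i) t (g i)" if i: "i < n" for i
  proof -
    have gl: "g i \<in> forms l" using fvg[of i] by (auto simp: forms_def)
    have "\<not> valid (X i) (Neg (g i))"
      using valid_sat[OF comps_struc[OF C i], of "Neg (g i)" s] g(2)[OF i] fvg[of i] c by auto
    then have "consistent_with (Th (X i)) (g i)" by (simp add: consistent_with_def proves_Th_iff)
    then obtain \<chi> where \<chi>: "complete_form (Th (X i)) l \<chi>" "valid (X i) (Imp \<chi> (g i))"
      using at[OF i] gl unfolding atomic_theory_def completable_form_def proves_Th_iff by blast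
    then obtain t where "asg (X i) t" "sat (X i) t \<chi>" by (auto simp: complete_form_Th_iff)
    then show ?thesis using \<chi> by (auto simp: valid_def)
  qed
  then obtain \<chi> t where \<chi>: "\<And>i. i < n \<Longrightarrow> complete_form (Th (X i)) l (\<chi> i) \<and> asg (X i) (t i) \<and>
      sat (X i) (t i) (\<chi> i) \<and> sat (X i) (t i) (g i)" by metis
  define s' where "s' j = t (c j) j" for j
  have s'X: "s' j \<in> univ (X (c j))" for j using \<chi>[of "c j"] c by (simp add: s'_def)
  have "\<exists>\<chi>'. isolates (X i) {j. j < l \<and> c j = i} \<chi>' \<and> sat (X i) s' \<chi>'" if i: "i < n" for i
  proof -
    have "complete_form (Th (X i)) l (\<chi> i)" "{j. j < l \<and> c j = i} \<subseteq> {..<l}" "\<And>j. j < l \<Longrightarrow> t i j \<in> univ (X i)"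
      "sat (X i) (t i) (\<chi> i)" using \<chi>[OF i] by auto
    from isolates_subtuple[OF comps_struc[OF C i] this] obtain \<chi>' where \<chi>':
      "isolates (X i) {j. j < l \<and> c j = i} \<chi>'"
      "\<forall>s. (\<forall>j\<in>{j. j < l \<and> c j = i}. s j = t i j) \<longrightarrow> sat (X i) s \<chi>'" by blast
    have "sat (X i) s' \<chi>'" by (rule \<chi>'(2)[rule_format]) (auto simp: s'_def)
    then show ?thesis using \<chi>'(1) by blast
  qed
  then obtain \<chi>' where \<chi>': "\<And>i. i < n \<Longrightarrow> isolates (X i) {j. j < l \<and> c j = i} (\<chi>' i) \<and> sat (X i) s' (\<chi>' i)"
    by metis
  have c': "\<And>j. j < l \<Longrightarrow> c j < n \<and> s' j \<in> univ (X (c j))" using c s'X by blast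
  obtain \<theta> where \<theta>: "complete_form (Th (dunion n X)) l \<theta>" "sat (dunion n X) s' \<theta>"
    by (rule union_isolated[OF X n c' \<chi>'])
  have "sat (X i) s' (g i)" if i: "i < n" for i
  proof -
    have "sat (X i) s' (g i) \<longleftrightarrow> sat (X i) (t i) (g i)"
      by (rule sat_cong) (use fvg[of i] in \<open>auto simp: s'_def\<close>)
    then show ?thesis using \<chi>[OF i] by blast
  qed
  then have "dnf_holds n (dnf \<phi> n c) X s'" using g(1) unfolding dnf_holds_def by blast
  then have "sat (dunion n X) s' \<phi>" using sat_dunion_dnf[OF C, of \<phi> c s'] c s'X by blast
  moreover have "asg (dunion n X) s'" using s'X c by (auto simp: asg_def univ_dunion)
  ultimately have "\<not> valid (dunion n X) (Imp \<theta> (Neg \<phi>))" using \<theta>(2) by (auto simp: valid_def)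
  then have "valid (dunion n X) (Imp \<theta> \<phi>)" using \<theta>(1) \<phi>l by (auto simp: complete_form_Th_iff)
  then show "completable_form (Th (dunion n X)) l \<phi>"
    using \<theta>(1) \<phi>l by (auto simp: completable_form_def proves_Th_iff)
qed

text \<open>Express in the union that the tuple lies in one component, which satisfies \<open>\<phi>\<close> and has the right
  theory, and complete this formula. The formula that the decomposition of the completion assigns
  to that component is, together with \<open>\<phi>\<close>, the required completion of \<open>\<phi>\<close>.\<close>

lemma component_atomic_theory:
  fixes X :: "nat \<Rightarrow> 'a struc"
  assumes X: "conn_comps n m X" and n: "n \<ge> 1" and at: "atomic_theory (Th (dunion n X))" and i: "i < n"
  shows "atomic_theory (Th (X i))"
  unfolding atomic_theory_def
proof (intro allI ballI impI)
  note C = comps_of_conn[OF X]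
  note S = dunion_struc[OF C n]
  fix l \<phi> assume \<phi>l: "\<phi> \<in> forms l" and "consistent_with (Th (X i)) \<phi>"
  then obtain s where s: "asg (X i) s" "sat (X i) s \<phi>" by (auto simp: consistent_Th_iff)
  obtain \<delta> where \<delta>: "\<delta> \<in> Th (X i)" "\<And>j. j < n \<Longrightarrow> \<delta> \<in> Th (X j) \<Longrightarrow> Th (X j) = Th (X i)"
    using separating_sentence[OF C i] by metis
  have \<delta>0: "fv \<delta> = {}" using \<delta>(1) by (simp add: Th_def forms_def)
  \<comment> \<open>nothing is required of the other components, \<open>Neg Fls\<close> being true\<close>
  define F where "F \<phi> k j = (if j = k then \<phi> else Neg Fls)" for \<phi> and k j :: nat
  have fvF: "fv (F \<psi> k j) \<subseteq> {v. v < l \<and> k = j}" if "\<psi> \<in> forms l" for \<psi> k j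
    using that by (auto simp: F_def forms_def)
  have \<delta>l: "And \<phi> \<delta> \<in> forms l" using \<phi>l \<delta>0 by (simp add: forms_def)
  \<comment> \<open>"all \<open>v\<^sub>j\<close> are in one component, which satisfies \<open>\<phi>\<close> and has the theory of \<open>X i\<close>"\<close>
  let ?\<Phi> = "master n m l (\<lambda>_. i) (F (And \<phi> \<delta>) i)"
  have \<Phi>l: "?\<Phi> \<in> forms l" by (rule fv_master) (use i fvF[OF \<delta>l] in auto)
  have sU: "asg (dunion n X) s" using s(1) i by (auto simp: asg_def univ_dunion)
  have "sat (dunion n X) s ?\<Phi>"
  proof (subst sat_master[where s = s, OF X i fvF[OF \<delta>l] asgD[OF sU]], intro exI[of _ "\<lambda>i. i"] conjI allI impI)
    show "sat (X j) s (F (And \<phi> \<delta>) i j)" if "j < n" for j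
      using s(2) \<delta>(1) Th_iff_any[OF comps_struc[OF C i]] by (auto simp: F_def)
  qed (use s(1) in \<open>auto simp: bij_betw_def\<close>)
  then have "consistent_with (Th (dunion n X)) ?\<Phi>" using sU unfolding consistent_Th_iff by blast
  then obtain \<chi> where \<chi>: "complete_form (Th (dunion n X)) l \<chi>" "valid (dunion n X) (Imp \<chi> ?\<Phi>)"
    using at \<Phi>l unfolding atomic_theory_def completable_form_def proves_Th_iff by blast
  then obtain t where t: "asg (dunion n X) t" "sat (dunion n X) t \<chi>" by (auto simp: complete_form_Th_iff)
  then have "sat (dunion n X) t ?\<Phi>" using \<chi>(2) by (auto simp: valid_def)
  then obtain \<sigma> where \<sigma>: "bij_betw \<sigma> {..<n} {..<n}" "\<forall>j<l. t j \<in> univ (X (\<sigma> i))"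
    "\<forall>j<n. sat (X (\<sigma> j)) t (F (And \<phi> \<delta>) i j)"
    using sat_master[where s = t, OF X i fvF[OF \<delta>l] asgD[OF t(1)]] by blast
  define k where "k = \<sigma> i"
  have k: "k < n" using \<sigma>(1) i by (auto simp: k_def bij_betw_def)
  have tk: "t j \<in> univ (X k)" if "j < l" for j using \<sigma>(2) that by (simp add: k_def)
  have "sat (X k) t (And \<phi> \<delta>)" using \<sigma>(3) i unfolding F_def k_def by (metis (full_types))
  then have t\<phi>: "sat (X k) t \<phi>" and "sat (X k) t \<delta>" by simp_all
  then have "\<delta> \<in> Th (X k)" using Th_iff_any[OF comps_struc[OF C k], of \<delta> t] \<delta>0 by (simp add: forms_def)
  then have Thk: "Th (X k) = Th (X i)" by (rule \<delta>(2)[OF k])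
  have \<chi>l: "\<chi> \<in> forms l" using \<chi>(1) by (simp add: complete_form_def)
  have fv\<chi>: "v < l" if "v \<in> fv \<chi>" for v using that \<chi>l by (auto simp: forms_def)
  have "dnf_holds n (dnf \<chi> n (\<lambda>_. k)) X t"
    using t(2) sat_dunion_dnf[OF C, of \<chi> "\<lambda>_. k" t] k tk fv\<chi> by blast
  then obtain g where g: "g \<in> set (dnf \<chi> n (\<lambda>_. k))" "\<And>j. j < n \<Longrightarrow> sat (X j) t (g j)"
    unfolding dnf_holds_def by blast
  have fvg: "fv (g j) \<subseteq> {v \<in> fv \<chi>. k = j}" for j by (rule fv_dnf[OF g(1)])
  define \<theta> where "\<theta> = And (g k) \<phi>"
  have \<theta>l: "\<theta> \<in> forms l" using fvg[of k] \<chi>l \<phi>l by (auto simp: \<theta>_def forms_def)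
  obtain t' where t': "asg (X k) t'" "\<forall>j<l. t' j = t j"
    using asg_extend[of "X k" l t, OF comps_struc[OF C k] tk] by blast
  have tt': "sat A t' \<psi> \<longleftrightarrow> sat A t \<psi>" if "\<psi> \<in> forms l" for \<psi> and A :: "'a struc"
    by (rule sat_cong_forms[OF that]) (simp add: t'(2))
  have "complete_form (Th (X k)) l \<theta>"
  proof (rule complete_formI[OF \<theta>l t'(1)])
    show "sat (X k) t' \<theta>" unfolding tt'[OF \<theta>l] using g(2)[OF k] t\<phi> by (simp add: \<theta>_def)
    fix u \<psi> assume u: "asg (X k) u" "sat (X k) u \<theta>" and \<psi>: "\<psi> \<in> forms l" "sat (X k) t' \<psi>"
    have uU: "asg (dunion n X) u" using u(1) k by (auto simp: asg_def univ_dunion)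
    have "sat (X j) u (g j)" if j: "j < n" for j
    proof (cases "j = k")
      case True then show ?thesis using u(2) by (simp add: \<theta>_def)
    next
      case False
      have "sat (X j) u (g j) \<longleftrightarrow> sat (X j) t (g j)" by (rule sat_cong) (use fvg[of j] False in auto)
      then show ?thesis using g(2)[OF j] by blast
    qed
    then have "dnf_holds n (dnf \<chi> n (\<lambda>_. k)) X u" using g(1) unfolding dnf_holds_def by blast
    then have u\<chi>: "sat (dunion n X) u \<chi>" using sat_dunion_dnf[OF C, of \<chi> "\<lambda>_. k" u] k u(1) by simp
    let ?\<Psi> = "master n m l (\<lambda>_. k) (F \<psi> k)"
    have \<Psi>l: "?\<Psi> \<in> forms l" by (rule fv_master) (use k fvF[OF \<psi>(1)] in auto)
    have "sat (dunion n X) t ?\<Psi>"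
    proof (subst sat_master[where s = t, OF X k fvF[OF \<psi>(1)] asgD[OF t(1)]], intro exI[of _ "\<lambda>i. i"] conjI allI impI)
      show "sat (X j) t (F \<psi> k j)" if "j < n" for j using \<psi> tt'[OF \<psi>(1)] by (auto simp: F_def)
    qed (use tk in \<open>auto simp: bij_betw_def\<close>)
    then have "sat (dunion n X) u ?\<Psi>"
      using complete_form_same_sat[OF \<chi>(1) refl refl S S _ t(2) _ u\<chi> \<Psi>l] t(1) uU by simp
    then obtain \<sigma>' where \<sigma>': "\<forall>j<l. u j \<in> univ (X (\<sigma>' k))" "\<forall>j<n. sat (X (\<sigma>' j)) u (F \<psi> k j)"
      and bij: "bij_betw \<sigma>' {..<n} {..<n}"
      using sat_master[where s = u, OF X k fvF[OF \<psi>(1)] asgD[OF uU]] by blast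
    \<comment> \<open>for \<open>l > 0\<close> the variables determine the component, for \<open>l = 0\<close> all formulas are sentences\<close>
    show "sat (X k) u \<psi>"
    proof (cases "l = 0")
      case True
      then have "\<psi> \<in> forms 0" using \<psi>(1) by simp
      then have "sat (X k) u \<psi> \<longleftrightarrow> sat (X k) t' \<psi>" by (rule sentence_indep)
      then show ?thesis using \<psi>(2) by simp
    next
      case False
      then have "u 0 \<in> univ (X (\<sigma>' k))" using \<sigma>'(1) by simp
      moreover have "\<sigma>' k < n" using bij k by (auto simp: bij_betw_def)
      ultimately have "\<sigma>' k = k" using comps_disj[OF C _ k _ asgD[OF u(1)]] by blast
      moreover have "sat (X (\<sigma>' k)) u (F \<psi> k k)" using \<sigma>'(2) k by blast
      ultimately show ?thesis by (simp add: F_def)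
    qed
  qed
  moreover have "valid (X i) (Imp \<theta> \<phi>)" by (simp add: \<theta>_def valid_def)
  ultimately show "completable_form (Th (X i)) l \<phi>"
    using \<phi>l unfolding completable_form_def Thk proves_Th_iff by blast
qed

text \<open>Each part of a tuple is isolated in its component, so the tuple is isolated in the union.\<close>

lemma union_atomic_model:
  fixes Z :: "nat \<Rightarrow> 'b struc"
  assumes Z: "conn_comps n m Z" and n: "n \<ge> 1" and at: "\<And>i. i < n \<Longrightarrow> atomic_model (Z i)"
  shows "atomic_model (dunion n Z)"
  unfolding atomic_model_def
proof (intro allI impI)
  note C = comps_of_conn[OF Z]
  fix xs assume xs: "set xs \<subseteq> univ (dunion n Z)"
  define l where "l = length xs"
  have "\<exists>i. j < l \<longrightarrow> i < n \<and> xs ! j \<in> univ (Z i)" for j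
  proof (cases "j < l")
    case True
    then have "xs ! j \<in> univ (dunion n Z)" using xs by (auto simp: l_def)
    then show ?thesis unfolding univ_dunion by blast
  qed blast
  then obtain c where c: "\<And>j. j < l \<Longrightarrow> c j < n \<and> xs ! j \<in> univ (Z (c j))" by metis
  have "\<exists>\<chi>'. isolates (Z i) {j. j < l \<and> c j = i} \<chi>' \<and> sat (Z i) ((!) xs) \<chi>'" if i: "i < n" for i
  proof -
    obtain a where a: "a \<in> univ (Z i)" using comps_struc[OF C i] by (auto simp: is_struc_def)
    let ?ys = "map (\<lambda>j. if c j = i then xs ! j else a) [0..<l]"
    have "set ?ys \<subseteq> univ (Z i)" using a c by auto
    then obtain \<chi> where \<chi>: "complete_form (Th (Z i)) (length ?ys) \<chi>" "sat (Z i) ((!) ?ys) \<chi>"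
      using at[OF i] unfolding atomic_model_def by blast
    have "?ys ! j \<in> univ (Z i)" if "j < l" for j using that a c[OF that] by auto
    then have pre: "complete_form (Th (Z i)) l \<chi>" "{j. j < l \<and> c j = i} \<subseteq> {..<l}"
      "\<And>j. j < l \<Longrightarrow> ?ys ! j \<in> univ (Z i)" "sat (Z i) ((!) ?ys) \<chi>" using \<chi> by auto
    from isolates_subtuple[OF comps_struc[OF C i] pre] obtain \<chi>' where \<chi>':
      "isolates (Z i) {j. j < l \<and> c j = i} \<chi>'"
      "\<forall>s. (\<forall>j\<in>{j. j < l \<and> c j = i}. s j = ?ys ! j) \<longrightarrow> sat (Z i) s \<chi>'" by blast
    have "sat (Z i) ((!) xs) \<chi>'" by (rule \<chi>'(2)[rule_format]) auto
    then show ?thesis using \<chi>'(1) by blast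
  qed
  then obtain \<chi> where \<chi>: "\<And>i. i < n \<Longrightarrow> isolates (Z i) {j. j < l \<and> c j = i} (\<chi> i) \<and> sat (Z i) ((!) xs) (\<chi> i)"
    by metis
  show "\<exists>\<phi>. complete_form (Th (dunion n Z)) (length xs) \<phi> \<and> sat (dunion n Z) ((!) xs) \<phi>"
    by (rule union_isolated[OF Z n c \<chi>]) (auto simp: l_def)
qed

section \<open>Small theories\<close>

text \<open>A type of the union is determined by the distribution of the variables over the components and
  by one type in each component.\<close>

lemma union_small:
  fixes X :: "nat \<Rightarrow> 'a struc"
  assumes X: "conn_comps n m X" and n: "n \<ge> 1" and sm: "\<And>i. i < n \<Longrightarrow> small_theory (Th (X i))"
  shows "small_theory (Th (dunion n X))"
proof -
  note C = comps_of_conn[OF X]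
  note S = dunion_struc[OF C n]
  have "countable (complete_types l (Th (dunion n X)))" for l
  proof -
    let ?T = "complete_types l (Th (dunion n X))"
    have "\<exists>(Z :: nat \<Rightarrow> nat struc) s c. conn_comps n m Z \<and> (\<forall>i<n. Th (Z i) = Th (X i)) \<and>
      (\<forall>j. c j < n \<and> s j \<in> univ (Z (c j))) \<and> p = tp l (dunion n Z) s" if p: "p \<in> ?T" for p
    proof -
      obtain B :: "nat struc" and s where B: "is_struc B" "Th B = Th (dunion n X)" "asg B s" "p = tp l B s"
        using complete_type_realized[OF S p] by metis
      then obtain Z where Z: "conn_comps n m Z" "\<forall>i<n. Th (Z i) = Th (X i)" "B = dunion n Z"
        using models_of_union[OF X n B(1)] by blast
      have "\<exists>i<n. s j \<in> univ (Z i)" for j using asgD[OF B(3), of j] unfolding Z(3) univ_dunion by blast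
      then obtain c where "\<And>j. c j < n \<and> s j \<in> univ (Z (c j))" by metis
      then show ?thesis using Z B(4) by blast
    qed
    then obtain Z :: "form set \<Rightarrow> nat \<Rightarrow> nat struc" and s c where Z: "\<And>p. p \<in> ?T \<Longrightarrow> conn_comps n m (Z p) \<and>
      (\<forall>i<n. Th (Z p i) = Th (X i)) \<and> (\<forall>j. c p j < n \<and> s p j \<in> univ (Z p (c p j))) \<and>
      p = tp l (dunion n (Z p)) (s p)" by metis
    \<comment> \<open>the part of the tuple in component \<open>i\<close>, filled up by a fixed element of the component\<close>
    define t where "t p i j = (if c p j = i then s p j else (SOME a. a \<in> univ (Z p i)))" for p i j
    have tZ: "t p i j \<in> univ (Z p i)" if p: "p \<in> ?T" and i: "i < n" for p i j
    proof -
      have "is_struc (Z p i)" using Z[OF p] i by (simp add: conn_comps_def comps_def)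
      then have "(SOME a. a \<in> univ (Z p i)) \<in> univ (Z p i)" by (auto simp: is_struc_def some_in_eq)
      then show ?thesis using Z[OF p] by (auto simp: t_def)
    qed
    define key where "key p = (map (c p) [0..<l], \<lambda>i\<in>{..<n}. tp l (Z p i) (t p i))" for p
    have "inj_on key ?T"
    proof (rule inj_onI)
      fix p q assume p: "p \<in> ?T" and q: "q \<in> ?T" and e: "key p = key q"
      have cc: "c p j = c q j" if "j < l" for j
        using arg_cong[OF e, of "\<lambda>k. fst k ! j"] that by (simp add: key_def)
      have tt: "tp l (Z p i) (t p i) = tp l (Z q i) (t q i)" if "i < n" for i
        using arg_cong[OF e, of "\<lambda>k. snd k i"] that by (simp add: key_def)
      have "sat (dunion n (Z p)) (s p) \<phi> \<longleftrightarrow> sat (dunion n (Z q)) (s q) \<phi>" if \<phi>: "\<phi> \<in> forms l" for \<phi>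
      proof (rule sat_dunion_cong)
        show "comps n (Z p)" "comps n (Z q)" using Z[OF p] Z[OF q] by (simp_all add: conn_comps_def)
        fix v assume "v \<in> fv \<phi>"
        then have "v < l" using \<phi> by (auto simp: forms_def)
        then show "c p v < n \<and> s p v \<in> univ (Z p (c p v)) \<and> s q v \<in> univ (Z q (c p v))"
          using Z[OF p] Z[OF q] cc by metis
      next
        fix i \<psi> assume i: "i < n" and \<psi>: "fv \<psi> \<subseteq> {v \<in> fv \<phi>. c p v = i}"
        then have \<psi>l: "fv \<psi> \<subseteq> {v. v < l \<and> c p v = i}" using \<phi> by (auto simp: forms_def)
        then have \<psi>f: "\<psi> \<in> forms l" by (auto simp: forms_def)
        have "sat (Z p i) (s p) \<psi> \<longleftrightarrow> sat (Z p i) (t p i) \<psi>"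
          by (rule sat_cong) (use \<psi>l in \<open>auto simp: t_def\<close>)
        also have "\<dots> \<longleftrightarrow> \<psi> \<in> tp l (Z p i) (t p i)" using \<psi>f by (simp add: tp_def)
        also have "\<dots> \<longleftrightarrow> \<psi> \<in> tp l (Z q i) (t q i)" by (simp only: tt[OF i])
        also have "\<dots> \<longleftrightarrow> sat (Z q i) (t q i) \<psi>" using \<psi>f by (simp add: tp_def)
        also have "\<dots> \<longleftrightarrow> sat (Z q i) (s q) \<psi>"
        proof (rule sat_cong)
          fix v assume "v \<in> fv \<psi>"
          then have "c q v = i" using \<psi>l cc by fastforce
          then show "t q i v = s q v" by (simp add: t_def)
        qed
        finally show "sat (Z p i) (s p) \<psi> \<longleftrightarrow> sat (Z q i) (s q) \<psi>" .
      qed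
      then have "tp l (dunion n (Z p)) (s p) = tp l (dunion n (Z q)) (s q)" unfolding tp_def by blast
      then show "p = q" using Z[OF p] Z[OF q] by metis
    qed
    moreover have "countable (key ` ?T)"
    proof (rule countable_subset)
      show "key ` ?T \<subseteq> (UNIV :: nat list set) \<times> (\<Pi>\<^sub>E i\<in>{..<n}. complete_types l (Th (X i)))"
      proof (rule image_subsetI)
        fix p assume p: "p \<in> ?T"
        have "tp l (Z p i) (t p i) \<in> complete_types l (Th (X i))" if i: "i < n" for i
          using Z[OF p] i tZ[OF p i]
          by (intro tp_complete_type[OF comps_struc[OF C i]]) (auto simp: conn_comps_def comps_def)
        then show "key p \<in> (UNIV :: nat list set) \<times> (\<Pi>\<^sub>E i\<in>{..<n}. complete_types l (Th (X i)))"
          by (auto simp: key_def)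
      qed
      have "countable (complete_types l (Th (X i)))" if "i < n" for i
        using sm[OF that] unfolding small_theory_def by (rule countable_subset[rotated]) blast
      then show "countable ((UNIV :: nat list set) \<times> (\<Pi>\<^sub>E i\<in>{..<n}. complete_types l (Th (X i))))"
        by (intro countable_SIGMA countable_finite_PiE) auto
    qed
    ultimately show ?thesis using countable_image_inj_on by blast
  qed
  then show ?thesis unfolding small_theory_def by (intro countable_UN) auto
qed

text \<open>Conversely, the type of a nonempty tuple of a component can be read off its type in the union,
  where the variables name the component. The empty tuple has only one type in each theory.\<close>

lemma component_small:
  fixes X :: "nat \<Rightarrow> 'a struc"
  assumes X: "conn_comps n m X" and n: "n \<ge> 1" and sm: "small_theory (Th (dunion n X))" and i: "i < n"
  shows "small_theory (Th (X i))"
proof -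
  note C = comps_of_conn[OF X]
  note S = dunion_struc[OF C n]
  have "\<exists>B. B \<in> Mods (X j)" if "j < n" for j
    using Lowenheim_Skolem[OF comps_struc[OF C that]] unfolding Mods_def by blast
  then obtain W where W: "\<And>j. j < n \<Longrightarrow> W j \<in> Mods (X j)" by metis
  have "countable (complete_types l (Th (X i)))" for l
  proof (cases "l = 0")
    case True
    have "complete_types l (Th (X i)) \<subseteq> {Th (X i)}"
    proof
      fix p assume "p \<in> complete_types l (Th (X i))"
      then obtain B :: "nat struc" and s where B: "is_struc B" "Th B = Th (X i)" "p = tp 0 B s"
        using complete_type_realized[OF comps_struc[OF C i]] True by metis
      then have "p = Th B" using Th_iff_any[OF B(1)] by (auto simp: tp_def)
      then show "p \<in> {Th (X i)}" using B by simp
    qed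
    then show ?thesis by (rule countable_subset) simp
  next
    case False
    define F where "F \<phi> j = (if j = i then \<phi> else Neg Fls)" for \<phi> and j :: nat
    have fvF: "fv (F \<psi> j) \<subseteq> {v. v < l \<and> i = j}" if "\<psi> \<in> forms l" for \<psi> j
      using that by (auto simp: F_def forms_def)
    define h where "h P = {\<phi> \<in> forms l. master n m l (\<lambda>_. i) (F \<phi>) \<in> P}" for P
    have "complete_types l (Th (X i)) \<subseteq> h ` complete_types l (Th (dunion n X))"
    proof
      fix p assume "p \<in> complete_types l (Th (X i))"
      then obtain B :: "nat struc" and t where B: "is_struc B" "Th B = Th (X i)" "asg B t" "p = tp l B t"
        using complete_type_realized[OF comps_struc[OF C i]] by metis
      define Y where "Y j = tag j (if j = i then B else W j)" for j
      have "(if j = i then B else W j) \<in> Mods (X j)" if "j < n" for j using W[OF that] B by (simp add: Mods_def)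
      from dunion_tag_Mods[OF X n this] have Y: "conn_comps n m Y" "dunion n Y \<in> Mods (dunion n X)"
        unfolding Y_def by auto
      have "iso_struc B (Y i)" using tag_iso[of B i] by (simp add: Y_def)
      then obtain f where f: "bij_betw f (univ B) (univ (Y i))"
        "\<And>x y. x \<in> univ B \<Longrightarrow> y \<in> univ B \<Longrightarrow> (x, y) \<in> rel B \<longleftrightarrow> (f x, f y) \<in> rel (Y i)"
        by (auto simp: iso_struc_def)
      have s: "f (t j) \<in> univ (Y i)" for j using bij_betw_apply[OF f(1) asgD[OF B(3)]] .
      then have sU: "asg (dunion n Y) (f \<circ> t)" using i by (auto simp: asg_def univ_dunion)
      have "sat (dunion n Y) (f \<circ> t) (master n m l (\<lambda>_. i) (F \<phi>)) \<longleftrightarrow> sat B t \<phi>" if \<phi>: "\<phi> \<in> forms l" for \<phi>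
      proof -
        have "sat (dunion n Y) (f \<circ> t) (master n m l (\<lambda>_. i) (F \<phi>)) \<longleftrightarrow> sat (Y i) (f \<circ> t) \<phi>"
        proof (subst sat_master[where s = "f \<circ> t", OF Y(1) i fvF[OF \<phi>] asgD[OF sU]], rule iffI)
          assume "\<exists>\<sigma>. bij_betw \<sigma> {..<n} {..<n} \<and> (\<forall>j<l. (f \<circ> t) j \<in> univ (Y (\<sigma> i))) \<and>
            (\<forall>j<n. sat (Y (\<sigma> j)) (f \<circ> t) (F \<phi> j))"
          then obtain \<sigma> where \<sigma>: "bij_betw \<sigma> {..<n} {..<n}" "\<forall>j<l. (f \<circ> t) j \<in> univ (Y (\<sigma> i))"
            "\<forall>j<n. sat (Y (\<sigma> j)) (f \<circ> t) (F \<phi> j)" by blast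
          have "\<sigma> i < n" using \<sigma>(1) i by (auto simp: bij_betw_def)
          moreover have "f (t 0) \<in> univ (Y (\<sigma> i))" using \<sigma>(2) False by simp
          ultimately have "\<sigma> i = i" using comps_disj[OF comps_of_conn[OF Y(1)] _ i _ s] by blast
          moreover have "sat (Y (\<sigma> i)) (f \<circ> t) (F \<phi> i)" using \<sigma>(3) i by blast
          ultimately show "sat (Y i) (f \<circ> t) \<phi>" by (simp add: F_def)
        next
          assume "sat (Y i) (f \<circ> t) \<phi>"
          then show "\<exists>\<sigma>. bij_betw \<sigma> {..<n} {..<n} \<and> (\<forall>j<l. (f \<circ> t) j \<in> univ (Y (\<sigma> i))) \<and>
            (\<forall>j<n. sat (Y (\<sigma> j)) (f \<circ> t) (F \<phi> j))"
            using s by (intro exI[of _ "\<lambda>j. j"]) (auto simp: bij_betw_def F_def)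
        qed
        also have "\<dots> \<longleftrightarrow> sat B t \<phi>" by (rule sat_iso[OF f B(3), symmetric])
        finally show ?thesis .
      qed
      moreover have "master n m l (\<lambda>_. i) (F \<phi>) \<in> forms l" if \<phi>: "\<phi> \<in> forms l" for \<phi>
        by (rule fv_master) (use i fvF[OF \<phi>] in auto)
      ultimately have "h (tp l (dunion n Y) (f \<circ> t)) = p"
        unfolding h_def B(4) tp_def by blast
      moreover have "tp l (dunion n Y) (f \<circ> t) \<in> complete_types l (Th (dunion n X))"
        using Y(2) sU by (intro tp_complete_type[OF S]) (auto simp: Mods_def asg_def)
      ultimately show "p \<in> h ` complete_types l (Th (dunion n X))" by blast
    qed
    moreover have "countable (complete_types l (Th (dunion n X)))"
      using sm unfolding small_theory_def by (rule countable_subset[rotated]) blast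
    ultimately show ?thesis by (meson countable_image countable_subset)
  qed
  then show ?thesis unfolding small_theory_def by (intro countable_UN) auto
qed

text \<open>The elements that realize finite parts of a type in the union can be taken from one fixed
  component, by the pigeonhole principle. There the type becomes a type over the parameters in
  that component, since what the formulas say about the other components is already decided.\<close>

lemma union_saturated:
  fixes Z :: "nat \<Rightarrow> 'b struc"
  assumes C: "comps n Z" and sat: "\<And>i. i < n \<Longrightarrow> omega_saturated (Z i)"
  shows "omega_saturated (dunion n Z)"
  unfolding omega_saturated_def
proof (intro allI impI, elim conjE)
  fix xs p
  assume xs: "set xs \<subseteq> univ (dunion n Z)" and p: "p \<subseteq> forms (Suc (length xs))"
    and fin: "\<forall>q\<subseteq>p. finite q \<longrightarrow> (\<exists>b\<in>univ (dunion n Z). \<forall>\<phi>\<in>q. sat (dunion n Z) ((!) (xs @ [b])) \<phi>)"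
  define l where "l = length xs"
  have "\<exists>i. j < l \<longrightarrow> i < n \<and> xs ! j \<in> univ (Z i)" for j
  proof (cases "j < l")
    case True
    then have "xs ! j \<in> univ (dunion n Z)" using xs by (auto simp: l_def)
    then show ?thesis unfolding univ_dunion by blast
  qed blast
  then obtain c where c: "\<And>j. j < l \<Longrightarrow> c j < n \<and> xs ! j \<in> univ (Z (c j))" by metis
  have "\<exists>i<n. \<forall>q\<subseteq>p. finite q \<longrightarrow> (\<exists>b\<in>univ (Z i). \<forall>\<phi>\<in>q. sat (dunion n Z) ((!) (xs @ [b])) \<phi>)"
  proof (rule ccontr)
    assume "\<not> ?thesis"
    then have "\<forall>i<n. \<exists>q\<subseteq>p. finite q \<and> \<not> (\<exists>b\<in>univ (Z i). \<forall>\<phi>\<in>q. sat (dunion n Z) ((!) (xs @ [b])) \<phi>)"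
      by blast
    then obtain q where q: "\<And>i. i < n \<Longrightarrow> q i \<subseteq> p \<and> finite (q i) \<and>
      \<not> (\<exists>b\<in>univ (Z i). \<forall>\<phi>\<in>q i. sat (dunion n Z) ((!) (xs @ [b])) \<phi>)" by metis
    have "(\<Union>i<n. q i) \<subseteq> p" "finite (\<Union>i<n. q i)" using q by auto
    then obtain b where b: "b \<in> univ (dunion n Z)" "\<forall>\<phi>\<in>(\<Union>i<n. q i). sat (dunion n Z) ((!) (xs @ [b])) \<phi>"
      using fin by blast
    then obtain i where i: "i < n" "b \<in> univ (Z i)" unfolding univ_dunion by blast
    then have "\<forall>\<phi>\<in>q i. sat (dunion n Z) ((!) (xs @ [b])) \<phi>" using b(2) by blast
    then show False using q[OF i(1)] i(2) by blast
  qed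
  then obtain i where i: "i < n" and fini: "\<And>q. q \<subseteq> p \<Longrightarrow> finite q \<Longrightarrow>
    \<exists>b\<in>univ (Z i). \<forall>\<phi>\<in>q. sat (dunion n Z) ((!) (xs @ [b])) \<phi>" by blast
  obtain a where a: "a \<in> univ (Z i)" using comps_struc[OF C i] by (auto simp: is_struc_def)
  define ys where "ys = map (\<lambda>j. if c j = i then xs ! j else a) [0..<l]"
  have ysl: "length ys = l" and ysZ: "set ys \<subseteq> univ (Z i)" using a c by (auto simp: ys_def)
  define c' where "c' = c(l := i)"
  \<comment> \<open>the disjunction of the formulas for component \<open>i\<close> in those disjuncts of the decomposition of
    \<open>\<phi>\<close> whose other formulas hold at the parameters\<close>
  define tr where "tr \<phi> = Neg (Conj (map (\<lambda>g. Neg (g i))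
    (filter (\<lambda>g. \<forall>k<n. k \<noteq> i \<longrightarrow> sat (Z k) ((!) xs) (g k)) (dnf \<phi> n c'))))" for \<phi>
  have fvg: "fv (g k) \<subseteq> {v. v < Suc l \<and> c' v = k}" if "g \<in> set (dnf \<phi> n c')" "\<phi> \<in> p" for g k \<phi>
    using fv_dnf[OF that(1), of k] that(2) p by (force simp: forms_def l_def)
  have tr: "sat (dunion n Z) ((!) (xs @ [b])) \<phi> \<longleftrightarrow> sat (Z i) ((!) (ys @ [b])) (tr \<phi>)"
    if b: "b \<in> univ (Z i)" and \<phi>: "\<phi> \<in> p" for b \<phi>
  proof -
    have col: "c' v < n \<and> (xs @ [b]) ! v \<in> univ (Z (c' v))" if "v < Suc l" for v
      using that c[of v] i b by (cases "v = l") (auto simp: c'_def nth_append l_def)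
    have "sat (dunion n Z) ((!) (xs @ [b])) \<phi> \<longleftrightarrow> dnf_holds n (dnf \<phi> n c') Z ((!) (xs @ [b]))"
    proof (rule sat_dunion_dnf[OF C])
      fix v assume "v \<in> fv \<phi>"
      then have "v < Suc l" using \<phi> p by (force simp: forms_def l_def)
      then show "c' v < n \<and> (xs @ [b]) ! v \<in> univ (Z (c' v))" by (rule col)
    qed
    also have "\<dots> \<longleftrightarrow> (\<exists>g\<in>set (dnf \<phi> n c'). (\<forall>k<n. k \<noteq> i \<longrightarrow> sat (Z k) ((!) xs) (g k)) \<and>
      sat (Z i) ((!) (ys @ [b])) (g i))"
      unfolding dnf_holds_def
    proof (rule bex_cong[OF refl])
      fix g assume g: "g \<in> set (dnf \<phi> n c')"
      have 1: "sat (Z k) ((!) (xs @ [b])) (g k) \<longleftrightarrow> sat (Z k) ((!) xs) (g k)" if "k \<noteq> i" for k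
      proof (rule sat_cong)
        fix v assume "v \<in> fv (g k)"
        then have "v < Suc l" "c' v = k" using fvg[OF g \<phi>, of k] by auto
        then have "v < l" using that by (cases "v = l") (auto simp: c'_def)
        then show "(xs @ [b]) ! v = xs ! v" by (simp add: nth_append l_def)
      qed
      have 2: "sat (Z i) ((!) (xs @ [b])) (g i) \<longleftrightarrow> sat (Z i) ((!) (ys @ [b])) (g i)"
      proof (rule sat_cong)
        fix v assume "v \<in> fv (g i)"
        then have "v < Suc l" "c' v = i" using fvg[OF g \<phi>, of i] by auto
        then show "(xs @ [b]) ! v = (ys @ [b]) ! v"
          by (cases "v = l") (auto simp: c'_def nth_append ysl ys_def l_def)
      qed
      show "(\<forall>k<n. sat (Z k) ((!) (xs @ [b])) (g k)) \<longleftrightarrow>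
        (\<forall>k<n. k \<noteq> i \<longrightarrow> sat (Z k) ((!) xs) (g k)) \<and> sat (Z i) ((!) (ys @ [b])) (g i)"
        using 1 2 i by metis
    qed
    also have "\<dots> \<longleftrightarrow> sat (Z i) ((!) (ys @ [b])) (tr \<phi>)" by (auto simp: tr_def sat_Conj)
    finally show ?thesis .
  qed
  have trf: "tr ` p \<subseteq> forms (Suc (length ys))"
  proof (rule image_subsetI)
    fix \<phi> assume \<phi>: "\<phi> \<in> p"
    have "fv (tr \<phi>) \<subseteq> (\<Union>g\<in>set (dnf \<phi> n c'). fv (g i))" by (auto simp: tr_def fv_Conj)
    then have "fv (tr \<phi>) \<subseteq> {..<Suc l}" using fvg[OF _ \<phi>, of _ i] by blast
    then show "tr \<phi> \<in> forms (Suc (length ys))" by (simp add: forms_def ysl)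
  qed
  have "\<exists>b\<in>univ (Z i). \<forall>\<phi>\<in>q'. sat (Z i) ((!) (ys @ [b])) \<phi>" if q': "q' \<subseteq> tr ` p" "finite q'" for q'
  proof -
    obtain q where q: "q \<subseteq> p" "finite q" "q' = tr ` q" using finite_subset_image[OF q'(2,1)] by blast
    then obtain b where "b \<in> univ (Z i)" "\<forall>\<phi>\<in>q. sat (dunion n Z) ((!) (xs @ [b])) \<phi>" using fini by blast
    then show ?thesis using tr q by blast
  qed
  then obtain b where b: "b \<in> univ (Z i)" "\<forall>\<phi>\<in>tr ` p. sat (Z i) ((!) (ys @ [b])) \<phi>"
    using sat[OF i, unfolded omega_saturated_def, rule_format, of ys "tr ` p"] ysZ trf by auto
  then have "\<forall>\<phi>\<in>p. sat (dunion n Z) ((!) (xs @ [b])) \<phi>" using tr by blast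
  moreover have "b \<in> univ (dunion n Z)" using b(1) i by (auto simp: univ_dunion)
  ultimately show "\<exists>b\<in>univ (dunion n Z). \<forall>\<phi>\<in>p. sat (dunion n Z) ((!) (xs @ [b])) \<phi>" by blast
qed

section \<open>Finite disjoint unions of structures of finite diameter\<close>

theorem theorem5p1:
  fixes n m :: nat
    and X :: "nat \<Rightarrow> 'a struc"
    and XX :: "'a struc"
    and T :: "form set"
    and Ti :: "nat \<Rightarrow> form set"
    and \<kappa> :: "(nat \<Rightarrow> nat struc set) rel"
  assumes "n \<ge> 1"
    and "\<forall>i<n. is_struc (X i)"
    and "disjoint_strucs n X"
    and "\<forall>i<n. diameter_le (X i) m"
    and "XX = dunion n X"
    and "T = Th XX"
    and "\<forall>i<n. Ti i = Th (X i)"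
    and "\<kappa> = card_Prod n (\<lambda>i. num_models (Ti i))"
  shows "
     \<comment> \<open>(a)\<close>
     (univ XX // rel_rst XX = {univ (X i) | i. i < n} \<and>
     rel_rst XX = {(x, y). [x, y] \<in> defset 2 (eps m) XX}) \<and>
     \<comment> \<open>(b)\<close>
     (\<forall>Y :: 'b struc. is_struc Y \<longrightarrow>
       (elem_equiv Y XX \<longleftrightarrow>
        (\<exists>Z. (\<forall>i<n. is_struc (Z i) \<and> elem_equiv (Z i) (X i)) \<and> disjoint_strucs n Z \<and>
             Y = dunion n Z))) \<and>
     \<comment> \<open>(c)\<close>
     (\<forall>E :: 'a struc. is_struc E \<longrightarrow>
       (elem_substruc E XX \<longleftrightarrow>
        (\<exists>Z. (\<forall>i<n. elem_substruc (Z i) (X i)) \<and> E = dunion n Z))) \<and>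
     \<comment> \<open>(d)\<close>
     (card_Max ((\<lambda>i. num_models (Ti i)) ` {..<n}) \<le>o num_models T \<and>
     num_models T \<le>o card_Prod n (\<lambda>i. num_models (Ti i)) \<and>
     (num_models T =o cone \<longleftrightarrow> (\<forall>i<n. num_models (Ti i) =o cone))) \<and>
     \<comment> \<open>(e)\<close>
     ((\<forall>i<n. Vaught_conjecture (Ti i)) \<longrightarrow>
       Vaught_conjecture T \<and>
       (if \<kappa> =o cone \<or> \<kappa> =o natLeq \<or> \<kappa> =o continuum
        then num_models T =o \<kappa>
        else |{..<3 :: nat}| \<le>o num_models T \<and> num_models T <o natLeq)) \<and>
     \<comment> \<open>(f)\<close>
     ((atomic_theory T \<longleftrightarrow> (\<forall>i<n. atomic_theory (Ti i))) \<and>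
     (atomic_theory T \<longrightarrow>
       (\<forall>i<n. \<exists>A :: nat struc. countable_atomic_model (Ti i) A) \<and>
       (\<forall>Z :: nat \<Rightarrow> 'b struc.
          (\<forall>i<n. countable_atomic_model (Ti i) (Z i)) \<and> disjoint_strucs n Z \<longrightarrow>
          countable_atomic_model T (dunion n Z)))) \<and>
     \<comment> \<open>(g)\<close>
     ((small_theory T \<longleftrightarrow> (\<forall>i<n. small_theory (Ti i))) \<and>
     (small_theory T \<longrightarrow>
       (\<forall>i<n. \<exists>A :: nat struc. countably_saturated_model (Ti i) A) \<and>
       (\<forall>Z :: nat \<Rightarrow> 'b struc.
          (\<forall>i<n. countably_saturated_model (Ti i) (Z i)) \<and> disjoint_strucs n Z \<longrightarrow>
          countably_saturated_model T (dunion n Z))))"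
proof -
  have n: "n \<ge> 1" by fact
  have C: "comps n X" using assms(2,3) by (simp add: comps_def)
  have X: "conn_comps n m X" using C assms(4) by (simp add: conn_comps_def diameter_le_iff_conn)
  note XX = assms(5)
  have T: "T = Th (dunion n X)" using assms(5,6) by simp
  have Ti: "Ti i = Th (X i)" if "i < n" for i using assms(7) that by blast
  have SX: "is_struc (X i)" if "i < n" for i using comps_struc[OF C that] .
  have S: "is_struc (dunion n X)" by (rule dunion_struc[OF C n])
  have a1: "univ XX // rel_rst XX = {univ (X i) | i. i < n}" unfolding XX by (rule quotient_rel_rst[OF X n])
  have a2: "rel_rst XX = {(x, y). [x, y] \<in> defset 2 (eps m) XX}" unfolding XX by (rule rel_rst_defset[OF X n])
  have b: "\<forall>Y :: 'b struc. is_struc Y \<longrightarrow>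
       (elem_equiv Y XX \<longleftrightarrow>
        (\<exists>Z. (\<forall>i<n. is_struc (Z i) \<and> elem_equiv (Z i) (X i)) \<and> disjoint_strucs n Z \<and>
             Y = dunion n Z))"
  proof (intro allI impI)
    fix Y :: "'b struc" assume Y: "is_struc Y"
    have "conn_comps n m Z \<and> (\<forall>i<n. Th (Z i) = Th (X i)) \<longleftrightarrow>
        (\<forall>i<n. is_struc (Z i) \<and> elem_equiv (Z i) (X i)) \<and> disjoint_strucs n Z" for Z :: "nat \<Rightarrow> 'b struc"
      using conn_comps_cong[OF X, of Z] by (auto simp: conn_comps_def comps_def elem_equiv_def)
    then show "elem_equiv Y XX \<longleftrightarrow>
        (\<exists>Z. (\<forall>i<n. is_struc (Z i) \<and> elem_equiv (Z i) (X i)) \<and> disjoint_strucs n Z \<and> Y = dunion n Z)"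
      using models_of_union[OF X n Y] unfolding elem_equiv_def XX by blast
  qed
  have c: "\<forall>E :: 'a struc. is_struc E \<longrightarrow>
       (elem_substruc E XX \<longleftrightarrow>
        (\<exists>Z. (\<forall>i<n. elem_substruc (Z i) (X i)) \<and> E = dunion n Z))"
    unfolding XX using elem_substruc_of_union[OF X n] by blast
  let ?Q = "\<lambda>i. Mods (X i) // iso_rel" and ?M = "Mods (dunion n X) // iso_rel"
  let ?P = "\<Pi>\<^sub>E i\<in>{..<n}. ?Q i"
  have Q: "num_models (Ti i) =o |?Q i|" if "i < n" for i
    unfolding Ti[OF that] by (rule num_models_eq[OF SX[OF that]])
  have M: "num_models T =o |?M|" unfolding T by (rule num_models_eq[OF S])
  have Qne: "?Q i \<noteq> {}" if "i < n" for i by (rule quotient_iso_nonempty[OF SX[OF that]])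
  have Mne: "?M \<noteq> {}" by (rule quotient_iso_nonempty[OF S])
  have low: "|?Q i| \<le>o |?M|" if "i < n" for i by (rule num_models_lower[OF X n that])
  have up: "|?M| \<le>o |?P|" by (rule num_models_upper[OF X n])
  have prod: "card_Prod n (\<lambda>i. num_models (Ti i)) =o |?P|"
  proof -
    have F: "|Field (num_models (Ti i))| =o |?Q i|" if "i < n" for i
      using card_of_Field_ordIso[OF Card_order_ordIso[OF card_of_Card_order Q[OF that]]] Q[OF that]
      by (rule ordIso_transitive)
    show ?thesis
      unfolding card_Prod_def ordIso_iff_ordLeq
      using F ordIso_iff_ordLeq by (intro conjI PiE_card_mono) blast+
  qed
  have d1: "card_Max ((\<lambda>i. num_models (Ti i)) ` {..<n}) \<le>o num_models T"
  proof -
    have "card_Max ((\<lambda>i. num_models (Ti i)) ` {..<n}) \<in> (\<lambda>i. num_models (Ti i)) ` {..<n}"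
    proof (rule card_Max_mem)
      show "Well_order r" if "r \<in> (\<lambda>i. num_models (Ti i)) ` {..<n}" for r
        using that Q by (auto simp: ordIso_def)
    qed (use n in \<open>auto simp: lessThan_empty_iff\<close>)
    then obtain i where i: "i < n" "card_Max ((\<lambda>i. num_models (Ti i)) ` {..<n}) = num_models (Ti i)" by auto
    have "num_models (Ti i) \<le>o |?M|" using Q[OF i(1)] low[OF i(1)] by (rule ordIso_ordLeq_trans)
    then show ?thesis unfolding i(2) using ordIso_symmetric[OF M] by (rule ordLeq_ordIso_trans)
  qed
  have d2: "num_models T \<le>o card_Prod n (\<lambda>i. num_models (Ti i))"
    using ordLeq_ordIso_trans[OF ordIso_ordLeq_trans[OF M up] ordIso_symmetric[OF prod]] .
  have one: "r =o cone \<longleftrightarrow> (\<exists>x. A = {x})" if "r =o |A|" for r :: "nat struc set rel" and A :: "nat struc set set"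
    unfolding card_cone_iff[symmetric]
    by (rule iffI, erule ordIso_transitive[OF ordIso_symmetric[OF that]], erule ordIso_transitive[OF that])
  have d3: "num_models T =o cone \<longleftrightarrow> (\<forall>i<n. num_models (Ti i) =o cone)"
  proof
    assume "num_models T =o cone"
    then obtain x where x: "?M = {x}" using one[OF M] by blast
    show "\<forall>i<n. num_models (Ti i) =o cone"
    proof (intro allI impI)
      fix i assume i: "i < n"
      obtain f where f: "inj_on f (?Q i)" "f ` ?Q i \<subseteq> {x}"
        using low[OF i] unfolding x card_of_ordLeq[symmetric] by blast
      obtain y where y: "y \<in> ?Q i" using Qne[OF i] by (auto simp only: ex_in_conv[symmetric])
      have "z = y" if "z \<in> ?Q i" for z
        using inj_onD[OF f(1) _ that y] f(2) that y by (metis imageI singletonD subsetD)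
      then have "?Q i = {y}" using y by blast
      then show "num_models (Ti i) =o cone" using one[OF Q[OF i]] by blast
    qed
  next
    assume "\<forall>i<n. num_models (Ti i) =o cone"
    then have "\<exists>x. ?Q i = {x}" if "i < n" for i using one[OF Q[OF that]] that by blast
    then obtain q where q: "\<And>i. i < n \<Longrightarrow> ?Q i = {q i}" by metis
    obtain f where f: "inj_on f ?M" "f ` ?M \<subseteq> ?P" using up unfolding card_of_ordLeq[symmetric] by blast
    have eq: "g = g'" if "g \<in> ?P" "g' \<in> ?P" for g g'
      using that q by (intro PiE_ext[OF that]) (metis PiE_mem lessThan_iff singletonD)
    obtain y where y: "y \<in> ?M" using Mne by (auto simp only: ex_in_conv[symmetric])
    have "z = y" if "z \<in> ?M" for z using f eq[of "f z" "f y"] that y by (auto dest: inj_onD)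
    then have "?M = {y}" using y by blast
    then show "num_models T =o cone" using one[OF M] by blast
  qed
  have e: "(\<forall>i<n. Vaught_conjecture (Ti i)) \<longrightarrow>
       Vaught_conjecture T \<and>
       (if \<kappa> =o cone \<or> \<kappa> =o natLeq \<or> \<kappa> =o continuum
        then num_models T =o \<kappa>
        else |{..<3 :: nat}| \<le>o num_models T \<and> num_models T <o natLeq)"
  proof
    assume V: "\<forall>i<n. Vaught_conjecture (Ti i)"
    have VQ: "|?Q i| \<le>o natLeq \<or> |?Q i| =o continuum" if i: "i < n" for i
    proof -
      have "num_models (Ti i) \<le>o natLeq \<or> num_models (Ti i) =o continuum"
        using V i by (simp add: Vaught_conjecture_def)
      then show ?thesis
        using ordIso_ordLeq_trans[OF ordIso_symmetric[OF Q[OF i]]]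
          ordIso_transitive[OF ordIso_symmetric[OF Q[OF i]]] by blast
    qed
    have \<kappa>: "\<kappa> =o |?P|" unfolding assms(8) by (rule prod)
    have main: "( |?M| \<le>o natLeq \<or> |?M| =o continuum) \<and>
      (if \<kappa> =o cone \<or> \<kappa> =o natLeq \<or> \<kappa> =o continuum then |?M| =o \<kappa>
       else |{..<3 :: nat}| \<le>o |?M| \<and> |?M| <o natLeq)"
    proof (rule between_factors_and_product[OF Qne Mne low up \<kappa> _ VQ])
      show "|{..<3 :: nat}| \<le>o |?Q i|" if "i < n" "countable (?Q i)" "\<not> |?Q i| =o cone" for i
        by (rule three_le_quotient[OF SX[OF that(1)] that(2,3)])
    qed
    have M': "|?M| =o num_models T" by (rule ordIso_symmetric[OF M])
    have "Vaught_conjecture T"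
      unfolding Vaught_conjecture_def
      using main ordIso_ordLeq_trans[OF M] ordIso_transitive[OF M] by blast
    moreover have "|?M| =o \<kappa> \<Longrightarrow> num_models T =o \<kappa>" by (rule ordIso_transitive[OF M])
    moreover have "|{..<3 :: nat}| \<le>o |?M| \<Longrightarrow> |{..<3 :: nat}| \<le>o num_models T"
      by (rule ordLeq_ordIso_trans[OF _ M'])
    moreover have "|?M| <o natLeq \<Longrightarrow> num_models T <o natLeq" by (rule ordIso_ordLess_trans[OF M])
    ultimately show "Vaught_conjecture T \<and>
       (if \<kappa> =o cone \<or> \<kappa> =o natLeq \<or> \<kappa> =o continuum
        then num_models T =o \<kappa>
        else |{..<3 :: nat}| \<le>o num_models T \<and> num_models T <o natLeq)"
      using main by (auto split: if_splits)
  qed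
  have conn_of: "conn_comps n m Z" if "\<forall>i<n. models (Z i) (Ti i)" "disjoint_strucs n Z" for Z :: "nat \<Rightarrow> 'b struc"
  proof (rule conn_comps_cong[OF X])
    have Z: "is_struc (Z i) \<and> Th (Z i) = Th (X i)" if i: "i < n" for i
    proof -
      have "models (Z i) (Ti i)" using \<open>\<forall>i<n. models (Z i) (Ti i)\<close> i by blast
      then show ?thesis unfolding Ti[OF i] models_Th_iff[OF SX[OF i]] .
    qed
    then show "comps n Z" using that(2) by (simp add: comps_def)
    show "Th (Z i) = Th (X i)" if "i < n" for i using Z[OF that] by blast
  qed
  have models_union: "models (dunion n Z) T"
    if Z: "\<forall>i<n. models (Z i) (Ti i)" "conn_comps n m Z" for Z :: "nat \<Rightarrow> 'b struc"
  proof -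
    have "Th (Z i) = Th (X i)" if i: "i < n" for i
    proof -
      have "models (Z i) (Ti i)" using Z(1) i by blast
      then show ?thesis unfolding Ti[OF i] models_Th_iff[OF SX[OF i]] by blast
    qed
    then have "Th (dunion n Z) = T" unfolding T by (rule Th_dunion_cong[OF n comps_of_conn[OF Z(2)] C])
    then show ?thesis using models_Th_iff[OF S, of "dunion n Z"] dunion_struc[OF comps_of_conn[OF Z(2)] n] T by simp
  qed
  have f1: "atomic_theory T \<longleftrightarrow> (\<forall>i<n. atomic_theory (Ti i))"
    using union_atomic_theory[OF X n] component_atomic_theory[OF X n] Ti unfolding T by metis
  have f2: "atomic_theory T \<longrightarrow>
       (\<forall>i<n. \<exists>A :: nat struc. countable_atomic_model (Ti i) A) \<and>
       (\<forall>Z :: nat \<Rightarrow> 'b struc.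
          (\<forall>i<n. countable_atomic_model (Ti i) (Z i)) \<and> disjoint_strucs n Z \<longrightarrow>
          countable_atomic_model T (dunion n Z))"
  proof (intro impI conjI allI)
    fix i assume "atomic_theory T" and i: "i < n"
    then have "atomic_theory (Th (X i))" using f1 i Ti[OF i] by metis
    then show "\<exists>A :: nat struc. countable_atomic_model (Ti i) A"
      unfolding Ti[OF i] by (rule countable_atomic_model_exists[OF SX[OF i]])
  next
    fix Z :: "nat \<Rightarrow> 'b struc"
    assume Z: "(\<forall>i<n. countable_atomic_model (Ti i) (Z i)) \<and> disjoint_strucs n Z"
    then have ZM: "\<forall>i<n. models (Z i) (Ti i)" by (simp add: countable_atomic_model_def)
    have ZC: "conn_comps n m Z" using conn_of[OF ZM] Z by blast
    have "atomic_model (dunion n Z)"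
      by (rule union_atomic_model[OF ZC n]) (use Z in \<open>simp add: countable_atomic_model_def\<close>)
    moreover have "countable (univ (dunion n Z))"
      using Z by (auto simp: univ_dunion countable_atomic_model_def)
    ultimately show "countable_atomic_model T (dunion n Z)"
      using models_union[OF ZM ZC] by (simp add: countable_atomic_model_def)
  qed
  have g1: "small_theory T \<longleftrightarrow> (\<forall>i<n. small_theory (Ti i))"
    using union_small[OF X n] component_small[OF X n] Ti unfolding T by metis
  have g2: "small_theory T \<longrightarrow>
       (\<forall>i<n. \<exists>A :: nat struc. countably_saturated_model (Ti i) A) \<and>
       (\<forall>Z :: nat \<Rightarrow> 'b struc.
          (\<forall>i<n. countably_saturated_model (Ti i) (Z i)) \<and> disjoint_strucs n Z \<longrightarrow>
          countably_saturated_model T (dunion n Z))"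
  proof (intro impI conjI allI)
    fix i assume "small_theory T" and i: "i < n"
    then have "small_theory (Th (X i))" using g1 i Ti[OF i] by metis
    then show "\<exists>A :: nat struc. countably_saturated_model (Ti i) A"
      unfolding Ti[OF i] by (rule countably_saturated_model_exists[OF SX[OF i]])
  next
    fix Z :: "nat \<Rightarrow> 'b struc"
    assume Z: "(\<forall>i<n. countably_saturated_model (Ti i) (Z i)) \<and> disjoint_strucs n Z"
    then have ZM: "\<forall>i<n. models (Z i) (Ti i)" by (simp add: countably_saturated_model_def)
    have ZC: "conn_comps n m Z" using conn_of[OF ZM] Z by blast
    have "omega_saturated (dunion n Z)"
      by (rule union_saturated[OF comps_of_conn[OF ZC]]) (use Z in \<open>simp add: countably_saturated_model_def\<close>)
    moreover have "countable (univ (dunion n Z))"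
      using Z by (auto simp: univ_dunion countably_saturated_model_def)
    ultimately show "countably_saturated_model T (dunion n Z)"
      using models_union[OF ZM ZC] by (simp add: countably_saturated_model_def)
  qed
  show ?thesis by (intro conjI a1 a2 b c d1 d2 d3 e f1 f2 g1 g2)
qed

end
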